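(* Let $I$ be a finite set with $\kappa=\#I\ge 2$ and suppose that for each $i\in I$ there is an invertible matrix $A_i\in\mathbb{R}^{d\times d}$ with $\|A_i\|<\tfrac12$. Let $K\subset I^\infty$ be a nonempty compact set with $\sigma(K)\subset K$, let $s\ge 0$ satisfy $P_K(s)=0$, and let $\mu$ be an ergodic $(K,s)$-equilibrium measure. Then for $\mathcal{L}^{d\kappa}$-almost every choice of $a=(a_i)_{i\in I}\in\mathbb{R}^{d\kappa}$, where $a_i\in\mathbb{R}^d$ are translation vectors, $$\dim_{\mathrm H}(E_K)=\dim_{\mathrm H}(\mu\circ\pi_a^{-1})=\min\{s,d\},$$ where $E_K=\pi_a(K)$.
   Context: $I^\infty=I^{\mathbb{N}}$ carries the (compact, metrizable) product topology of the discrete set $I$, and $\sigma(i_1,i_2,\ldots)=(i_2,i_3,\ldots)$ is the left shift. For $\mathtt{i}\in I^\infty$, $\mathtt{i}|_n\in I^n$ is its initial word of length $n$ ($\mathtt{i}|_0$ is the empty word); for $\mathtt{i}\in I^n$, $[\mathtt{i}]=\{\mathtt{j}\in I^\infty:\mathtt{j}|_n=\mathtt{i}\}$ is the cylinder and $A_{\mathtt{i}}=A_{i_1}\cdots A_{i_n}$ (identity for the empty word). For $K\subset I^\infty$, $K_n=\{\mathtt{i}|_n:\mathtt{i}\in K\}$. $\|\cdot\|$ is the Euclidean operator norm and $\alpha_1(A)\ge\cdots\ge\alpha_d(A)>0$ are the singular values of an invertible $A\in\mathbb{R}^{d\times d}$. The singular value function is $\varphi^t(A)=\alpha_1(A)\cdots\alpha_l(A)\,\alpha_{l+1}(A)^{t-l}$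 for $0\le t<d$, $l=\lfloor t\rfloor$, and $\varphi^t(A)=|\det A|^{t/d}$ for $t\ge d$. For nonempty $K$ with $\sigma(K)\subset K$, the topological pressure is $P_K(t)=\lim_{n\to\infty}\frac1n\log\sum_{\mathtt{i}\in K_n}\varphi^t(A_{\mathtt{i}})$, $t\ge0$ (the limit exists by subadditivity). $\mathcal{M}_\sigma(K)$ is the set of $\sigma$-invariant Borel probability measures on $I^\infty$ whose support is contained in $K$; ergodic means ergodic with respect to $\sigma$. For $\mu\in\mathcal{M}_\sigma(K)$, with $H(x)=-x\log x$ for $0<x\le1$ and $H(0)=0$, the entropy is $h(\mu)=\lim_{n\to\infty}\frac1n\sum_{\mathtt{i}\in I^n}H(\mu([\mathtt{i}]))$ and the $t$-energy is $\Lambda^t(\mu)=\lim_{n\to\infty}\frac1n\sum_{\mathtt{i}\in I^n}\mu([\mathtt{i}])\log\varphi^t(A_{\mathtt{i}})$ (both limits exist). A measure $\mu\in\mathcal{M}_\sigma(K)$ is a $(K,t)$-equilibrium measure if $P_K(t)=h(\mu)+\Lambda^t(\mu)$. For $a=(a_i)_{i\in I}\in\mathbb{R}^{d\kappa}$, the projection $\pi_a:I^\infty\to\mathbb{R}^d$ is $\pi_a(\mathtt{i})=\sum_{n=1}^\infty A_{\mathtt{i}|_{n-1}}a_{i_n}$ for $\mathtt{i}=(i_1,i_2,\ldots)$. $\mathcal{L}^{n}$ is $n$-dimensional Lebesgue measure. $\dim_{\mathrm H}$ of a set is Hausdorff dimension; for a Borel probability measure $m$ on $\mathbb{R}^d$,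 $\dim_{\mathrm H}(m)=\inf\{\dim_{\mathrm H}(B): B\subset\mathbb{R}^d\text{ Borel},\ m(B)>0\}$. *)

theory Defs
  imports
    "HOL-Analysis.Analysis"
    "HOL-Probability.Probability_Measure"
    "HOL-Computational_Algebra.Polynomial"
begin

text \<open>
  The alphabet $I$ is the universe of a finite type \<open>'i\<close>, and $d$ is \<open>CARD('d)\<close>.  The class
  \<open>discrete_topology\<close> on \<open>'i\<close> makes the library's topology on \<open>nat \<Rightarrow> 'i\<close> the product of discrete
  topologies, so \<open>compact\<close>, \<open>open\<close> and \<open>borel\<close> below are those of $I^\infty$.  Sequences are
  indexed from 0, and words of length $n$ are lists of length $n$.
\<close>

subsection \<open>Symbolic space\<close>

definition shift :: "(nat \<Rightarrow> 'i) \<Rightarrow> nat \<Rightarrow> 'i"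
  where "shift x = (\<lambda>n. x (Suc n))"

definition init_word :: "nat \<Rightarrow> (nat \<Rightarrow> 'i) \<Rightarrow> 'i list"
  where "init_word n x = map x [0..<n]"

definition cylinder :: "'i list \<Rightarrow> (nat \<Rightarrow> 'i) set"
  where "cylinder w = {x. init_word (length w) x = w}"

definition words :: "nat \<Rightarrow> 'i list set"
  where "words n = {w. length w = n}"

primrec word_mat :: "('i \<Rightarrow> real^'d^'d) \<Rightarrow> 'i list \<Rightarrow> real^'d^'d"
  where
    "word_mat A [] = mat 1"
  | "word_mat A (i # w) = A i ** word_mat A w"


subsection \<open>Singular values and the singular value function\<close>

definition char_poly_mat :: "real^'d^'d \<Rightarrow> real poly"
  where "char_poly_mat M = det (mat [:0, 1:] - map_matrix (\<lambda>c. [:c:]) M)"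

text \<open>
  The singular values of $A$ are the square roots of the eigenvalues of $A^T A$, repeated according
  to multiplicity and listed in decreasing order; \<open>singular_value k A\<close> is $\alpha_k(A)$ for
  $1 \le k \le d$.
\<close>

definition singular_values :: "real^'d^'d \<Rightarrow> real list"
  where "singular_values A =
    rev (sorted_list_of_multiset (image_mset sqrt (proots (char_poly_mat (transpose A ** A)))))"

definition singular_value :: "nat \<Rightarrow> real^'d^'d \<Rightarrow> real"
  where "singular_value k A = singular_values A ! (k - 1)"

definition sv_fun :: "real \<Rightarrow> real^'d^'d \<Rightarrow> real"
  where "sv_fun t A =
    (if t < real CARD('d)
     then (let l = nat \<lfloor>t\<rfloor> in
             (\<Prod>k = 1..l. singular_value k A) * singular_value (l + 1) A powr (t - real l))
     else \<bar>det A\<bar> powr (t / real CARD('d)))"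


subsection \<open>Pressure, entropy, energy and equilibrium measures\<close>

definition pressure :: "('i \<Rightarrow> real^'d^'d) \<Rightarrow> (nat \<Rightarrow> 'i) set \<Rightarrow> real \<Rightarrow> real"
  where "pressure A K t =
    lim (\<lambda>n. 1 / real n * ln (\<Sum>w \<in> init_word n ` K. sv_fun t (word_mat A w)))"

definition measure_support :: "'a::topological_space measure \<Rightarrow> 'a set"
  where "measure_support m = {x. \<forall>U. open U \<and> x \<in> U \<longrightarrow> emeasure m U > 0}"

definition invariant_measures ::
    "(nat \<Rightarrow> 'i::{finite, discrete_topology}) set \<Rightarrow> (nat \<Rightarrow> 'i) measure set"
  where "invariant_measures K =
    {\<mu>. prob_space \<mu> \<and> sets \<mu> = sets borel \<and> distr \<mu> borel shift = \<mu> \<and> measure_support \<mu> \<subseteq> K}"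

definition ergodic :: "(nat \<Rightarrow> 'i::{finite, discrete_topology}) measure \<Rightarrow> bool"
  where "ergodic \<mu> \<longleftrightarrow>
    (\<forall>B \<in> sets borel. shift -` B = B \<longrightarrow> measure \<mu> B = 0 \<or> measure \<mu> B = 1)"

definition H :: "real \<Rightarrow> real"
  where "H x = (if x = 0 then 0 else - x * ln x)"

definition entropy :: "(nat \<Rightarrow> 'i::{finite, discrete_topology}) measure \<Rightarrow> real"
  where "entropy \<mu> = lim (\<lambda>n. 1 / real n * (\<Sum>w \<in> words n. H (measure \<mu> (cylinder w))))"

definition energy ::
    "('i \<Rightarrow> real^'d^'d) \<Rightarrow> real \<Rightarrow> (nat \<Rightarrow> 'i::{finite, discrete_topology}) measure \<Rightarrow> real"
  where "energy A t \<mu> =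
    lim (\<lambda>n. 1 / real n *
      (\<Sum>w \<in> words n. measure \<mu> (cylinder w) * ln (sv_fun t (word_mat A w))))"

definition equilibrium_measure ::
    "('i \<Rightarrow> real^'d^'d) \<Rightarrow> (nat \<Rightarrow> 'i::{finite, discrete_topology}) set \<Rightarrow> real \<Rightarrow>
      (nat \<Rightarrow> 'i) measure \<Rightarrow> bool"
  where "equilibrium_measure A K t \<mu> \<longleftrightarrow>
    \<mu> \<in> invariant_measures K \<and> pressure A K t = entropy \<mu> + energy A t \<mu>"


subsection \<open>Projection\<close>

definition proj :: "('i::finite \<Rightarrow> real^'d^'d) \<Rightarrow> real^'d^'i \<Rightarrow> (nat \<Rightarrow> 'i) \<Rightarrow> real^'d"
  where "proj A a x = (\<Sum>n. word_mat A (init_word n x) *v (a $ x n))"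


subsection \<open>Hausdorff dimension\<close>

text \<open>
  $(\mathrm{diam}\,U)^s$ for bounded $U$, with $0^0 = 1$ for nonempty $U$ and with value 0 for the
  empty set (the library has \<open>0 powr 0 = 0\<close>).
\<close>

definition diam_power :: "real \<Rightarrow> 'a::metric_space set \<Rightarrow> ennreal"
  where "diam_power s U =
    (if U = {} then 0 else if s = 0 then 1 else ennreal (diameter U powr s))"

text \<open>
  The boundedness condition is needed because \<open>diameter\<close> is meaningless on unbounded sets.  Covers by
  finitely many sets are included, since the \<open>U n\<close> may be empty.
\<close>

definition hausdorff_premeasure :: "real \<Rightarrow> real \<Rightarrow> 'a::metric_space set \<Rightarrow> ennreal"
  where "hausdorff_premeasure s \<delta> E =
    (INF U \<in> {U :: nat \<Rightarrow> 'a set. E \<subseteq> (\<Union>n. U n) \<and> (\<forall>n. bounded (U n) \<and> diameter (U n) \<le> \<delta>)}.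
      \<Sum>n. diam_power s (U n))"

definition hausdorff_measure :: "real \<Rightarrow> 'a::metric_space set \<Rightarrow> ennreal"
  where "hausdorff_measure s E = (SUP \<delta> \<in> {0<..}. hausdorff_premeasure s \<delta> E)"

definition hausdorff_dim :: "'a::metric_space set \<Rightarrow> ennreal"
  where "hausdorff_dim E = (INF s \<in> {s. 0 \<le> s \<and> hausdorff_measure s E = 0}. ennreal s)"

definition hausdorff_dim_measure :: "'a::metric_space measure \<Rightarrow> ennreal"
  where "hausdorff_dim_measure m =
    (INF B \<in> {B \<in> sets borel. emeasure m B > 0}. hausdorff_dim B)"

end

theory Submission
  imports Defs "HOL-Library.Sublist"
begin

text \<open>
  Write \<open>p w\<close> for the measure of the cylinder of a word \<open>w\<close>,
  \<open>\<phi> w\<close> for the value of the singular value function of exponent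
  \<open>s\<close> at the matrix of \<open>w\<close>, \<open>d\<close> for
  \<open>CARD('d)\<close>, and let \<open>\<eta> < 1/2\<close> bound the norms of the matrices.

  \<^bold>\<open>Covers instead of singular values.\<close> For a matrix \<open>A\<close> let
  \<open>cover_content t A\<close> be the infimum of \<open>N r^t\<close> over all covers of the
  ellipsoid \<open>A(B(0,1))\<close> by \<open>N\<close> balls of one radius \<open>r\<close>. A
  grid along the axes of the ellipsoid shows that about \<open>\<Prod>k. max 1 (\<alpha>\<^sub>k /
  r)\<close> balls are needed, and \<open>r^t\<close> times this product is smallest at \<open>r =
  \<alpha>\<^sub>l\<^sub>+\<^sub>1\<close>, \<open>l = \<lfloor>t\<rfloor>\<close>, where it is
  the singular value function. So the two quantities are comparable for \<open>t < d\<close>, with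
  constants that depend on \<open>d\<close> and \<open>t\<close> only. The content is
  submultiplicative because covers can be composed; hence the singular value function is
  submultiplicative up to a constant. By Fekete's lemma this gives the limits that define pressure
  and energy; the limit for the entropy comes from the subadditivity of entropy.

  \<^bold>\<open>Upper bound.\<close> The set \<open>\<pi>(K)\<close> is a union of translates of
  subsets of \<open>A\<^sub>w(B(0,R))\<close> with \<open>w\<close> in \<open>K\<^sub>n\<close>.
  If \<open>s < t\<close> and \<open>s < d\<close>, the sum of \<open>cover_content t\<close> over
  \<open>K\<^sub>n\<close> is at most \<open>\<eta>^(n (t - s))\<close> times a sum that grows
  subexponentially, as \<open>P_K(s) = 0\<close>, so near-optimal covers show that the
  \<open>t\<close>-dimensional Hausdorff measure of \<open>\<pi>(K)\<close> vanishes
  (\<open>hausdorff_dim_proj_le\<close>). If \<open>s \<ge> d\<close>, the bound \<open>d\<close>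
  holds for every bounded set.

  \<^bold>\<open>A local bound for the equilibrium measure.\<close> For almost every
  \<open>x\<close> and every \<open>\<epsilon> > 0\<close> there is \<open>B\<close> with \<open>p
  (x|n) \<le> B e^(\<epsilon> n) \<phi> (x|n)\<close> for all \<open>n\<close>
  (\<open>equilibrium_local_upper_bound\<close>). By ergodicity, otherwise almost every
  \<open>x\<close> has arbitrarily long initial words \<open>w\<close> with \<open>p w >
  e^(\<epsilon> |w|) \<phi> w\<close>. Choose finitely many of them with disjoint cylinders of
  total measure close to 1; as the measures add up to at most 1, \<open>\<Sum> e^(\<epsilon> |w|)
  \<phi> w \<le> 1\<close> for these words. By invariance, at least half of the measure is carried
  by words of length \<open>n\<close> that are, up to a small proportion of single letters,
  concatenations of the chosen words, and submultiplicativity bounds the sum of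
  \<open>\<phi>\<close> over all such concatenations by \<open>e^(-\<epsilon> n / 2)\<close>
  (\<open>parsing_bound\<close>). The entropy plus energy of such a measure would be negative by
  Gibbs' inequality, whereas at an equilibrium it is 0.

  \<^bold>\<open>Transversality.\<close> Let \<open>x\<close> and \<open>y\<close> first differ at
  position \<open>n\<close>. The difference of their projections is \<open>A\<^sub>w\<close>,
  \<open>w = x|n\<close>, applied to a linear function of the translation vectors which, in one of
  the blocks \<open>a\<^sub>i\<close>, is plus or minus the identity up to an error of norm less
  than 1; this uses \<open>\<parallel>A\<^sub>i\<parallel> < 1/2\<close>. If the parameters in a
  ball for which the two projections have distance at most \<open>r\<close> are moved in this
  block along a maximal family of \<open>2 r\<close>-separated points of
  \<open>A\<^sub>w(B(0,1))\<close>, the translates are disjoint. Therefore their Lebesgue measure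
  is at most a constant times \<open>r^u / cover_content u A\<^sub>w\<close>
  (\<open>transversality\<close>).

  \<^bold>\<open>Lower bound.\<close> Let \<open>t < u < min s d\<close>. Since \<open>\<phi>
  (x|n)\<close> is at most a constant times \<open>\<eta>^(n (s - u)) cover_content u\<close>, the
  local bound makes \<open>\<Sum>n. p (x|n) / cover_content u\<close> converge for typical
  \<open>x\<close>. By transversality and Fubini the measure of the ball of radius
  \<open>r\<close> around the projection of \<open>x\<close> is, on average over the parameters,
  at most a constant times \<open>r^u\<close>. Hence it is at most a constant times
  \<open>r^t\<close> for dyadic \<open>r\<close> and almost all parameters, and the mass
  distribution principle gives dimension at least \<open>t\<close> for every Borel set of positive
  measure. The set \<open>\<pi>(K)\<close> is one of these sets, so the two dimensions and
  \<open>min s d\<close> agree.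
\<close>

section \<open>Subadditive sequences\<close>

text \<open>
  Fekete's lemma: adding the constant \<open>C\<close> makes the sequence subadditive, and then
  dividing \<open>n\<close> by an \<open>m\<close> at which \<open>b m / m\<close> is close to its
  infimum shows that \<open>b n / n\<close> is eventually close to the infimum too.
\<close>
lemma fekete_convergent:
  fixes a :: "nat \<Rightarrow> real"
  assumes sub: "\<And>m n. a (m + n) \<le> a m + a n + C"
    and low: "\<And>n. - B * real n - D \<le> a n"
  shows "convergent (\<lambda>n. 1 / real n * a n)"
proof -
  define b where "b n = a n + C" for n
  have bsub: "b (m + n) \<le> b m + b n" for m n
    using sub[of m n] by (simp add: b_def)
  have bmul: "b (q * m + r) \<le> real q * b m + b r" for q m r
  proof (induction q)
    case (Suc q)
    have "b (Suc q * m + r) = b (m + (q * m + r))" by (simp add: add.assoc)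
    also have "\<dots> \<le> b m + b (q * m + r)" by (rule bsub)
    finally show ?case using Suc by (simp add: algebra_simps)
  qed simp
  define S where "S = (\<lambda>n. b n / real n) ` {1..}"
  have lowb: "- B - \<bar>C\<bar> - \<bar>D\<bar> \<le> b n / real n" if "n \<ge> 1" for n
  proof -
    have "(- B - \<bar>C\<bar> - \<bar>D\<bar>) * real n \<le> - B * real n - D + C"
    proof -
      have "\<bar>C\<bar> * 1 \<le> \<bar>C\<bar> * real n" "\<bar>D\<bar> * 1 \<le> \<bar>D\<bar> * real n"
        using that by (intro mult_left_mono; simp)+
      then show ?thesis by (simp add: algebra_simps)
    qed
    also have "\<dots> \<le> b n" using low[of n] by (simp add: b_def)
    finally show ?thesis using that by (simp add: pos_le_divide_eq)
  qed
  have bdd: "bdd_below S" unfolding S_def by (rule bdd_belowI2[of _ "- B - \<bar>C\<bar> - \<bar>D\<bar>"]) (use lowb in auto)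
  define L where "L = Inf S"
  have Lle: "L \<le> b n / real n" if "n \<ge> 1" for n
    unfolding L_def by (rule cInf_lower[OF _ bdd]) (use that in \<open>auto simp: S_def\<close>)
  have lim: "(\<lambda>n. b n / real n) \<longlonglongrightarrow> L"
  proof (rule LIMSEQ_I)
    fix e :: real assume e: "0 < e"
    have "Inf S < L + e / 2" using e by (simp add: L_def)
    then obtain m where m: "m \<ge> 1" "b m / real m < L + e / 2"
      using cInf_lessD[of S "L + e / 2"] unfolding S_def by auto
    define E where "E = \<bar>b m\<bar> + (\<Sum>r<m. \<bar>b r\<bar>)"
    obtain N :: nat where N: "real N > 2 * E / e" using reals_Archimedean2 by blast
    show "\<exists>no. \<forall>n\<ge>no. norm (b n / real n - L) < e"
    proof (intro exI allI impI)
      fix n assume n: "n \<ge> Suc N"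
      define q r where "q = n div m" and "r = n mod m"
      have nqr: "n = q * m + r" and rm: "r < m" using m by (auto simp: q_def r_def)
      have "b n \<le> real q * b m + b r" unfolding nqr by (rule bmul)
      moreover have "real q * b m = real n * (b m / real m) - real r * (b m / real m)"
        using m by (simp add: nqr field_simps)
      moreover have "b r \<le> (\<Sum>r<m. \<bar>b r\<bar>)"
        using rm member_le_sum[of r "{..<m}" "\<lambda>r. \<bar>b r\<bar>"] by auto
      moreover have "- (real r * (b m / real m)) \<le> \<bar>b m\<bar>"
      proof -
        have "- (real r * (b m / real m)) \<le> \<bar>real r / real m * b m\<bar>" 
          using abs_ge_minus_self[of "real r / real m * b m"] by simp
        also have "\<dots> = (real r / real m) * \<bar>b m\<bar>" by (simp add: abs_mult)
        also have "\<dots> \<le> 1 * \<bar>b m\<bar>" using rm m by (intro mult_right_mono) (auto simp: field_simps)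
        finally show ?thesis by simp
      qed
      ultimately have "b n \<le> real n * (b m / real m) + E" unfolding E_def by linarith
      then have "b n / real n \<le> b m / real m + E / real n"
        using n by (simp add: divide_simps split: if_splits) (simp add: algebra_simps)
      also have "E / real n < e / 2"
      proof -
        have "2 * E / e < real n" using N n by linarith
        then show ?thesis using n e by (simp add: field_simps)
      qed
      finally have "b n / real n < L + e" using m by simp
      moreover have "L \<le> b n / real n" using Lle n by simp
      ultimately show "norm (b n / real n - L) < e" by simp
    qed
  qed
  have "(\<lambda>n. b n / real n - C * (1 / real n)) \<longlonglongrightarrow> L - C * 0"
    by (intro tendsto_intros lim lim_1_over_n)
  moreover have "(\<lambda>n. b n / real n - C * (1 / real n)) = (\<lambda>n. 1 / real n * a n)"
    by (auto simp: b_def add_divide_distrib)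
  ultimately show ?thesis by (auto simp: convergent_def)
qed

section \<open>Singular values\<close>

text \<open>
  The spectral theorem on an invariant subspace, by induction on its dimension. A maximum
  \<open>e\<close> of the quadratic form on the unit sphere is an eigenvector, because the first
  variation at \<open>e\<close> forces \<open>f e\<close> to be orthogonal to everything
  orthogonal to \<open>e\<close>; self-adjointness makes the orthogonal complement of
  \<open>e\<close> invariant.
\<close>
lemma selfadjoint_eigenbasis:
  fixes f :: "'a::euclidean_space \<Rightarrow> 'a"
  assumes lin: "linear f" and sa: "\<And>x y. x \<bullet> f y = f x \<bullet> y"
    and "subspace S" "f ` S \<subseteq> S"
  shows "\<exists>B. B \<subseteq> S \<and> finite B \<and> card B = dim S \<and> pairwise orthogonal B \<and>
           (\<forall>b\<in>B. norm b = 1 \<and> (\<exists>l. f b = l *\<^sub>R b))"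
  using assms(3,4)
proof (induction "dim S" arbitrary: S)
  case 0
  then show ?case by (intro exI[of _ "{}"]) auto
next
  case (Suc n)
  interpret f: linear f by (rule lin)
  have sphne: "S \<inter> sphere 0 1 \<noteq> {}"
  proof -
    obtain x where x: "x \<in> S" "x \<noteq> 0"
      using Suc.hyps(2) by (metis dim_eq_0 nat.distinct(1) subsetI singletonI)
    have "x /\<^sub>R norm x \<in> S" using x Suc.prems(1) by (simp add: subspace_scale)
    moreover have "x /\<^sub>R norm x \<in> sphere 0 1" using x by simp
    ultimately show ?thesis by blast
  qed
  have comp: "compact (S \<inter> sphere 0 1)"
    using closed_subspace[OF Suc.prems(1)] by (simp add: closed_Int_compact)
  have cont: "continuous_on (S \<inter> sphere 0 1) (\<lambda>x. x \<bullet> f x)"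
    by (intro continuous_intros linear_continuous_on linear_linear[THEN iffD2] lin)
  obtain e where e: "e \<in> S" "norm e = 1" and max: "\<And>x. x \<in> S \<Longrightarrow> norm x = 1 \<Longrightarrow> x \<bullet> f x \<le> e \<bullet> f e"
    using continuous_attains_sup[OF comp sphne cont] by auto
  define l where "l = e \<bullet> f e"
  have quad: "x \<bullet> f x \<le> l * (x \<bullet> x)" if "x \<in> S" for x
  proof (cases "x = 0")
    case False
    have "(x /\<^sub>R norm x) \<bullet> f (x /\<^sub>R norm x) \<le> l"
      unfolding l_def using that False Suc.prems(1) by (intro max) (auto simp: subspace_scale)
    then have "(x \<bullet> f x) / (norm x)\<^sup>2 \<le> l"
      by (simp add: f.scaleR power2_eq_square divide_inverse mult_ac)
    then show ?thesis using False by (simp add: pos_divide_le_eq power2_norm_eq_inner)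
  qed (simp add: f.zero)
  have orth: "y \<bullet> f e = 0" if y: "y \<in> S" "y \<bullet> e = 0" for y
  proof (rule ccontr)
    assume ne: "y \<bullet> f e \<noteq> 0"
    define c where "c = y \<bullet> f e"
    define k where "k = l * (y \<bullet> y) - y \<bullet> f y"
    \<comment> \<open>The quadratic form at \<open>e + t y\<close> does not exceed
    \<open>l\<close> times the squared norm.\<close>
    have main: "2 * t * c \<le> t\<^sup>2 * k" for t
    proof -
      have "e + t *\<^sub>R y \<in> S" using e y Suc.prems(1) by (simp add: subspace_add subspace_scale)
      note quad[OF this]
      moreover have "(e + t *\<^sub>R y) \<bullet> f (e + t *\<^sub>R y) = l + 2 * t * c + t\<^sup>2 * (y \<bullet> f y)"
        using sa[of e y] by (simp add: f.add f.scaleR inner_simps l_def c_def power2_eq_square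
            inner_commute algebra_simps)
      moreover have "(e + t *\<^sub>R y) \<bullet> (e + t *\<^sub>R y) = 1 + t\<^sup>2 * (y \<bullet> y)"
        using y e by (simp add: inner_simps power2_eq_square inner_commute norm_eq_1)
      ultimately have "l + 2 * t * c + t\<^sup>2 * (y \<bullet> f y) \<le> l * (1 + t\<^sup>2 * (y \<bullet> y))" by simp
      then show ?thesis by (simp add: k_def algebra_simps)
    qed
    \<comment> \<open>Small enough for the linear term \<open>2 t c\<close> to dominate the
    quadratic term \<open>t\<^sup>2 k\<close>.\<close>
    define t where "t = c / (\<bar>k\<bar> + 1)"
    have "t\<^sup>2 * k \<le> t\<^sup>2 * (\<bar>k\<bar> + 1)" by (intro mult_left_mono) auto
    also have "\<dots> = t * c" by (simp add: t_def power2_eq_square)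
    finally have "2 * (t * c) \<le> t * c" using main[of t] by (simp only: mult.assoc)
    moreover have "t * c > 0" using ne by (simp add: t_def c_def flip: power2_eq_square)
    ultimately show False by linarith
  qed
  have ev: "f e = l *\<^sub>R e"
  proof -
    define z where "z = f e - l *\<^sub>R e"
    have zS: "z \<in> S" using e Suc.prems by (auto simp: z_def subspace_diff subspace_scale)
    have ze: "z \<bullet> e = 0" using e by (simp add: z_def inner_simps l_def norm_eq_1 inner_commute)
    have "z \<bullet> z = z \<bullet> f e - l * (z \<bullet> e)" by (simp add: z_def inner_simps)
    then have "z \<bullet> z = 0" using orth[OF zS ze] ze by simp
    then show ?thesis by (simp add: z_def)
  qed
  define S' where "S' = {x \<in> S. e \<bullet> x = 0}"
  have sub': "subspace S'"
    using Suc.prems(1) by (auto simp: S'_def subspace_def inner_simps)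
  have inv': "f ` S' \<subseteq> S'"
    using Suc.prems(2) sa[of e] ev by (auto simp: S'_def)
  have dim': "dim S' = n"
  proof -
    have "dim {y \<in> span S. \<forall>x\<in>span {e}. orthogonal x y} + dim (span {e}) = dim (span S)"
      using dim_subspace_orthogonal_to_vectors[of "span {e}" "span S"] e
      by (simp add: subspace_span span_minimal span_base span_mono)
    moreover have "{y \<in> span S. \<forall>x\<in>span {e}. orthogonal x y} = S'"
    proof -
      have "(\<forall>x\<in>span {e}. orthogonal x y) \<longleftrightarrow> e \<bullet> y = 0" for y
        by (auto simp: span_singleton orthogonal_def)
      moreover have "span S = S" using Suc.prems(1) by (simp add: span_eq_iff)
      ultimately show ?thesis unfolding S'_def by metis
    qed
    moreover have "dim {e} = 1" using e by (auto simp: dim_singleton)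
    ultimately show ?thesis using Suc.hyps(2) by simp
  qed
  obtain B where B: "B \<subseteq> S'" "finite B" "card B = n" "pairwise orthogonal B"
    "\<forall>b\<in>B. norm b = 1 \<and> (\<exists>l. f b = l *\<^sub>R b)"
    using Suc.hyps(1)[OF _ sub' inv'] dim' by auto
  have "e \<notin> B" using B(1) e by (auto simp: S'_def)
  show ?case
  proof (intro exI[of _ "insert e B"] conjI)
    show "pairwise orthogonal (insert e B)"
      using B(1,4) by (auto simp: pairwise_insert S'_def orthogonal_def inner_commute)
    show "card (insert e B) = dim S" using \<open>e \<notin> B\<close> B Suc.hyps(2) by simp
    show "\<forall>b\<in>insert e B. norm b = 1 \<and> (\<exists>l. f b = l *\<^sub>R b)" using B(5) e ev by auto
  qed (use B e in \<open>auto simp: S'_def\<close>)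
qed

lemma symmetric_matrix_eigenbasis:
  fixes M :: "real^'d^'d"
  assumes "transpose M = M"
  obtains e :: "'d \<Rightarrow> real^'d" and l :: "'d \<Rightarrow> real"
  where "\<And>i j. e i \<bullet> e j = (if i = j then 1 else 0)" "\<And>i. M *v e i = l i *\<^sub>R e i"
proof -
  have "\<exists>B. B \<subseteq> UNIV \<and> finite B \<and> card B = dim (UNIV :: (real^'d) set) \<and> pairwise orthogonal B \<and>
           (\<forall>b\<in>B. norm b = 1 \<and> (\<exists>l. M *v b = l *\<^sub>R b))"
  proof (rule selfadjoint_eigenbasis)
    show "linear ((*v) M)" by simp
    show "x \<bullet> (M *v y) = (M *v x) \<bullet> y" for x y
      using assms by (metis dot_lmul_matrix vector_transpose_matrix)
  qed auto
  then obtain B where B: "finite B" "card B = CARD('d)" "pairwise orthogonal B"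
    "\<And>b. b \<in> B \<Longrightarrow> norm b = 1" "\<And>b. b \<in> B \<Longrightarrow> \<exists>l. M *v b = l *\<^sub>R b"
    by auto
  obtain e where e: "bij_betw e (UNIV :: 'd set) B"
    using finite_same_card_bij[of "UNIV :: 'd set" B] B by auto
  have eB: "e i \<in> B" for i using e by (auto simp: bij_betw_def)
  have "\<exists>l. M *v e i = l *\<^sub>R e i" for i using B(5)[OF eB] .
  then obtain l where l: "\<And>i. M *v e i = l i *\<^sub>R e i" by metis
  show ?thesis
  proof (rule that[OF _ l])
    fix i j
    show "e i \<bullet> e j = (if i = j then 1 else 0)"
    proof (cases "i = j")
      case False
      then have "e i \<noteq> e j" using e by (auto simp: bij_betw_def inj_on_def)
      then show ?thesis using B(3) eB False by (auto simp: pairwise_def orthogonal_def)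
    qed (use B(4)[OF eB] in \<open>simp add: norm_eq_1\<close>)
  qed
qed

lemma const_poly_sum: "[:sum f S:] = (\<Sum>x\<in>S. [:f x :: real:])"
proof (induction S rule: infinite_finite_induct)
  case (insert x F)
  have "[:sum f (insert x F):] = [:f x:] + [:sum f F:]" using insert.hyps by simp
  also have "\<dots> = (\<Sum>x\<in>insert x F. [:f x:])" unfolding insert.IH using insert.hyps by simp
  finally show ?case .
qed auto

lemma const_poly_matrix_mult:
  fixes P Q :: "real^'d^'d"
  shows "map_matrix (\<lambda>c. [:c:]) (P ** Q) = map_matrix (\<lambda>c. [:c:]) P ** map_matrix (\<lambda>c. [:c:]) Q"
  by (simp add: map_matrix_def matrix_matrix_mult_def vec_eq_iff const_poly_sum mult.commute)

lemma orthogonal_diagonalization: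
  fixes M :: "real^'d^'d" and e :: "'d \<Rightarrow> real^'d"
  assumes "\<And>i j. e i \<bullet> e j = (if i = j then 1 else 0)" "\<And>i. M *v e i = l i *\<^sub>R e i"
  obtains Q where "transpose Q ** Q = mat 1" "Q ** transpose Q = mat 1"
    "M = Q ** (\<chi> i j. if i = j then l i else 0) ** transpose Q"
proof -
  define Q where "Q = (\<chi> i j. e j $ i)"
  define D where "D = (\<chi> i j. if i = j then l i else 0)"
  have 1: "transpose Q ** Q = mat 1"
    using assms(1) by (simp add: vec_eq_iff matrix_matrix_mult_def transpose_def Q_def mat_def inner_vec_def)
  then have 2: "Q ** transpose Q = mat 1" using matrix_left_right_inverse by blast
  have "M ** Q = Q ** D"
  proof -
    have "(M ** Q) $ i $ j = (Q ** D) $ i $ j" for i j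
    proof -
      have "(M ** Q) $ i $ j = (M *v e j) $ i"
        by (simp add: matrix_matrix_mult_def matrix_vector_mult_def Q_def)
      also have "\<dots> = l j * e j $ i" by (simp add: assms(2))
      also have "\<dots> = (Q ** D) $ i $ j"
        by (simp add: matrix_matrix_mult_def Q_def D_def if_distrib cong: if_cong)
      finally show ?thesis .
    qed
    then show ?thesis by (simp add: vec_eq_iff)
  qed
  then have "M ** Q ** transpose Q = Q ** D ** transpose Q" by simp
  then have "M = Q ** D ** transpose Q" using 2 by (simp add: matrix_mul_assoc[symmetric])
  then show ?thesis using that 1 2 unfolding D_def by blast
qed

text \<open>
  The orthogonal diagonalization is transported to matrices of polynomials by embedding the
  scalars as constants. There the matrix \<open>X\<close> is central, so conjugation turns
  \<open>X - M\<close> into a diagonal matrix.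
\<close>
lemma char_poly_mat_eq_prod:
  fixes M :: "real^'d^'d" and e :: "'d \<Rightarrow> real^'d"
  assumes "\<And>i j. e i \<bullet> e j = (if i = j then 1 else 0)" "\<And>i. M *v e i = l i *\<^sub>R e i"
  shows "char_poly_mat M = (\<Prod>i\<in>UNIV. [:- l i, 1:])"
proof -
  obtain Q where Q: "transpose Q ** Q = mat 1" "Q ** transpose Q = mat 1"
    "M = Q ** (\<chi> i j. if i = j then l i else 0) ** transpose Q"
    by (rule orthogonal_diagonalization[OF assms])
  define D where "D = (\<chi> i j. if i = j then l i else (0::real))"
  let ?c = "map_matrix (\<lambda>c. [:c:]) :: real^'d^'d \<Rightarrow> real poly^'d^'d"
  let ?X = "mat [:0, 1:] :: real poly^'d^'d"
  have c1: "?c (mat 1) = mat 1"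
    by (simp add: map_matrix_def mat_def vec_eq_iff)
  have QQ: "?c Q ** ?c (transpose Q) = mat 1"
    using Q(2) c1 by (metis const_poly_matrix_mult)
  have comm: "?X ** P = P ** ?X" for P :: "real poly^'d^'d"
    by (simp add: matrix_matrix_mult_def mat_def vec_eq_iff if_distrib if_distribR mult.commute cong: if_cong)
  have "?X - ?c M = ?c Q ** (?X - ?c D) ** ?c (transpose Q)"
  proof -
    have "?c M = ?c Q ** ?c D ** ?c (transpose Q)"
      unfolding Q(3) D_def by (simp add: const_poly_matrix_mult)
    moreover have "?c Q ** ?X ** ?c (transpose Q) = ?X"
      by (metis QQ comm matrix_mul_assoc matrix_mul_rid)
    moreover have "P ** (X - Y) ** R = P ** X ** R - P ** Y ** R" for P X Y R :: "real poly^'d^'d"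
      by (simp add: matrix_matrix_mult_def vec_eq_iff algebra_simps sum_subtractf sum_distrib_right sum_distrib_left)
    ultimately show ?thesis by simp
  qed
  then have "char_poly_mat M = det (?c Q) * det (?X - ?c D) * det (?c (transpose Q))"
    by (simp add: char_poly_mat_def det_mul)
  also have "\<dots> = det (?c Q ** ?c (transpose Q)) * det (?X - ?c D)"
    by (simp add: det_mul)
  also have "\<dots> = det (?X - ?c D)" by (simp add: QQ)
  also have "\<dots> = (\<Prod>i\<in>UNIV. (?X - ?c D) $ i $ i)"
    by (rule det_diagonal) (simp add: mat_def map_matrix_def D_def)
  also have "\<dots> = (\<Prod>i\<in>UNIV. [:- l i, 1:])"
    by (simp add: mat_def map_matrix_def D_def)
  finally show ?thesis .
qed

lemma sqrt_prod: "sqrt (prod f S) = (\<Prod>x\<in>S. sqrt (f x))"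
  by (induction S rule: infinite_finite_induct) (auto simp: real_sqrt_mult)

text \<open>
  This connects the singular values, given as roots of a characteristic polynomial, with the
  geometry of \<open>A\<close>: an orthonormal eigenbasis of \<open>A\<^sup>T A\<close> is mapped
  to orthogonal vectors whose lengths are the singular values. The basis is indexed from 0, so its
  \<open>i\<close>th vector belongs to the singular value of number \<open>Suc i\<close>.
\<close>
lemma singular_value_decomposition:
  fixes A :: "real^'d^'d"
  obtains e :: "nat \<Rightarrow> real^'d"
  where "\<And>i j. i < CARD('d) \<Longrightarrow> j < CARD('d) \<Longrightarrow> e i \<bullet> e j = (if i = j then 1 else 0)"
    and "\<And>i j. i < CARD('d) \<Longrightarrow> j < CARD('d) \<Longrightarrow>
          (A *v e i) \<bullet> (A *v e j) = (if i = j then (singular_value (Suc i) A)\<^sup>2 else 0)"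
    and "\<And>i. i < CARD('d) \<Longrightarrow> 0 \<le> singular_value (Suc i) A"
    and "\<And>i j. i \<le> j \<Longrightarrow> j < CARD('d) \<Longrightarrow> singular_value (Suc j) A \<le> singular_value (Suc i) A"
    and "\<bar>det A\<bar> = (\<Prod>i<CARD('d). singular_value (Suc i) A)"
proof -
  define M where "M = transpose A ** A"
  have "transpose M = M" by (simp add: M_def matrix_transpose_mul)
  then obtain f :: "'d \<Rightarrow> real^'d" and l where f: "\<And>i j. f i \<bullet> f j = (if i = j then 1 else 0)"
    and l: "\<And>i. M *v f i = l i *\<^sub>R f i"
    by (rule symmetric_matrix_eigenbasis) blast
  have inner: "(A *v x) \<bullet> (A *v y) = x \<bullet> (M *v y)" for x y
  proof -
    have "(A *v x) \<bullet> (A *v y) = (x v* transpose A) \<bullet> (A *v y)" by (simp only: vector_transpose_matrix)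
    also have "\<dots> = x \<bullet> (transpose A *v (A *v y))" by (rule dot_lmul_matrix)
    finally show ?thesis by (simp add: M_def matrix_vector_mul_assoc)
  qed
  have inner_f: "(A *v f i) \<bullet> (A *v f j) = (if i = j then l i else 0)" for i j
    by (simp add: inner l f)
  have l0: "l i \<ge> 0" for i using inner_f[of i i] by (metis inner_ge_zero)
  have roots: "proots (char_poly_mat M) = image_mset l (mset_set UNIV)"
  proof -
    have "proots (char_poly_mat M) = (\<Sum>i\<in>UNIV. proots [:- l i, 1:])"
      unfolding char_poly_mat_eq_prod[OF f l] by (rule proots_prod) auto
    also have "\<dots> = (\<Sum>i\<in>UNIV. {#l i#})" by simp
    also have "\<dots> = image_mset l (mset_set UNIV)"
      by (simp add: sum_unfold_sum_mset)
    finally show ?thesis .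
  qed
  obtain xs :: "'d list" where xs: "set xs = UNIV" "distinct xs"
    using finite_distinct_list[of "UNIV :: 'd set"] by auto
  define ys where "ys = rev (sort_key (\<lambda>i. sqrt (l i)) xs)"
  have ys: "set ys = UNIV" "distinct ys" by (simp_all add: ys_def xs)
  then have len: "length ys = CARD('d)" by (metis distinct_card)
  have sv: "singular_values A = map (\<lambda>i. sqrt (l i)) ys"
  proof -
    have "sorted_list_of_multiset (image_mset sqrt (image_mset l (mset_set UNIV)))
        = map (\<lambda>i. sqrt (l i)) (sort_key (\<lambda>i. sqrt (l i)) xs)" (is "sorted_list_of_multiset ?N = ?zs")
    proof -
      have "mset ?zs = ?N" using xs by (simp add: multiset.map_comp comp_def mset_set_set flip: xs(1))
      then have "sorted_list_of_multiset ?N = sort ?zs" by (metis sorted_list_of_multiset_mset)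
      also have "\<dots> = ?zs" by (rule sorted_sort_id) simp
      finally show ?thesis .
    qed
    then show ?thesis
      by (simp add: singular_values_def roots ys_def rev_map flip: M_def)
  qed
  define e where "e i = f (ys ! i)" for i
  have svi: "singular_value (Suc i) A = sqrt (l (ys ! i))" if "i < CARD('d)" for i
    using that len by (simp add: singular_value_def sv)
  have eq: "ys ! i = ys ! j \<longleftrightarrow> i = j" if "i < CARD('d)" "j < CARD('d)" for i j
    using that len ys nth_eq_iff_index_eq by metis
  show ?thesis
  proof (rule that[of e])
    show "e i \<bullet> e j = (if i = j then 1 else 0)" if "i < CARD('d)" "j < CARD('d)" for i j
      using eq[OF that] by (simp add: e_def f)
    show "(A *v e i) \<bullet> (A *v e j) = (if i = j then (singular_value (Suc i) A)\<^sup>2 else 0)"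
      if "i < CARD('d)" "j < CARD('d)" for i j
      using eq[OF that] svi[OF that(1)] l0[of "ys ! i"] by (auto simp: e_def inner_f)
    show "0 \<le> singular_value (Suc i) A" if "i < CARD('d)" for i
      using svi[OF that] l0 by simp
    show "singular_value (Suc j) A \<le> singular_value (Suc i) A" if "i \<le> j" "j < CARD('d)" for i j
    proof -
      have "sorted (map (\<lambda>i. sqrt (l i)) (rev ys))" by (simp add: ys_def)
      then have "sorted (rev (singular_values A))" by (simp add: sv rev_map)
      then have "sorted_wrt (\<ge>) (singular_values A)" by (simp add: sorted_wrt_rev)
      then show ?thesis
        using that len sorted_wrt_nth_less[of "(\<ge>)" "singular_values A" i j]
        by (cases "i = j") (auto simp: singular_value_def sv)
    qed
    show "\<bar>det A\<bar> = (\<Prod>i<CARD('d). singular_value (Suc i) A)"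
    proof -
      obtain Q where Q: "transpose Q ** Q = mat 1" "Q ** transpose Q = mat 1"
        "M = Q ** (\<chi> i j. if i = j then l i else 0) ** transpose Q"
        by (rule orthogonal_diagonalization[OF f l])
      have "det A * det A = det M" by (simp add: M_def det_mul)
      also have "\<dots> = (det (transpose Q) * det Q) * det (\<chi> i j. if i = j then l i else (0::real))"
        by (simp add: Q(3) det_mul)
      also have "det (transpose Q) * det Q = 1" using Q(1) by (metis det_I det_mul)
      also have "det (\<chi> i j. if i = j then l i else (0::real)) = (\<Prod>i\<in>UNIV. l i)"
        by (subst det_diagonal) auto
      finally have "\<bar>det A\<bar> = sqrt (\<Prod>i\<in>UNIV. l i)" by (metis mult_1 real_sqrt_abs2)
      also have "\<dots> = (\<Prod>i\<in>UNIV. sqrt (l i))" by (rule sqrt_prod)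
      also have "\<dots> = (\<Prod>k<CARD('d). sqrt (l (ys ! k)))"
        by (rule prod.reindex_bij_betw[OF bij_betw_nth, symmetric]) (simp_all add: ys len)
      also have "\<dots> = (\<Prod>i<CARD('d). singular_value (Suc i) A)"
        by (rule prod.cong) (auto simp: svi)
      finally show ?thesis .
    qed
  qed
qed

section \<open>Covering numbers of ellipsoids\<close>

definition ball_cover :: "real^'d^'d \<Rightarrow> real \<Rightarrow> (real^'d) set \<Rightarrow> bool"
  where "ball_cover A r F \<longleftrightarrow> 0 < r \<and> finite F \<and> (*v) A ` cball 0 1 \<subseteq> (\<Union>z\<in>F. cball z r)"

text \<open>
  A version of the singular value function that is defined by covers with balls of equal radius;
  the two are comparable for exponents below the dimension. It is exactly submultiplicative, and
  it is what both the upper and the lower estimate of the dimension use.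
\<close>
definition cover_content :: "real \<Rightarrow> real^'d^'d \<Rightarrow> real"
  where "cover_content t A = Inf {real (card F) * r powr t |F r. ball_cover A r F}"

lemma ball_cover_card_ge_1: "ball_cover A r F \<Longrightarrow> 1 \<le> card F"
proof -
  assume c: "ball_cover A r F"
  have "0 \<in> (*v) A ` cball 0 1" by (rule image_eqI[of _ _ 0]) auto
  then have "F \<noteq> {}" using c by (auto simp: ball_cover_def)
  then show ?thesis using c by (simp add: ball_cover_def Suc_le_eq card_gt_0_iff)
qed

lemma compact_ellipsoid: "compact ((*v) (A :: real^'d^'d) ` cball 0 1)"
  by (intro compact_continuous_image compact_cball linear_continuous_on)
    (simp add: linear_conv_bounded_linear[symmetric])

lemma ball_cover_exists:
  assumes "0 < r"
  obtains F where "ball_cover A r F"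
proof -
  obtain F where "finite F" "(*v) A ` cball 0 1 \<subseteq> (\<Union>z\<in>F. ball z r)"
    using compact_ellipsoid[of A] assms unfolding compact_eq_totally_bounded by blast
  moreover have "(\<Union>z\<in>F. ball z r) \<subseteq> (\<Union>z\<in>F. cball z r)" by (intro UN_mono) auto
  ultimately have "ball_cover A r F" using assms unfolding ball_cover_def by (meson subset_trans)
  then show ?thesis by (rule that)
qed

lemma cover_content_le:
  assumes "ball_cover A r F"
  shows "cover_content t A \<le> real (card F) * r powr t"
  unfolding cover_content_def
  by (rule cInf_lower) (use assms in \<open>auto intro!: bdd_belowI[of _ 0]\<close>)

lemma cover_content_ge:
  assumes "\<And>F r. ball_cover A r F \<Longrightarrow> c \<le> real (card F) * r powr t"
  shows "c \<le> cover_content t A"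
proof -
  obtain F where "ball_cover A 1 F" by (rule ball_cover_exists[of 1]) auto
  then show ?thesis
    unfolding cover_content_def by (intro cInf_greatest) (use assms in auto)
qed

lemma cover_content_less:
  assumes "cover_content t A < x"
  obtains F r where "ball_cover A r F" "real (card F) * r powr t < x"
proof -
  obtain F where "ball_cover A 1 F" by (rule ball_cover_exists[of 1]) auto
  then have "{real (card F) * r powr t |F r. ball_cover A r F} \<noteq> {}" by blast
  from cInf_lessD[OF this] assms that show ?thesis unfolding cover_content_def by blast
qed

lemma cover_content_nonneg: "0 \<le> cover_content t A"
  by (rule cover_content_ge) auto

text \<open>
  Covers compose: \<open>A\<close> maps each ball of the cover for \<open>B\<close> to a translate
  of \<open>q A(B(0,1))\<close>, which is covered by \<open>q\<close> times the cover for
  \<open>A\<close>.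
\<close>
lemma ball_cover_mult:
  assumes F: "ball_cover A r F" and G: "ball_cover B q G"
  shows "ball_cover (A ** B) (r * q) ((\<lambda>(y, z). A *v z + q *\<^sub>R y) ` (F \<times> G))"
  unfolding ball_cover_def
proof (intro conjI subsetI)
  have rq: "0 < r" "0 < q" using F G by (auto simp: ball_cover_def)
  then show "0 < r * q" by simp
  show "finite ((\<lambda>(y, z). A *v z + q *\<^sub>R y) ` (F \<times> G))"
    using F G by (auto simp: ball_cover_def)
  fix x assume "x \<in> (*v) (A ** B) ` cball 0 1"
  then obtain u where u: "norm u \<le> 1" "x = A *v (B *v u)"
    by (auto simp: matrix_vector_mul_assoc)
  then obtain z where z: "z \<in> G" "dist z (B *v u) \<le> q"
    using G unfolding ball_cover_def by (force simp: image_subset_iff)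
  define w where "w = (1 / q) *\<^sub>R (B *v u - z)"
  have "norm w \<le> 1" using z rq by (simp add: w_def dist_norm norm_minus_commute divide_simps)
  then obtain y where y: "y \<in> F" "dist y (A *v w) \<le> r"
    using F unfolding ball_cover_def by (force simp: image_subset_iff)
  have "x = A *v z + q *\<^sub>R (A *v w)"
  proof -
    have "B *v u = z + q *\<^sub>R w" using rq by (simp add: w_def)
    then show ?thesis
      using u by (simp add: matrix_vector_right_distrib matrix_vector_mult_scaleR)
  qed
  then have "dist (A *v z + q *\<^sub>R y) x = q * dist y (A *v w)"
    using rq by (simp add: dist_norm flip: scaleR_diff_right)
  also have "\<dots> \<le> r * q" using y rq by (simp add: mult.commute)
  finally show "x \<in> (\<Union>c\<in>(\<lambda>(y, z). A *v z + q *\<^sub>R y) ` (F \<times> G). cball c (r * q))"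
    using y z by force
qed

text \<open>
  The product of the values of two covers bounds the content of the product. The infimum is taken
  in one factor after the other, dividing by the other factor, which is positive as long as it
  comes from an actual cover.
\<close>
lemma cover_content_submult: "cover_content t (A ** B) \<le> cover_content t A * cover_content t B"
proof -
  have one: "cover_content t (A ** B) \<le> (real (card F) * r powr t) * (real (card G) * q powr t)"
    if F: "ball_cover A r F" and G: "ball_cover B q G" for F r G q
  proof -
    have rq: "0 < r" "0 < q" "finite F" "finite G" using F G by (auto simp: ball_cover_def)
    have "cover_content t (A ** B)
        \<le> real (card ((\<lambda>(y, z). A *v z + q *\<^sub>R y) ` (F \<times> G))) * (r * q) powr t"
      by (rule cover_content_le[OF ball_cover_mult[OF F G]])
    also have "\<dots> \<le> real (card (F \<times> G)) * (r * q) powr t"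
      using rq by (intro mult_right_mono of_nat_mono card_image_le) auto
    also have "\<dots> = (real (card F) * r powr t) * (real (card G) * q powr t)"
      using rq by (simp add: card_cartesian_product powr_mult)
    finally show ?thesis .
  qed
  have two: "cover_content t (A ** B) \<le> cover_content t A * (real (card G) * q powr t)"
    if G: "ball_cover B q G" for G q
  proof -
    have pos: "0 < real (card G) * q powr t"
      using ball_cover_card_ge_1[OF G] G by (auto simp: ball_cover_def)
    have "cover_content t (A ** B) / (real (card G) * q powr t) \<le> cover_content t A"
      by (rule cover_content_ge) (use one[OF _ G] pos in \<open>simp add: pos_divide_le_eq\<close>)
    then show ?thesis using pos by (simp add: pos_divide_le_eq)
  qed
  show ?thesis
  proof (cases "cover_content t A = 0")
    case True
    obtain G where "ball_cover B 1 G" by (rule ball_cover_exists[of 1]) auto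
    from two[OF this] True show ?thesis by simp
  next
    case False
    then have pos: "0 < cover_content t A" using cover_content_nonneg[of t A] by simp
    have "cover_content t (A ** B) / cover_content t A \<le> cover_content t B"
      by (rule cover_content_ge) (use two pos in \<open>simp add: pos_divide_le_eq mult.commute\<close>)
    then show ?thesis using pos by (simp add: pos_divide_le_eq mult.commute)
  qed
qed

text \<open>
  If \<open>r \<le> \<rho>\<close>, then \<open>r^s \<le> \<rho>^(s-t) r^t\<close>. A cover with a
  larger radius is no better than the single ball of radius \<open>\<rho>\<close>, so such covers
  do not matter for the infimum.
\<close>
lemma cover_content_exponent_mono:
  assumes "0 \<le> t" "t \<le> s" "0 < \<rho>" and \<rho>: "\<And>x. norm (A *v x) \<le> \<rho> * norm x"
  shows "cover_content s A \<le> \<rho> powr (s - t) * cover_content t A"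
proof -
  have "cover_content s A / \<rho> powr (s - t) \<le> cover_content t A"
  proof (rule cover_content_ge)
    fix F r assume F: "ball_cover A r F"
    then have r: "0 < r" by (simp add: ball_cover_def)
    have "cover_content s A \<le> \<rho> powr (s - t) * (real (card F) * r powr t)"
    proof (cases "r \<le> \<rho>")
      case True
      have "cover_content s A \<le> real (card F) * r powr s" by (rule cover_content_le[OF F])
      also have "r powr s = r powr (s - t) * r powr t" by (simp flip: powr_add)
      also have "r powr (s - t) \<le> \<rho> powr (s - t)" using True r assms by (intro powr_mono2) auto
      finally show ?thesis by (simp add: mult_left_mono mult_right_mono mult_ac)
    next
      case False
      have "norm (A *v x) \<le> \<rho>" if "norm x \<le> 1" for x
        using order_trans[OF \<rho>[of x] mult_left_mono[of "norm x" 1 \<rho>]] that assms(3) by simp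
      then have "ball_cover A \<rho> {0}" using assms(3) by (auto simp: ball_cover_def)
      then have "cover_content s A \<le> \<rho> powr s" using cover_content_le[of A \<rho> "{0}" s] by simp
      also have "\<rho> powr s = \<rho> powr (s - t) * (1 * \<rho> powr t)" by (simp flip: powr_add)
      also have "\<dots> \<le> \<rho> powr (s - t) * (real (card F) * r powr t)"
        using ball_cover_card_ge_1[OF F] False assms
        by (intro mult_left_mono mult_mono powr_mono2) auto
      finally show ?thesis .
    qed
    then show "cover_content s A / \<rho> powr (s - t) \<le> real (card F) * r powr t"
      using assms by (simp add: pos_divide_le_eq mult.commute)
  qed
  then show ?thesis using assms by (simp add: pos_divide_le_eq mult.commute)
qed

text \<open>
  A ball of radius \<open>r\<close> contains at most one of the separated points.
\<close>
lemma separated_card_le: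
  assumes F: "ball_cover A r F" and Y: "Y \<subseteq> (*v) A ` cball 0 1"
    and sep: "\<And>y z. y \<in> Y \<Longrightarrow> z \<in> Y \<Longrightarrow> y \<noteq> z \<Longrightarrow> 2 * r < dist y z"
  shows "finite Y" "card Y \<le> card F"
proof -
  have "\<forall>y\<in>Y. \<exists>c. c \<in> F \<and> dist c y \<le> r"
    using F Y unfolding ball_cover_def subset_iff UN_iff mem_cball by blast
  then obtain c where c: "\<And>y. y \<in> Y \<Longrightarrow> c y \<in> F" "\<And>y. y \<in> Y \<Longrightarrow> dist (c y) y \<le> r" by metis
  have inj: "inj_on c Y"
  proof (rule inj_onI, rule ccontr)
    fix y z assume yz: "y \<in> Y" "z \<in> Y" "c y = c z" "y \<noteq> z"
    have "dist y z \<le> dist (c y) y + dist (c z) z"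
      using yz(3) dist_triangle3[of y z "c y"] by simp
    then show False using c(2)[OF yz(1)] c(2)[OF yz(2)] sep[OF yz(1,2,4)] by simp
  qed
  have fF: "finite F" using F by (simp add: ball_cover_def)
  have sub: "c ` Y \<subseteq> F" using c by auto
  show "finite Y" using finite_subset[OF sub fF] inj finite_imageD by blast
  show "card Y \<le> card F" using card_inj_on_le[OF inj sub fF] .
qed

text \<open>
  A separated subset of the largest possible cardinality cannot be enlarged, hence it is a cover.
  In the transversality estimate such a set yields many disjoint translates.
\<close>
lemma maximal_separated_cover:
  fixes A :: "real^'d^'d"
  assumes r: "0 < r"
  obtains Y where "Y \<subseteq> (*v) A ` cball 0 1" "ball_cover A r Y"
    "\<And>y z. y \<in> Y \<Longrightarrow> z \<in> Y \<Longrightarrow> y \<noteq> z \<Longrightarrow> r < dist y z"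
proof -
  define sep where "sep Y \<longleftrightarrow> Y \<subseteq> (*v) A ` cball 0 1 \<and> (\<forall>y\<in>Y. \<forall>z\<in>Y. y \<noteq> z \<longrightarrow> r < dist y z)" for Y
  obtain F where F: "ball_cover A (r / 2) F" by (rule ball_cover_exists[of "r / 2"]) (use r in auto)
  have fin: "finite Y" "card Y \<le> card F" if "sep Y" for Y
    using separated_card_le[OF F, of Y] that by (auto simp: sep_def)
  \<comment> \<open>Cardinalities of separated sets are bounded by that of a cover of half the
  radius.\<close>
  define k where "k = (GREATEST k. \<exists>Y. sep Y \<and> card Y = k)"
  have ex: "\<exists>Y. sep Y \<and> card Y = k" unfolding k_def
  proof (rule GreatestI_nat[of "\<lambda>k. \<exists>Y. sep Y \<and> card Y = k" 0 "card F"])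
    show "\<exists>Y. sep Y \<and> card Y = 0" by (rule exI[of _ "{}"]) (simp add: sep_def)
  qed (use fin in auto)
  then obtain Y where Y: "sep Y" "card Y = k" by blast
  have max: "card Z \<le> k" if "sep Z" for Z
    unfolding k_def by (rule Greatest_le_nat[of _ _ "card F"]) (use that fin in auto)
  have "\<exists>z\<in>Y. dist z x \<le> r" if x: "x \<in> (*v) A ` cball 0 1" for x
  proof (rule ccontr)
    assume "\<not> (\<exists>z\<in>Y. dist z x \<le> r)"
    then have far: "\<And>z. z \<in> Y \<Longrightarrow> r < dist z x" by force
    then have "sep (insert x Y)" using Y(1) x by (auto simp: sep_def dist_commute)
    moreover have "x \<notin> Y" using far r by fastforce
    ultimately show False using max[of "insert x Y"] Y fin(1)[OF Y(1)] by simp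
  qed
  then have "ball_cover A r Y" using r fin(1)[OF Y(1)] by (auto simp: ball_cover_def)
  with Y(1) that show ?thesis unfolding sep_def by blast
qed

lemma orthonormal_family_expand:
  fixes e :: "nat \<Rightarrow> real^'d"
  assumes on: "\<And>i j. i < CARD('d) \<Longrightarrow> j < CARD('d) \<Longrightarrow> e i \<bullet> e j = (if i = j then 1 else 0)"
  shows "x = (\<Sum>k<CARD('d). (x \<bullet> e k) *\<^sub>R e k)"
proof -
  let ?B = "e ` {..<CARD('d)}"
  have inj: "inj_on e {..<CARD('d)}"
  proof (rule inj_onI)
    fix i j assume "i \<in> {..<CARD('d)}" "j \<in> {..<CARD('d)}" "e i = e j"
    then show "i = j" using on[of i j] on[of i i] by (auto split: if_splits)
  qed
  have ne: "0 \<notin> ?B" using on by force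
  have po: "pairwise orthogonal ?B" using on by (auto simp: pairwise_def orthogonal_def)
  have ind: "independent ?B" by (rule pairwise_orthogonal_independent[OF po ne])
  have "card ?B = DIM(real^'d)" using card_image[OF inj] by simp
  then have sp: "span ?B = UNIV" using ind by (metis card_eq_dim dim_UNIV independent_bound_general span_UNIV subset_UNIV dim_eq_full dim_eq_card_independent)
  have "x = (\<Sum>b\<in>?B. (x \<bullet> b) *\<^sub>R b)"
    by (rule orthonormal_basis_expand[OF po, symmetric]) (auto simp: sp on norm_eq_1)
  also have "\<dots> = (\<Sum>k<CARD('d). (x \<bullet> e k) *\<^sub>R e k)" by (rule sum.reindex_cong[OF inj]) auto
  finally show ?thesis .
qed

text \<open>
  A point of the ellipsoid is approximated by rounding its coordinates along the axes \<open>A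
  e\<^sub>k\<close> down to multiples of \<open>r\<close>; each coordinate contributes at most
  \<open>r\<close> to the error.
\<close>
lemma grid_ball_cover:
  fixes A :: "real^'d^'d" and e :: "nat \<Rightarrow> real^'d"
  assumes on: "\<And>i j. i < CARD('d) \<Longrightarrow> j < CARD('d) \<Longrightarrow> e i \<bullet> e j = (if i = j then 1 else 0)"
    and al: "\<And>i. i < CARD('d) \<Longrightarrow> 0 < \<alpha> i \<and> norm (A *v e i) \<le> \<alpha> i" and r: "0 < r"
  obtains F where "ball_cover A (real CARD('d) * r) F"
    "real (card F) \<le> (\<Prod>k<CARD('d). 5 * max 1 (\<alpha> k / r))"
proof -
  define m where "m k = \<lceil>\<alpha> k / r\<rceil>" for k
  define J where "J = PiE {..<CARD('d)} (\<lambda>k. {- m k..m k})"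
  define c where "c j = (\<Sum>k<CARD('d). (real_of_int (j k) * r / \<alpha> k) *\<^sub>R (A *v e k))" for j
  have finJ: "finite J" unfolding J_def by (intro finite_PiE) auto
  have "ball_cover A (real CARD('d) * r) (c ` J)"
    unfolding ball_cover_def
  proof (intro conjI subsetI)
    fix y assume "y \<in> (*v) A ` cball 0 1"
    then obtain x where x: "norm x \<le> 1" "y = A *v x" by auto
    define j where "j = (\<lambda>k\<in>{..<CARD('d)}. \<lfloor>(x \<bullet> e k) * \<alpha> k / r\<rfloor>)"
    have xe: "\<bar>x \<bullet> e k\<bar> \<le> 1" if "k < CARD('d)" for k
    proof -
      have "norm (e k) = 1" using on[OF that that] by (simp add: norm_eq_1)
      then show ?thesis using Cauchy_Schwarz_ineq2[of x "e k"] x by simp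
    qed
    have "j \<in> J" unfolding J_def
    proof (rule PiE_I)
      fix k assume k: "k \<in> {..<CARD('d)}"
      then have a: "0 < \<alpha> k / r" using al r by simp
      have "(x \<bullet> e k) * \<alpha> k / r \<le> \<alpha> k / r" "- (\<alpha> k / r) \<le> (x \<bullet> e k) * \<alpha> k / r"
        using xe[of k] k al[of k] r mult_right_mono[of "x \<bullet> e k" 1 "\<alpha> k"] mult_right_mono[of "-1" "x \<bullet> e k" "\<alpha> k"]
        by (auto simp: divide_simps)
      then have "\<lfloor>(x \<bullet> e k) * \<alpha> k / r\<rfloor> \<le> m k \<and> - m k \<le> \<lfloor>(x \<bullet> e k) * \<alpha> k / r\<rfloor>"
        unfolding m_def by linarith
      then show "j k \<in> {- m k..m k}" using k by (simp add: j_def)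
    qed (simp add: j_def)
    have yx: "y = (\<Sum>k<CARD('d). (x \<bullet> e k) *\<^sub>R (A *v e k))"
    proof -
      have "y = A *v (\<Sum>k<CARD('d). (x \<bullet> e k) *\<^sub>R e k)"
        using x orthonormal_family_expand[OF on, of x] by simp
      then show ?thesis by (simp add: linear_sum[OF matrix_vector_mul_linear] matrix_vector_mult_scaleR)
    qed
    have "norm (c j - y) = norm (\<Sum>k<CARD('d). (real_of_int (j k) * r / \<alpha> k - x \<bullet> e k) *\<^sub>R (A *v e k))"
      by (simp add: c_def yx scaleR_left_diff_distrib sum_subtractf)
    also have "\<dots> \<le> (\<Sum>k<CARD('d). r)"
    proof (intro sum_norm_le)
      fix k assume k: "k \<in> {..<CARD('d)}"
      then have a: "0 < \<alpha> k" "norm (A *v e k) \<le> \<alpha> k" using al by auto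
      have "\<bar>real_of_int (j k) - (x \<bullet> e k) * \<alpha> k / r\<bar> \<le> 1"
        using k by (simp add: j_def) linarith
      moreover have "real_of_int (j k) * r / \<alpha> k - x \<bullet> e k = (real_of_int (j k) - (x \<bullet> e k) * \<alpha> k / r) * (r / \<alpha> k)"
        using a r by (simp add: field_simps)
      ultimately have "\<bar>real_of_int (j k) * r / \<alpha> k - x \<bullet> e k\<bar> \<le> 1 * (r / \<alpha> k)"
        using a r by (simp only: abs_mult) (intro mult_mono, auto)
      then have "norm ((real_of_int (j k) * r / \<alpha> k - x \<bullet> e k) *\<^sub>R (A *v e k)) \<le> (r / \<alpha> k) * \<alpha> k"
        unfolding norm_scaleR using a by (intro mult_mono) auto
      then show "norm ((real_of_int (j k) * r / \<alpha> k - x \<bullet> e k) *\<^sub>R (A *v e k)) \<le> r" using a by simp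
    qed
    finally have "dist (c j) y \<le> real CARD('d) * r" by (simp add: dist_norm)
    then show "y \<in> (\<Union>z\<in>c ` J. cball z (real CARD('d) * r))" using \<open>j \<in> J\<close> by auto
  qed (use finJ r in auto)
  moreover have "real (card (c ` J)) \<le> (\<Prod>k<CARD('d). 5 * max 1 (\<alpha> k / r))"
  proof -
    have "real (card (c ` J)) \<le> real (card J)" using card_image_le[OF finJ] by simp
    also have "\<dots> = (\<Prod>k<CARD('d). real (card {- m k..m k}))"
      by (simp add: J_def card_PiE)
    also have "\<dots> \<le> (\<Prod>k<CARD('d). 5 * max 1 (\<alpha> k / r))"
    proof (intro prod_mono conjI)
      fix k assume k: "k \<in> {..<CARD('d)}"
      then have a: "0 < \<alpha> k / r" using al r by simp
      have "real (card {- m k..m k}) = 2 * real_of_int (m k) + 1"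
        using a by (simp add: m_def)
      also have "\<dots> \<le> 2 * (\<alpha> k / r + 1) + 1"
        using of_int_ceiling_le_add_one[of "\<alpha> k / r"] unfolding m_def by (simp only: add_le_cancel_right mult_le_cancel_left_pos[OF zero_less_numeral])
      also have "\<dots> \<le> 5 * max 1 (\<alpha> k / r)" by simp
      finally show "real (card {- m k..m k}) \<le> 5 * max 1 (\<alpha> k / r)" .
    qed auto
    finally show ?thesis .
  qed
  ultimately show ?thesis using that by blast
qed

text \<open>
  The counterpart of the grid cover. Grid points of mesh \<open>h\<^sub>k = 3 r /
  \<alpha>\<^sub>k\<close> along the \<open>e\<^sub>k\<close> have images that differ by at least
  \<open>3 r\<close> along one of the orthogonal axes, so no ball of radius \<open>r\<close>
  contains two of them. They stay in the unit ball if every coordinate is at most \<open>1 /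
  d\<close>.
\<close>
lemma grid_packing_le_card:
  fixes A :: "real^'d^'d" and e :: "nat \<Rightarrow> real^'d"
  assumes on: "\<And>i j. i < CARD('d) \<Longrightarrow> j < CARD('d) \<Longrightarrow> e i \<bullet> e j = (if i = j then 1 else 0)"
    and orth: "\<And>i j. i < CARD('d) \<Longrightarrow> j < CARD('d) \<Longrightarrow>
       (A *v e i) \<bullet> (A *v e j) = (if i = j then (\<alpha> i)\<^sup>2 else 0)"
    and al: "\<And>i. i < CARD('d) \<Longrightarrow> 0 < \<alpha> i"
    and F: "ball_cover A r F"
  shows "(\<Prod>k<CARD('d). max 1 (\<alpha> k / (3 * real CARD('d) * r))) \<le> real (card F)"
proof -
  let ?d = "real CARD('d)"
  have r: "0 < r" using F by (simp add: ball_cover_def)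
  define h where "h k = 3 * r / \<alpha> k" for k
  define m where "m k = Suc (nat \<lfloor>1 / (?d * h k)\<rfloor>)" for k
  define J where "J = PiE {..<CARD('d)} (\<lambda>k. {..<m k})"
  define c where "c j = (\<Sum>k<CARD('d). (real (j k) * h k) *\<^sub>R e k)" for j :: "nat \<Rightarrow> nat"
  have h: "0 < h k" if "k < CARD('d)" for k using al[OF that] r by (simp add: h_def)
  have Ac: "A *v c j = (\<Sum>k<CARD('d). (real (j k) * h k) *\<^sub>R (A *v e k))" for j
    by (simp add: c_def linear_sum[OF matrix_vector_mul_linear] matrix_vector_mult_scaleR)
  have sub: "(\<lambda>j. A *v c j) ` J \<subseteq> (*v) A ` cball 0 1"
  proof -
    have "norm (c j) \<le> 1" if "j \<in> J" for j
    proof -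
      have "norm (c j) \<le> (\<Sum>k<CARD('d). 1 / ?d)" unfolding c_def
      proof (intro sum_norm_le)
        fix k assume k: "k \<in> {..<CARD('d)}"
        have "j k < m k" using that k by (auto simp: J_def)
        then have "real (j k) \<le> 1 / (?d * h k)" unfolding m_def using h[of k] k
          by (meson divide_nonneg_pos less_Suc_eq_le lessThan_iff mult_pos_pos of_nat_0_less_iff of_nat_floor
              of_nat_mono order.trans zero_less_card_finite zero_le_one less_imp_le divide_nonneg_nonneg)
        then have "real (j k) * h k \<le> 1 / ?d" using h[of k] k by (simp add: field_simps)
        moreover have "norm (e k) = 1" using on[of k k] k by (simp add: norm_eq_1)
        ultimately show "norm ((real (j k) * h k) *\<^sub>R e k) \<le> 1 / ?d" using h[of k] k by simp
      qed
      then show ?thesis by simp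
    qed
    then show ?thesis by auto
  qed
  have far: "3 * r \<le> dist (A *v c i) (A *v c j)" if ij: "i \<in> J" "j \<in> J" "i \<noteq> j" for i j
  proof -
    obtain k where k: "k < CARD('d)" "i k \<noteq> j k"
      using ij unfolding J_def by (metis PiE_ext lessThan_iff)
    have "(A *v c i - A *v c j) \<bullet> (A *v e k)
        = (\<Sum>l<CARD('d). ((real (i l) - real (j l)) * h l) * ((A *v e l) \<bullet> (A *v e k)))"
      by (simp add: Ac inner_diff_left inner_sum_left flip: sum_subtractf) (simp add: algebra_simps)
    also have "\<dots> = (\<Sum>l<CARD('d). if l = k then (real (i l) - real (j l)) * h l * (\<alpha> l)\<^sup>2 else 0)"
      by (intro sum.cong) (auto simp: orth k)
    also have "\<dots> = (real (i k) - real (j k)) * h k * (\<alpha> k)\<^sup>2" using k by simp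
    finally have eq: "(A *v c i - A *v c j) \<bullet> (A *v e k) = (real (i k) - real (j k)) * (3 * r * \<alpha> k)"
      using al[OF k(1)] by (simp add: h_def power2_eq_square)
    have "1 \<le> \<bar>real (i k) - real (j k)\<bar>" using k by linarith
    then have "1 * (3 * r * \<alpha> k) \<le> \<bar>(A *v c i - A *v c j) \<bullet> (A *v e k)\<bar>"
      unfolding eq abs_mult using al[OF k(1)] r by (intro mult_mono) auto
    also have "\<dots> \<le> norm (A *v c i - A *v c j) * norm (A *v e k)" by (rule Cauchy_Schwarz_ineq2)
    also have "norm (A *v e k) = \<alpha> k"
      using orth[OF k(1) k(1)] al[OF k(1)] by (simp add: norm_eq_sqrt_inner)
    finally show ?thesis using al[OF k(1)] by (simp add: dist_norm)
  qed
  have inj: "inj_on (\<lambda>j. A *v c j) J"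
  proof (rule inj_onI, rule ccontr)
    fix i j assume "i \<in> J" "j \<in> J" "A *v c i = A *v c j" "i \<noteq> j"
    then show False using far[of i j] r by simp
  qed
  have "real (card J) \<le> real (card F)"
  proof -
    have "card ((\<lambda>j. A *v c j) ` J) \<le> card F"
      by (rule separated_card_le(2)[OF F sub]) (use far r in fastforce)
    then show ?thesis by (simp add: card_image[OF inj])
  qed
  moreover have "real (card J) = (\<Prod>k<CARD('d). real (m k))" by (simp add: J_def card_PiE)
  moreover have "(\<Prod>k<CARD('d). max 1 (\<alpha> k / (3 * ?d * r))) \<le> (\<Prod>k<CARD('d). real (m k))"
  proof (intro prod_mono conjI)
    fix k assume k: "k \<in> {..<CARD('d)}"
    have "\<alpha> k / (3 * ?d * r) = 1 / (?d * h k)" using al[of k] k r by (simp add: h_def field_simps)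
    also have "\<dots> \<le> real (m k)" unfolding m_def by linarith
    finally show "max 1 (\<alpha> k / (3 * ?d * r)) \<le> real (m k)" by (simp add: m_def)
  qed auto
  ultimately show ?thesis by linarith
qed

section \<open>The singular value function and the cover content\<close>

lemma sv_fun_eq:
  fixes A :: "real^'d^'d"
  assumes "0 \<le> t" "t < real CARD('d)"
  shows "nat \<lfloor>t\<rfloor> < CARD('d)"
    and "sv_fun t A = (\<Prod>k<nat \<lfloor>t\<rfloor>. singular_value (Suc k) A) *
           singular_value (Suc (nat \<lfloor>t\<rfloor>)) A powr (t - real (nat \<lfloor>t\<rfloor>))"
proof -
  show "nat \<lfloor>t\<rfloor> < CARD('d)" using assms by linarith
  have "(\<Prod>k = 1..l. singular_value k A) = (\<Prod>k<l. singular_value (Suc k) A)" for l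
    by (rule prod.reindex_bij_witness[of _ Suc "\<lambda>k. k - 1"]) auto
  then show "sv_fun t A = (\<Prod>k<nat \<lfloor>t\<rfloor>. singular_value (Suc k) A) *
           singular_value (Suc (nat \<lfloor>t\<rfloor>)) A powr (t - real (nat \<lfloor>t\<rfloor>))"
    using assms by (simp add: sv_fun_def Let_def)
qed

lemma singular_value_pos:
  fixes A :: "real^'d^'d"
  assumes "invertible A" "k < CARD('d)"
  shows "0 < singular_value (Suc k) A"
proof -
  obtain e :: "nat \<Rightarrow> real^'d" where e: "\<And>i. i < CARD('d) \<Longrightarrow> 0 \<le> singular_value (Suc i) A"
    "\<bar>det A\<bar> = (\<Prod>i<CARD('d). singular_value (Suc i) A)"
    by (rule singular_value_decomposition[of A]) blast
  have "det A \<noteq> 0" using assms(1) by (simp add: invertible_det_nz)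
  then have "(\<Prod>i<CARD('d). singular_value (Suc i) A) \<noteq> 0" using e(2) by linarith
  then have "singular_value (Suc k) A \<noteq> 0" using assms(2) by (simp add: prod_zero_iff)
  then show ?thesis using e(1)[OF assms(2)] by simp
qed

lemma sv_fun_pos:
  fixes A :: "real^'d^'d"
  assumes "invertible A" "0 \<le> t"
  shows "0 < sv_fun t A"
proof (cases "t < real CARD('d)")
  case True
  then show ?thesis
    unfolding sv_fun_eq(2)[OF assms(2) True] using sv_fun_eq(1)[OF assms(2) True]
      singular_value_pos[OF assms(1)]
    by (intro mult_pos_pos prod_pos) (auto simp: less_imp_neq[symmetric])
next
  case False
  then show ?thesis using assms(1) by (simp add: sv_fun_def invertible_det_nz)
qed

lemma singular_values_packing:
  fixes A :: "real^'d^'d"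
  assumes inv: "invertible A" and F: "ball_cover A r F"
  shows "(\<Prod>k<CARD('d). max 1 (singular_value (Suc k) A / (3 * real CARD('d) * r))) \<le> real (card F)"
proof -
  obtain e :: "nat \<Rightarrow> real^'d" where
    on: "\<And>i j. i < CARD('d) \<Longrightarrow> j < CARD('d) \<Longrightarrow> e i \<bullet> e j = (if i = j then 1 else 0)" and
    orth: "\<And>i j. i < CARD('d) \<Longrightarrow> j < CARD('d) \<Longrightarrow>
       (A *v e i) \<bullet> (A *v e j) = (if i = j then (singular_value (Suc i) A)\<^sup>2 else 0)"
    by (rule singular_value_decomposition[of A]) blast
  show ?thesis by (rule grid_packing_le_card[OF on orth singular_value_pos[OF inv] F])
qed

text \<open>
  A cover of radius \<open>r\<close> has at least \<open>\<Prod>k. max 1 (\<alpha>\<^sub>k /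
  R)\<close> elements, where \<open>R = 3 d r\<close>. Keeping \<open>\<alpha>\<^sub>k / R\<close>
  for the first \<open>l\<close> factors and a power of exponent \<open>t - l \<le> 1\<close> of
  the next one leaves \<open>R^(-t) \<phi>\<^sup>t(A)\<close>.
\<close>
lemma cover_content_ge_sv_fun:
  fixes A :: "real^'d^'d"
  assumes inv: "invertible A" and t: "0 \<le> t" "t < real CARD('d)"
  shows "sv_fun t A \<le> (3 * real CARD('d)) powr t * cover_content t A"
proof -
  let ?d = "real CARD('d)" and ?\<alpha> = "\<lambda>k. singular_value (Suc k) A"
  define l where "l = nat \<lfloor>t\<rfloor>"
  have l: "l < CARD('d)" "real l \<le> t" "t - real l \<le> 1" using t by (auto simp: l_def) linarith+
  have sv: "sv_fun t A = (\<Prod>k<l. ?\<alpha> k) * ?\<alpha> l powr (t - real l)"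
    using sv_fun_eq(2)[OF t] by (simp add: l_def)
  note pos = singular_value_pos[OF inv]
  have "sv_fun t A / (3 * ?d) powr t \<le> cover_content t A"
  proof (rule cover_content_ge)
    fix F r assume F: "ball_cover A r F"
    then have r: "0 < r" by (simp add: ball_cover_def)
    \<comment> \<open>The scale at which \<open>singular_values_packing\<close> counts.\<close>
    define R where "R = 3 * ?d * r"
    have R: "0 < R" using r by (simp add: R_def)
    have "sv_fun t A = R powr t * ((\<Prod>k<l. ?\<alpha> k / R) * (?\<alpha> l / R) powr (t - real l))"
    proof -
      have "R powr t = R ^ l * R powr (t - real l)"
        using R by (simp add: powr_realpow[symmetric] flip: powr_add)
      then show ?thesis using R pos[OF l(1)] by (simp add: sv prod_dividef powr_divide)
    qed
    also have "\<dots> \<le> R powr t * ((\<Prod>k<l. max 1 (?\<alpha> k / R)) * max 1 (?\<alpha> l / R))"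
    proof (intro mult_left_mono mult_mono)
      show "(\<Prod>k<l. ?\<alpha> k / R) \<le> (\<Prod>k<l. max 1 (?\<alpha> k / R))"
        using pos l R by (intro prod_mono) (auto intro!: divide_nonneg_pos less_imp_le)
      have "(?\<alpha> l / R) powr (t - real l) \<le> max 1 (?\<alpha> l / R) powr (t - real l)"
        using l pos[of l] R by (intro powr_mono2) auto
      also have "\<dots> \<le> max 1 (?\<alpha> l / R) powr 1" using l by (intro powr_mono) auto
      finally show "(?\<alpha> l / R) powr (t - real l) \<le> max 1 (?\<alpha> l / R)" by simp
    qed (auto intro!: prod_nonneg)
    also have "(\<Prod>k<l. max 1 (?\<alpha> k / R)) * max 1 (?\<alpha> l / R) = (\<Prod>k<Suc l. max 1 (?\<alpha> k / R))"
      by simp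
    also have "\<dots> \<le> (\<Prod>k<CARD('d). max 1 (?\<alpha> k / R))"
      using l by (intro prod_mono2) auto
    also have "\<dots> \<le> real (card F)"
      unfolding R_def by (rule singular_values_packing[OF inv F])
    finally have "sv_fun t A \<le> R powr t * real (card F)" using R by (simp add: mult_left_mono)
    also have "R powr t = (3 * ?d) powr t * r powr t" using r by (simp add: R_def powr_mult)
    finally show "sv_fun t A / (3 * ?d) powr t \<le> real (card F) * r powr t"
      by (simp add: pos_divide_le_eq mult_ac)
  qed
  then show ?thesis by (simp add: pos_divide_le_eq mult_ac)
qed

text \<open>
  The determinant takes the place of the singular value function at the exponent \<open>d\<close>,
  where all factors of the packing bound are kept.
\<close>
lemma abs_det_le_cover_content:
  fixes A :: "real^'d^'d"
  assumes inv: "invertible A"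
  shows "\<bar>det A\<bar> \<le> (3 * real CARD('d)) powr CARD('d) * cover_content (real CARD('d)) A"
proof -
  let ?d = "real CARD('d)" and ?\<alpha> = "\<lambda>k. singular_value (Suc k) A"
  have "\<bar>det A\<bar> / (3 * ?d) powr ?d \<le> cover_content ?d A"
  proof (rule cover_content_ge)
    fix F r assume F: "ball_cover A r F"
    then have r: "0 < r" by (simp add: ball_cover_def)
    have "\<bar>det A\<bar> = (\<Prod>k<CARD('d). ?\<alpha> k)"
      by (rule singular_value_decomposition[of A]) blast
    also have "\<dots> \<le> (\<Prod>k<CARD('d). 3 * ?d * r * max 1 (?\<alpha> k / (3 * ?d * r)))"
      using r singular_value_pos[OF inv] by (intro prod_mono) (auto simp: max_def less_imp_le field_simps)
    also have "\<dots> \<le> (3 * ?d * r) ^ CARD('d) * real (card F)"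
      using singular_values_packing[OF inv F] r by (simp add: prod.distrib mult_left_mono)
    also have "(3 * ?d * r) ^ CARD('d) = (3 * ?d) powr ?d * r powr ?d"
      using r by (simp add: powr_realpow power_mult_distrib)
    finally show "\<bar>det A\<bar> / (3 * ?d) powr ?d \<le> real (card F) * r powr ?d"
      by (simp add: pos_divide_le_eq mult_ac)
  qed
  then show ?thesis by (simp add: pos_divide_le_eq mult_ac)
qed

text \<open>
  The radius \<open>r = \<alpha>\<^sub>l\<^sub>+\<^sub>1\<close> is optimal: in the grid cover
  exactly the first \<open>l\<close> axes then need more than a bounded number of points.
\<close>
lemma cover_content_le_sv_fun:
  fixes A :: "real^'d^'d"
  assumes inv: "invertible A" and t: "0 \<le> t" "t < real CARD('d)"
  shows "cover_content t A \<le> 5 ^ CARD('d) * real CARD('d) powr t * sv_fun t A"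
proof -
  let ?d = "real CARD('d)"
  define \<alpha> where "\<alpha> i = singular_value (Suc i) A" for i
  define l where "l = nat \<lfloor>t\<rfloor>"
  have l: "l < CARD('d)" using sv_fun_eq(1)[OF t] by (simp add: l_def)
  have sv: "sv_fun t A = (\<Prod>k<l. \<alpha> k) * \<alpha> l powr (t - real l)"
    using sv_fun_eq(2)[OF t] by (simp add: \<alpha>_def l_def)
  have pos: "0 < \<alpha> i" if "i < CARD('d)" for i
    using singular_value_pos[OF inv that] by (simp add: \<alpha>_def)
  obtain e :: "nat \<Rightarrow> real^'d" where
    on: "\<And>i j. i < CARD('d) \<Longrightarrow> j < CARD('d) \<Longrightarrow> e i \<bullet> e j = (if i = j then 1 else 0)" and
    orth: "\<And>i j. i < CARD('d) \<Longrightarrow> j < CARD('d) \<Longrightarrow>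
       (A *v e i) \<bullet> (A *v e j) = (if i = j then (\<alpha> i)\<^sup>2 else 0)" and
    dec: "\<And>i j. i \<le> j \<Longrightarrow> j < CARD('d) \<Longrightarrow> \<alpha> j \<le> \<alpha> i"
    unfolding \<alpha>_def by (rule singular_value_decomposition[of A]) blast
  have al: "0 < \<alpha> i \<and> norm (A *v e i) \<le> \<alpha> i" if "i < CARD('d)" for i
    using orth[OF that that] pos[OF that] by (simp add: norm_eq_sqrt_inner)
  define r where "r = \<alpha> l"
  have r: "0 < r" using pos[OF l] by (simp add: r_def)
  obtain F where F: "ball_cover A (?d * r) F" "real (card F) \<le> (\<Prod>k<CARD('d). 5 * max 1 (\<alpha> k / r))"
    using grid_ball_cover[OF on al r] by blast
  have "(\<Prod>k<CARD('d). max 1 (\<alpha> k / r)) = (\<Prod>k<l. \<alpha> k / r)"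
  proof -
    have "(\<Prod>k<l. \<alpha> k / r) = (\<Prod>k<CARD('d). max 1 (\<alpha> k / r))"
    proof (rule prod.mono_neutral_cong_left)
      show "\<forall>i\<in>{..<CARD('d)} - {..<l}. max 1 (\<alpha> i / r) = 1"
        using dec r by (auto simp: r_def)
      show "\<alpha> k / r = max 1 (\<alpha> k / r)" if "k \<in> {..<l}" for k
        using dec[of k l] l that r by (simp add: r_def)
    qed (use l in auto)
    then show ?thesis by simp
  qed
  then have "real (card F) \<le> 5 ^ CARD('d) * (\<Prod>k<l. \<alpha> k / r)"
    using F(2) by (simp add: prod.distrib)
  then have "cover_content t A \<le> 5 ^ CARD('d) * (\<Prod>k<l. \<alpha> k / r) * (?d * r) powr t"
    using cover_content_le[OF F(1), of t] by (meson mult_right_mono order_trans powr_ge_zero)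
  also have "\<dots> = 5 ^ CARD('d) * ?d powr t * ((\<Prod>k<l. \<alpha> k / r) * r powr t)"
    using r by (simp add: powr_mult)
  also have "(\<Prod>k<l. \<alpha> k / r) * r powr t = sv_fun t A"
  proof -
    have "r powr t = r ^ l * r powr (t - real l)"
      using r by (simp add: powr_realpow[symmetric] flip: powr_add)
    then show ?thesis using r by (simp add: sv prod_dividef) (simp add: r_def)
  qed
  finally show ?thesis .
qed

text \<open>
  The gain \<open>\<rho>^(s-t)\<close> comes from lowering the exponent. For \<open>s \<ge>
  d\<close> one factor \<open>\<bar>det A\<bar>\<close> of \<open>\<bar>det A\<bar>^(s/d)\<close>
  is compared with the content, and the remaining power is bounded by a power of
  \<open>\<rho>\<close>.
\<close>
lemma sv_fun_le_cover_content:
  fixes t s :: real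
  assumes t: "0 \<le> t" "t < real CARD('d)" "t \<le> s"
  obtains C where "0 < C" "\<And>(A::real^'d^'d) \<rho>. invertible A \<Longrightarrow> 0 < \<rho> \<Longrightarrow>
      (\<And>x. norm (A *v x) \<le> \<rho> * norm x) \<Longrightarrow> sv_fun s A \<le> C * \<rho> powr (s - t) * cover_content t A"
proof (cases "s < real CARD('d)")
  case True
  show ?thesis
  proof (rule that[of "(3 * real CARD('d)) powr s"])
    fix A :: "real^'d^'d" and \<rho> :: real
    assume A: "invertible A" and \<rho>: "0 < \<rho>" "\<And>x. norm (A *v x) \<le> \<rho> * norm x"
    have "sv_fun s A \<le> (3 * real CARD('d)) powr s * cover_content s A"
      by (rule cover_content_ge_sv_fun) (use A t True in auto)
    also have "\<dots> \<le> (3 * real CARD('d)) powr s * (\<rho> powr (s - t) * cover_content t A)"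
      by (intro mult_left_mono cover_content_exponent_mono) (use t \<rho> in auto)
    finally show "sv_fun s A \<le> (3 * real CARD('d)) powr s * \<rho> powr (s - t) * cover_content t A"
      by (simp add: mult_ac)
  qed simp
next
  case False
  let ?d = "real CARD('d)"
  show ?thesis
  proof (rule that[of "(3 * ?d) powr s"])
    fix A :: "real^'d^'d" and \<rho> :: real
    assume A: "invertible A" and \<rho>: "0 < \<rho>" "\<And>x. norm (A *v x) \<le> \<rho> * norm x"
    have det: "\<bar>det A\<bar> \<le> (3 * ?d) powr ?d * (\<rho> powr (?d - t') * cover_content t' A)"
      if "0 \<le> t'" "t' \<le> ?d" for t'
      using abs_det_le_cover_content[OF A] cover_content_exponent_mono[OF that \<rho>]
      by (meson mult_left_mono order_trans powr_ge_zero)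
    have "\<bar>det A\<bar> \<le> (3 * ?d * \<rho>) powr ?d"
    proof -
      have "norm (A *v x) \<le> \<rho>" if "norm x \<le> 1" for x
        using order_trans[OF \<rho>(2)[of x] mult_left_mono[of "norm x" 1 \<rho>]] that \<rho>(1) by simp
      then have "ball_cover A \<rho> {0}" using \<rho>(1) by (auto simp: ball_cover_def)
      from cover_content_le[OF this, of 0] have "cover_content 0 A \<le> 1" using \<rho>(1) by simp
      have "\<bar>det A\<bar> \<le> (3 * ?d) powr ?d * (\<rho> powr ?d * cover_content 0 A)" using det[of 0] by simp
      also have "\<dots> \<le> (3 * ?d) powr ?d * (\<rho> powr ?d * 1)"
        by (intro mult_left_mono \<open>cover_content 0 A \<le> 1\<close>) auto
      also have "\<dots> = (3 * ?d * \<rho>) powr ?d" using \<rho>(1) by (simp add: powr_mult)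
      finally show ?thesis .
    qed
    then have "\<bar>det A\<bar> powr (s / ?d - 1) \<le> ((3 * ?d * \<rho>) powr ?d) powr (s / ?d - 1)"
      using False by (intro powr_mono2) (auto simp: field_simps)
    also have "\<dots> = (3 * ?d) powr (s - ?d) * \<rho> powr (s - ?d)"
      using \<rho>(1) by (simp add: powr_powr powr_mult algebra_simps)
    finally have pow: "\<bar>det A\<bar> powr (s / ?d - 1) \<le> (3 * ?d) powr (s - ?d) * \<rho> powr (s - ?d)" .
    have "sv_fun s A = \<bar>det A\<bar> * \<bar>det A\<bar> powr (s / ?d - 1)"
      using False A by (simp add: sv_fun_def powr_diff invertible_det_nz)
    also have "\<dots> \<le> ((3 * ?d) powr ?d * (\<rho> powr (?d - t) * cover_content t A))
        * ((3 * ?d) powr (s - ?d) * \<rho> powr (s - ?d))"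
      using det[of t] t pow by (intro mult_mono) (auto simp: cover_content_nonneg)
    also have "\<dots> = ((3 * ?d) powr ?d * (3 * ?d) powr (s - ?d))
        * (\<rho> powr (?d - t) * \<rho> powr (s - ?d)) * cover_content t A"
      by (simp only: mult_ac)
    also have "\<dots> = (3 * ?d) powr s * \<rho> powr (s - t) * cover_content t A"
      by (simp flip: powr_add)
    finally show "sv_fun s A \<le> (3 * ?d) powr s * \<rho> powr (s - t) * cover_content t A" .
  qed simp
qed

lemma cover_content_le_sv_fun_powr:
  fixes t s :: real
  assumes t: "0 \<le> s" "s < real CARD('d)" "s \<le> t"
  obtains C where "0 < C" "\<And>(A::real^'d^'d) \<rho>. invertible A \<Longrightarrow> 0 < \<rho> \<Longrightarrow>
      (\<And>x. norm (A *v x) \<le> \<rho> * norm x) \<Longrightarrow> cover_content t A \<le> C * \<rho> powr (t - s) * sv_fun s A"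
proof (rule that[of "5 ^ CARD('d) * real CARD('d) powr s"])
  fix A :: "real^'d^'d" and \<rho> :: real
  assume A: "invertible A" and \<rho>: "0 < \<rho>" "\<And>x. norm (A *v x) \<le> \<rho> * norm x"
  have "cover_content t A \<le> \<rho> powr (t - s) * cover_content s A"
    by (intro cover_content_exponent_mono) (use t \<rho> in auto)
  also have "\<dots> \<le> \<rho> powr (t - s) * (5 ^ CARD('d) * real CARD('d) powr s * sv_fun s A)"
    by (intro mult_left_mono cover_content_le_sv_fun) (use t A in auto)
  finally show "cover_content t A \<le> 5 ^ CARD('d) * real CARD('d) powr s * \<rho> powr (t - s) * sv_fun s A"
    by (simp add: mult_ac)
qed simp

text \<open>
  For \<open>s < d\<close> this is inherited from the content by comparison in both directions;
  for \<open>s \<ge> d\<close> the determinant is multiplicative.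
\<close>
lemma sv_fun_submultiplicative:
  fixes s :: real
  assumes s: "0 \<le> s"
  obtains C where "0 < C" "\<And>A B :: real^'d^'d. invertible A \<Longrightarrow> invertible B \<Longrightarrow>
    sv_fun s (A ** B) \<le> C * sv_fun s A * sv_fun s B"
proof (cases "s < real CARD('d)")
  case True
  define C1 where "C1 = (3 * real CARD('d)) powr s"
  define C2 where "C2 = 5 ^ CARD('d) * real CARD('d) powr s"
  have C: "0 < C1" "0 < C2" by (auto simp: C1_def C2_def)
  show ?thesis
  proof (rule that[of "C1 * C2 * C2"])
    fix A B :: "real^'d^'d" assume AB: "invertible A" "invertible B"
    have "sv_fun s (A ** B) \<le> C1 * cover_content s (A ** B)" unfolding C1_def
      by (rule cover_content_ge_sv_fun) (use AB s True in \<open>auto intro: invertible_mult\<close>)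
    also have "\<dots> \<le> C1 * (cover_content s A * cover_content s B)"
      using C by (intro mult_left_mono cover_content_submult) auto
    also have "\<dots> \<le> C1 * ((C2 * sv_fun s A) * (C2 * sv_fun s B))"
      unfolding C2_def using C s True AB sv_fun_pos[OF AB(1) s]
      by (intro mult_left_mono mult_mono cover_content_le_sv_fun) (auto simp: cover_content_nonneg)
    finally show "sv_fun s (A ** B) \<le> C1 * C2 * C2 * sv_fun s A * sv_fun s B" by (simp add: mult_ac)
  qed (use C in auto)
next
  case False
  show ?thesis
    by (rule that[of 1]) (use False in \<open>auto simp: sv_fun_def det_mul abs_mult powr_mult\<close>)
qed

section \<open>Words, cylinders and invariant measures\<close>

lemma length_init_word [simp]: "length (init_word n x) = n"
  by (simp add: init_word_def)

lemma init_word_0 [simp]: "init_word 0 x = []"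
  by (simp add: init_word_def)

lemma init_word_Suc: "init_word (Suc n) x = x 0 # init_word n (shift x)"
  by (simp add: init_word_def shift_def map_upt_Suc del: upt_Suc)

lemma shift_funpow: "(shift ^^ m) x = (\<lambda>n. x (m + n))"
  by (induction m) (simp_all add: shift_def)

lemma init_word_add: "init_word (m + n) x = init_word m x @ init_word n ((shift ^^ m) x)"
  by (rule nth_equalityI) (auto simp: init_word_def nth_append shift_funpow)

lemma take_init_word: "k \<le> n \<Longrightarrow> take k (init_word n x) = init_word k x"
  by (simp add: init_word_def take_map)

lemma nth_init_word [simp]: "k < n \<Longrightarrow> init_word n x ! k = x k"
  by (simp add: init_word_def)

lemma init_word_eq_iff: "init_word n x = init_word n y \<longleftrightarrow> (\<forall>k<n. x k = y k)"
  by (auto simp: init_word_def)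

lemma mem_cylinder_iff: "x \<in> cylinder w \<longleftrightarrow> (\<forall>k<length w. x k = w ! k)"
  unfolding cylinder_def mem_Collect_eq list_eq_iff_nth_eq length_init_word by (simp add: init_word_def)

lemma finite_words [simp]: "finite (words n :: 'i::finite list set)"
  using finite_lists_length_eq[of "UNIV :: 'i set" n] by (simp add: words_def)

lemma init_word_in_words [simp]: "init_word n x \<in> words n"
  by (simp add: words_def)

lemma words_Suc: "words (Suc n) = (\<lambda>(i, w). i # w) ` (UNIV \<times> words n)"
  by (auto simp: words_def length_Suc_conv image_iff)

lemma words_add: "words (m + n) = (\<lambda>(u, v). u @ v) ` (words m \<times> words n)"
proof (intro set_eqI iffI)
  fix w :: "'a list" assume "w \<in> words (m + n)"
  then have "w = take m w @ drop m w" "take m w \<in> words m" "drop m w \<in> words n"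
    by (auto simp: words_def)
  then show "w \<in> (\<lambda>(u, v). u @ v) ` (words m \<times> words n)" by (metis (mono_tags, lifting) SigmaI case_prod_conv image_eqI)
qed (auto simp: words_def)

lemma inj_on_append_words: "inj_on (\<lambda>(u, v). u @ v) (words m \<times> words n)"
  by (auto simp: inj_on_def words_def)

lemma sum_words_add: "(\<Sum>w\<in>words (m + n). f w) = (\<Sum>u\<in>words m. \<Sum>v\<in>words n. f (u @ v))"
proof -
  have "(\<Sum>w\<in>words (m + n). f w) = (\<Sum>z\<in>words m \<times> words n. f (fst z @ snd z))"
    using sum.reindex[OF inj_on_append_words[of m n], of f] by (simp only: words_add comp_def case_prod_beta)
  then show ?thesis by (simp add: sum.cartesian_product[of "\<lambda>u v. f (u @ v)"] case_prod_beta)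
qed

lemma word_mat_append: "word_mat A (u @ v) = word_mat A u ** word_mat A v"
  by (induction u) (simp_all add: matrix_mul_assoc)

lemma invertible_word_mat: "(\<And>i. invertible (A i)) \<Longrightarrow> invertible (word_mat A w)"
  by (induction w) (auto intro: invertible_mult simp: invertible_def[of "mat 1"])

lemma open_cylinder: "open (cylinder w :: (nat \<Rightarrow> 'i::discrete_topology) set)"
proof -
  have "cylinder w = (\<Inter>k\<in>{..<length w}. (\<lambda>x. x k) -` {w ! k})"
    by (auto simp: mem_cylinder_iff)
  also have "open \<dots>"
  proof (rule open_INT)
    show "\<forall>k\<in>{..<length w}. open ((\<lambda>x :: nat \<Rightarrow> 'i. x k) -` {w ! k})"
      by (intro ballI open_vimage open_discrete continuous_on_product_coordinates)
  qed simp
  finally show ?thesis .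
qed

text \<open>
  A basic open set of the product topology restricts finitely many coordinates only.
\<close>
lemma cylinder_subset_open:
  fixes x :: "nat \<Rightarrow> 'i::discrete_topology"
  assumes "open U" "x \<in> U"
  obtains n where "cylinder (init_word n x) \<subseteq> U"
proof -
  have "openin (product_topology (\<lambda>i. euclidean) UNIV) U" using assms(1) by (simp add: open_fun_def)
  from product_topology_open_contains_basis[OF this assms(2)]
  obtain X where X: "x \<in> PiE UNIV X" "finite {i. X i \<noteq> (UNIV :: 'i set)}" "PiE UNIV X \<subseteq> U"
    by auto
  obtain n where n: "\<And>i. X i \<noteq> UNIV \<Longrightarrow> i < n"
    using X(2) finite_nat_set_iff_bounded by auto
  have "cylinder (init_word n x) \<subseteq> PiE UNIV X"
  proof
    fix y assume "y \<in> cylinder (init_word n x)"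
    then have "\<forall>k<n. y k = x k" by (simp add: cylinder_def init_word_eq_iff)
    then have "y k \<in> X k" for k using X(1) n[of k] by (cases "k < n") (auto simp: PiE_iff)
    then show "y \<in> PiE UNIV X" by (auto simp: PiE_iff)
  qed
  then have "cylinder (init_word n x) \<subseteq> U" using X(3) by (rule subset_trans)
  then show ?thesis by (rule that)
qed

lemma continuous_shift: "continuous_on UNIV (shift :: (nat \<Rightarrow> 'i::topological_space) \<Rightarrow> _)"
  unfolding shift_def by (intro continuous_on_coordinatewise_then_product continuous_on_product_coordinates)

lemma borel_measurable_shift [measurable]:
  "shift \<in> borel_measurable (borel :: (nat \<Rightarrow> 'i::topological_space) measure)"
  by (rule borel_measurable_continuous_onI[OF continuous_shift])

lemma borel_measurable_shift_funpow [measurable]: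
  "(shift ^^ k) \<in> borel_measurable (borel :: (nat \<Rightarrow> 'i::topological_space) measure)"
proof (induction k)
  case (Suc k)
  show ?case using measurable_comp[OF Suc borel_measurable_shift] by (simp add: comp_def)
qed (simp add: id_def)

lemma cylinder_sets [measurable]: "cylinder w \<in> sets (borel :: (nat \<Rightarrow> 'i::discrete_topology) measure)"
  using open_cylinder by (rule borel_open)

lemma measurable_init_word [measurable]:
  "init_word n \<in> borel \<rightarrow>\<^sub>M count_space (UNIV :: 'i::{finite, discrete_topology} list set)"
proof (subst measurable_count_space_eq2_countable, intro conjI ballI)
  fix w :: "'i list"
  show "init_word n -` {w} \<inter> space borel \<in> sets borel"
  proof (cases "length w = n")
    case True
    then have "init_word n -` {w} \<inter> space borel = cylinder w" by (auto simp: cylinder_def)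
    then show ?thesis by simp
  next
    case False
    then have "init_word n -` {w} \<inter> space borel = {}" by auto
    then show ?thesis by simp
  qed
qed auto

locale shift_invariant = prob_space \<mu> for \<mu> :: "(nat \<Rightarrow> 'i::{finite, discrete_topology}) measure" +
  assumes sets_eq: "sets \<mu> = sets borel"
    and invariant: "distr \<mu> borel shift = \<mu>"
begin

abbreviation p :: "'i list \<Rightarrow> real" where "p w \<equiv> prob (cylinder w)"

lemma space_eq [simp]: "space \<mu> = UNIV"
  using sets_eq_imp_space_eq[OF sets_eq] by simp

lemma prob_UNIV [simp]: "prob UNIV = 1"
  using prob_space by simp

lemma measurable_eq [simp]: "measurable \<mu> N = measurable borel N"
  by (rule measurable_cong_sets[OF sets_eq refl])

lemma sets_eq' [measurable_cong]: "sets \<mu> = sets borel"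
  by (rule sets_eq)

lemma emeasure_shift_funpow:
  assumes "B \<in> sets borel"
  shows "emeasure \<mu> ((shift ^^ k) -` B) = emeasure \<mu> B"
  using assms
proof (induction k arbitrary: B)
  case (Suc k)
  have B': "shift -` B \<in> sets borel"
    using measurable_sets[OF borel_measurable_shift Suc.prems] by simp
  have "(shift ^^ Suc k) -` B = (shift ^^ k) -` (shift -` B)" by auto
  then have "emeasure \<mu> ((shift ^^ Suc k) -` B) = emeasure \<mu> (shift -` B)"
    using Suc.IH[OF B'] by simp
  also have "\<dots> = emeasure (distr \<mu> borel shift) B"
    by (subst emeasure_distr) (use Suc.prems in auto)
  finally show ?case by (simp add: invariant comp_def)
qed simp

lemma prob_shift_funpow: "B \<in> sets borel \<Longrightarrow> prob ((shift ^^ k) -` B) = prob B"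
  by (simp add: measure_def emeasure_shift_funpow)

lemma prob_init_word_in:
  assumes "S \<subseteq> words n"
  shows "prob {x. init_word n x \<in> S} = (\<Sum>w\<in>S. p w)"
proof -
  have fin: "finite S" using assms finite_words finite_subset by blast
  have "{x. init_word n x \<in> S} = (\<Union>w\<in>S. cylinder w)"
    using assms by (auto simp: cylinder_def words_def)
  also have "prob \<dots> = (\<Sum>w\<in>S. p w)"
  proof (rule finite_measure_finite_Union[OF fin])
    show "disjoint_family_on cylinder S"
      unfolding disjoint_family_on_def
    proof (intro ballI impI)
      fix u v assume "u \<in> S" "v \<in> S" "u \<noteq> v"
      moreover from this have "length u = n" "length v = n" using assms by (auto simp: words_def)
      ultimately show "cylinder u \<inter> cylinder v = {}" by (auto simp: cylinder_def)
    qed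
  qed (auto simp: sets_eq)
  finally show ?thesis .
qed

lemma sum_p_words: "(\<Sum>w\<in>words n. p w) = 1"
  using prob_init_word_in[of "words n" n] prob_space by simp

lemma sum_p_append_right: "(\<Sum>v\<in>words n. p (u @ v)) = p u"
proof -
  have "(\<Sum>v\<in>words n. p (u @ v)) = (\<Sum>w\<in>(@) u ` words n. p w)"
    by (rule sum.reindex_cong[of "(@) u", symmetric]) (auto simp: inj_on_def)
  also have "\<dots> = prob {x. init_word (length u + n) x \<in> (@) u ` words n}"
    by (rule prob_init_word_in[symmetric]) (auto simp: words_def)
  also have "{x. init_word (length u + n) x \<in> (@) u ` words n} = cylinder u"
    by (auto simp: init_word_add cylinder_def words_def)
  finally show ?thesis .
qed

lemma sum_p_append_left: "(\<Sum>u\<in>words m. p (u @ v)) = p v"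
proof -
  have "(\<Sum>u\<in>words m. p (u @ v)) = (\<Sum>w\<in>(\<lambda>u. u @ v) ` words m. p w)"
    by (rule sum.reindex_cong[of "\<lambda>u. u @ v", symmetric]) (auto simp: inj_on_def)
  also have "\<dots> = prob {x. init_word (m + length v) x \<in> (\<lambda>u. u @ v) ` words m}"
    by (rule prob_init_word_in[symmetric]) (auto simp: words_def)
  also have "{x. init_word (m + length v) x \<in> (\<lambda>u. u @ v) ` words m} = (shift ^^ m) -` cylinder v"
  proof -
    have "init_word (m + length v) x \<in> (\<lambda>u. u @ v) ` words m \<longleftrightarrow> init_word (length v) ((shift ^^ m) x) = v" for x
      unfolding init_word_add by (auto simp: words_def)
    then show ?thesis by (auto simp: cylinder_def)
  qed
  also have "prob \<dots> = p v" by (rule prob_shift_funpow) simp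
  finally show ?thesis .
qed

lemma p_append_le:
  shows "p (u @ v) \<le> p u" and "p (u @ v) \<le> p v"
proof -
  have "v \<in> words (length v)" "u \<in> words (length u)" by (auto simp: words_def)
  then show "p (u @ v) \<le> p u" "p (u @ v) \<le> p v"
    using member_le_sum[of v "words (length v)" "\<lambda>v. p (u @ v)"]
      member_le_sum[of u "words (length u)" "\<lambda>u. p (u @ v)"]
    by (simp_all add: sum_p_append_left sum_p_append_right)
qed

end

text \<open>
  The inequality \<open>ln y \<le> y - 1\<close>, in the form in which sums of it over words
  compare a measure with a weight \<open>g\<close>.
\<close>
lemma gibbs_pointwise:
  assumes "0 \<le> p" "0 < g"
  shows "H p + p * ln g + p * c \<le> g * exp c - p"
proof (cases "p = 0")
  case False
  then have p: "0 < p" using assms by simp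
  have "ln (g * exp c / p) \<le> g * exp c / p - 1"
    using p assms by (intro ln_le_minus_one) simp
  then have "p * ln (g * exp c / p) \<le> p * (g * exp c / p - 1)"
    using p by (intro mult_left_mono) auto
  then show ?thesis using p assms by (simp add: H_def ln_div ln_mult algebra_simps)
qed (use assms in \<open>simp add: H_def\<close>)

context shift_invariant begin

text \<open>
  The joint distribution of the first \<open>m\<close> and the following \<open>n\<close> letters
  is compared with the product of its marginals, both of which are given by \<open>p\<close>
  because the measure is invariant.
\<close>
lemma entropy_subadditive:
  "(\<Sum>w\<in>words (m + n). H (p w)) \<le> (\<Sum>w\<in>words m. H (p w)) + (\<Sum>w\<in>words n. H (p w))"
proof -
  have H_eq: "H (p u) = - p u * ln (p u)" for u by (simp add: H_def)
  have "(\<Sum>w\<in>words (m + n). H (p w)) = (\<Sum>u\<in>words m. \<Sum>v\<in>words n. H (p (u @ v)))"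
    by (rule sum_words_add)
  also have "\<dots> \<le> (\<Sum>u\<in>words m. \<Sum>v\<in>words n.
      - p (u @ v) * ln (p u) - p (u @ v) * ln (p v) + p u * p v - p (u @ v))"
  proof (intro sum_mono)
    fix u v
    show "H (p (u @ v)) \<le> - p (u @ v) * ln (p u) - p (u @ v) * ln (p v) + p u * p v - p (u @ v)"
    proof (cases "p (u @ v) = 0")
      case False
      then have "0 < p (u @ v)" by (simp add: zero_less_measure_iff)
      then have "0 < p u" "0 < p v" using p_append_le[of u v] by linarith+
      then show ?thesis
        using gibbs_pointwise[of "p (u @ v)" "p u * p v" 0] by (simp add: ln_mult algebra_simps)
    qed (simp add: H_def)
  qed
  also have "\<dots> = (\<Sum>w\<in>words m. H (p w)) + (\<Sum>w\<in>words n. H (p w))"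
  proof -
    have "(\<Sum>u\<in>words m. \<Sum>v\<in>words n. p (u @ v) * ln (p u)) = (\<Sum>u\<in>words m. p u * ln (p u))"
      by (simp add: sum_p_append_right flip: sum_distrib_right)
    moreover have "(\<Sum>u\<in>words m. \<Sum>v\<in>words n. p (u @ v) * ln (p v)) = (\<Sum>v\<in>words n. p v * ln (p v))"
      by (subst sum.swap) (simp add: sum_p_append_left flip: sum_distrib_right)
    moreover have "(\<Sum>u\<in>words m. \<Sum>v\<in>words n. p u * p v) = 1"
      by (simp add: sum_p_words flip: sum_distrib_left)
    moreover have "(\<Sum>u\<in>words m. \<Sum>v\<in>words n. p (u @ v)) = 1"
      by (simp add: sum_p_append_right sum_p_words)
    ultimately show ?thesis by (simp add: sum.distrib sum_subtractf sum_negf H_eq)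
  qed
  finally show ?thesis .
qed

end

section \<open>Parsing words into blocks\<close>

text \<open>
  A bound for the number of single letters that are left over when words of \<open>W\<close> are
  split off greedily from the left. All positions are counted, not only those that the greedy scan
  visits, because then the expectation follows from invariance.
\<close>
primrec uncovered :: "'i list set \<Rightarrow> 'i list \<Rightarrow> nat"
  where
    "uncovered W [] = 0"
  | "uncovered W (i # w) = uncovered W w + (if \<exists>u\<in>W. prefix u (i # w) then 0 else 1)"

lemma uncovered_append_ge: "uncovered W v \<le> uncovered W (u @ v)"
  by (induction u) auto

lemma uncovered_le_length: "uncovered W w \<le> length w"
  by (induction w) auto

text \<open>
  Induction on \<open>n\<close>: a word either begins with some \<open>u \<in> W\<close>, which is
  split off as a block, or its first letter is split off as a spacer. The blocks contribute at
  most \<open>\<Sum>u\<in>W. g u e^((\<epsilon>-\<beta>) |u|) \<le> e^(-\<beta> N) \<le>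
  1/2\<close>. A spacer raises \<open>uncovered\<close> by 1, and the factor \<open>1 / R\<close>
  that it brings is so small that all letters together also contribute at most \<open>1/2\<close>.
\<close>
lemma parsing_bound:
  fixes g :: "'i::finite list \<Rightarrow> real" and W :: "'i list set" and D R \<beta> \<epsilon> :: real and N n :: nat
  assumes g: "\<And>w. 0 < g w" "\<And>u v. g (u @ v) \<le> g u * g v" "\<And>i. g [i] \<le> D"
    and W: "finite W" "\<And>u. u \<in> W \<Longrightarrow> N \<le> length u" "(\<Sum>u\<in>W. g u * exp (\<epsilon> * length u)) \<le> 1"
    and N: "1 \<le> N" "exp (- \<beta> * N) \<le> 1 / 2" and \<beta>: "0 < \<beta>" "\<beta> < \<epsilon>"
    and R: "1 \<le> R" "2 * real CARD('i) * D * exp \<epsilon> \<le> R"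
  shows "(\<Sum>w\<in>words n. g w * exp ((\<epsilon> - \<beta>) * n) / R ^ uncovered W w) \<le> g []"
proof (induction n rule: less_induct)
  case (less n)
  define f where "f w = g w * exp ((\<epsilon> - \<beta>) * length w) / R ^ uncovered W w" for w
  have f0: "0 \<le> f w" for w using g(1)[of w] R by (simp add: f_def)
  have IH: "(\<Sum>w\<in>words k. f w) \<le> g []" if "k < n" for k
    using less.IH[OF that] by (simp add: f_def words_def)
  have "(\<Sum>w\<in>words n. f w) \<le> g []"
  proof (cases n)
    case 0
    then show ?thesis by (simp add: words_def f_def)
  next
    case (Suc m)
    define P where "P = {w \<in> words n. \<exists>u\<in>W. prefix u w}"
    define Q where "Q = words n - P"
    have "(\<Sum>w\<in>P. f w) \<le> (\<Sum>u\<in>{u\<in>W. length u \<le> n}. \<Sum>v\<in>words (n - length u). f (u @ v))"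
    proof -
      have fin: "finite (SIGMA u:{u\<in>W. length u \<le> n}. (words (n - length u) :: 'i list set))"
        using W(1) by (intro finite_SigmaI) auto
      have "P \<subseteq> (\<lambda>(u, v). u @ v) ` (SIGMA u:{u\<in>W. length u \<le> n}. words (n - length u))"
        unfolding P_def by (force simp: words_def prefix_def image_iff)
      then have "(\<Sum>w\<in>P. f w) \<le> (\<Sum>w\<in>(\<lambda>(u, v). u @ v) ` (SIGMA u:{u\<in>W. length u \<le> n}. words (n - length u)). f w)"
        by (intro sum_mono2 finite_imageI fin f0) auto
      also have "\<dots> \<le> (\<Sum>z\<in>(SIGMA u:{u\<in>W. length u \<le> n}. words (n - length u)). f (case z of (u, v) \<Rightarrow> u @ v))"
        using sum_image_le[OF fin, of f "\<lambda>(u, v). u @ v"] f0 by (simp add: comp_def)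
      also have "\<dots> = (\<Sum>u\<in>{u\<in>W. length u \<le> n}. \<Sum>v\<in>words (n - length u). f (u @ v))"
        using W(1) by (subst sum.Sigma) (auto simp: case_prod_beta')
      finally show ?thesis .
    qed
    also have "\<dots> \<le> (\<Sum>u\<in>{u\<in>W. length u \<le> n}. g u * exp (\<epsilon> * length u) * (1 / 2) * g [])"
    proof (intro sum_mono)
      fix u assume u: "u \<in> {u\<in>W. length u \<le> n}"
      then have Nu: "N \<le> length u" using W by auto
      have ff: "f (u @ v) \<le> (g u * exp ((\<epsilon> - \<beta>) * length u)) * f v" for v
      proof -
        have "f (u @ v) \<le> (g u * g v) * (exp ((\<epsilon> - \<beta>) * length u) * exp ((\<epsilon> - \<beta>) * length v)) / R ^ uncovered W v"
          unfolding f_def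
        proof (intro frac_le mult_mono g(2))
          show "exp ((\<epsilon> - \<beta>) * real (length (u @ v))) \<le> exp ((\<epsilon> - \<beta>) * length u) * exp ((\<epsilon> - \<beta>) * length v)"
            by (simp add: algebra_simps flip: exp_add)
          show "R ^ uncovered W v \<le> R ^ uncovered W (u @ v)"
            using R(1) by (intro power_increasing uncovered_append_ge)
        qed (use g(1) R in \<open>auto intro: less_imp_le mult_nonneg_nonneg\<close>)
        then show ?thesis by (simp add: f_def mult_ac)
      qed
      have "(\<Sum>v\<in>words (n - length u). f (u @ v)) \<le> (\<Sum>v\<in>words (n - length u). (g u * exp ((\<epsilon> - \<beta>) * length u)) * f v)"
        by (intro sum_mono ff)
      also have "\<dots> = (g u * exp ((\<epsilon> - \<beta>) * length u)) * (\<Sum>v\<in>words (n - length u). f v)"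
        by (simp add: sum_distrib_left)
      also have "\<dots> \<le> (g u * exp ((\<epsilon> - \<beta>) * length u)) * g []"
        using IH[of "n - length u"] Nu N(1) Suc g(1)[of u] by (intro mult_left_mono) auto
      also have "exp ((\<epsilon> - \<beta>) * length u) \<le> exp (\<epsilon> * length u) * (1 / 2)"
      proof -
        have "exp ((\<epsilon> - \<beta>) * length u) = exp (\<epsilon> * length u) * exp (- \<beta> * length u)"
          by (simp add: algebra_simps flip: exp_add)
        also have "exp (- \<beta> * length u) \<le> exp (- \<beta> * N)" using Nu \<beta> by simp
        also note N(2)
        finally show ?thesis by simp
      qed
      finally show "(\<Sum>v\<in>words (n - length u). f (u @ v)) \<le> g u * exp (\<epsilon> * length u) * (1 / 2) * g []"
        using g(1)[of u] g(1)[of "[]"] by (simp add: mult_ac)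
    qed
    also have "\<dots> = (\<Sum>u\<in>{u\<in>W. length u \<le> n}. g u * exp (\<epsilon> * length u)) * (1 / 2) * g []"
      by (simp add: sum_distrib_right)
    also have "\<dots> \<le> 1 * (1 / 2) * g []"
    proof -
      have "(\<Sum>u\<in>{u\<in>W. length u \<le> n}. g u * exp (\<epsilon> * length u)) \<le> (\<Sum>u\<in>W. g u * exp (\<epsilon> * length u))"
        using W(1) g(1) by (intro sum_mono2) (auto intro!: mult_nonneg_nonneg less_imp_le)
      then show ?thesis using W(3) g(1)[of "[]"] by (intro mult_right_mono) auto
    qed
    finally have P: "(\<Sum>w\<in>P. f w) \<le> g [] / 2" by simp
    have "(\<Sum>w\<in>Q. f w) \<le> (\<Sum>z\<in>(UNIV :: 'i set) \<times> words m. (1 / (2 * real CARD('i))) * f (snd z))"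
    proof -
      have Qsub: "Q \<subseteq> (\<lambda>(i, w). i # w) ` (UNIV \<times> words m)"
        by (auto simp: Q_def Suc words_Suc)
      have "(\<Sum>w\<in>Q. f w) = (\<Sum>z\<in>{z \<in> UNIV \<times> words m. fst z # snd z \<in> Q}. f (fst z # snd z))"
        by (rule sum.reindex_cong[of "\<lambda>z. fst z # snd z"]) (use Qsub in \<open>auto simp: inj_on_def image_iff\<close>)
      also have "\<dots> \<le> (\<Sum>z\<in>{z \<in> UNIV \<times> words m. fst z # snd z \<in> Q}. (1 / (2 * real CARD('i))) * f (snd z))"
      proof (intro sum_mono)
        fix z assume z: "z \<in> {z \<in> (UNIV :: 'i set) \<times> words m. fst z # snd z \<in> Q}"
        define i v where "i = fst z" and "v = snd z"
        have iv: "i # v \<in> Q" using z by (simp add: i_def v_def)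
        then have unc: "uncovered W (i # v) = Suc (uncovered W v)"
          by (auto simp: Q_def P_def)
        have D0: "0 < D" using g(1)[of "[i]"] g(3)[of i] by linarith
        have "f (i # v) = g (i # v) * (exp (\<epsilon> - \<beta>) * exp ((\<epsilon> - \<beta>) * length v)) / (R * R ^ uncovered W v)"
          unfolding f_def unc by (simp add: algebra_simps flip: exp_add)
        also have "\<dots> \<le> (D * g v) * (exp \<epsilon> * exp ((\<epsilon> - \<beta>) * length v)) / (R * R ^ uncovered W v)"
        proof (intro divide_right_mono mult_mono)
          have "g (i # v) \<le> g [i] * g v" using g(2)[of "[i]" v] by simp
          also have "\<dots> \<le> D * g v" using g(1)[of v] g(3)[of i] by (intro mult_right_mono) auto
          finally show "g (i # v) \<le> D * g v" .
        qed (use \<beta> D0 g(1)[of v] R in \<open>auto intro: less_imp_le\<close>)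
        also have "\<dots> = (D * exp \<epsilon> / R) * f v" by (simp add: f_def)
        also have "\<dots> \<le> (1 / (2 * real CARD('i))) * f v"
          using R f0 by (intro mult_right_mono) (simp_all add: field_simps)
        finally show "f (fst z # snd z) \<le> (1 / (2 * real CARD('i))) * f (snd z)"
          by (simp add: i_def v_def)
      qed
      also have "\<dots> \<le> (\<Sum>z\<in>(UNIV :: 'i set) \<times> words m. (1 / (2 * real CARD('i))) * f (snd z))"
        by (intro sum_mono2) (auto intro!: divide_nonneg_nonneg f0)
      finally show ?thesis .
    qed
    also have "\<dots> = (\<Sum>i\<in>(UNIV::'i set). \<Sum>v\<in>words m. (1 / (2 * real CARD('i))) * f v)"
      by (simp only: sum.cartesian_product case_prod_unfold)
    also have "\<dots> = (1 / 2) * (\<Sum>v\<in>words m. f v)"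
      by (simp add: sum_distrib_left[symmetric] sum_divide_distrib[symmetric])
    also have "\<dots> \<le> g [] / 2" using IH[of m] Suc by simp
    finally have Q: "(\<Sum>w\<in>Q. f w) \<le> g [] / 2" .
    have "(\<Sum>w\<in>words n. f w) = (\<Sum>w\<in>Q. f w) + (\<Sum>w\<in>P. f w)"
      unfolding Q_def by (rule sum.subset_diff) (auto simp: P_def)
    then show ?thesis using P Q by simp
  qed
  then show ?case by (simp add: f_def words_def)
qed

text \<open>
  A word of \<open>W\<close> that starts at a position \<open>k \<le> n - M\<close> of
  \<open>x\<close> ends within the first \<open>n\<close> letters, so only the last
  \<open>M\<close> positions can be uncovered without the shifted sequence leaving
  \<open>U\<close>.
\<close>
lemma uncovered_init_word_le:
  assumes W: "\<And>u. u \<in> W \<Longrightarrow> length u \<le> M"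
    and U: "U = {x. \<exists>u\<in>W. x \<in> cylinder u}"
  shows "uncovered W (init_word n x) \<le> (\<Sum>k<n. of_bool ((shift ^^ k) x \<notin> U)) + min n M"
proof (induction n arbitrary: x)
  case (Suc n)
  have split: "(\<Sum>k<Suc n. of_bool ((shift ^^ k) x \<notin> U) :: nat)
      = of_bool (x \<notin> U) + (\<Sum>k<n. of_bool ((shift ^^ k) (shift x) \<notin> U))"
    by (subst sum.lessThan_Suc_shift) (simp add: funpow_swap1)
  show ?case
  proof (cases "Suc n \<le> M")
    case True
    have "uncovered W (init_word (Suc n) x) \<le> Suc n"
      using uncovered_le_length[of W "init_word (Suc n) x"] by simp
    then show ?thesis using True by simp
  next
    case False
    have "(\<exists>u\<in>W. prefix u (init_word (Suc n) x))" if xU: "x \<in> U"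
    proof -
      obtain u where u: "u \<in> W" "init_word (length u) x = u" using xU unfolding U cylinder_def mem_Collect_eq by blast
      have "length u \<le> Suc n" using W[OF u(1)] False by simp
      then have "prefix u (init_word (Suc n) x)"
        using take_init_word[of "length u" "Suc n" x] u(2) take_is_prefix by metis
      then show ?thesis using u by blast
    qed
    then have "uncovered W (init_word (Suc n) x) \<le> of_bool (x \<notin> U) + uncovered W (init_word n (shift x))"
      by (auto simp: init_word_Suc)
    also have "\<dots> \<le> of_bool (x \<notin> U) + ((\<Sum>k<n. of_bool ((shift ^^ k) (shift x) \<notin> U)) + min n M)"
      by (intro add_left_mono Suc.IH)
    finally show ?thesis using False by (simp only: split)
  qed
qed simp

section \<open>Local bounds for ergodic measures\<close>

context shift_invariant begin

text \<open>
  The union of all preimages of \<open>G\<close> is strictly invariant, so ergodicity applies to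
  it. It is an increasing union of sets that have the measure of \<open>G\<close>.
\<close>
lemma ergodic_limsup_set:
  assumes erg: "ergodic \<mu>" and G: "G \<in> sets borel" "G \<subseteq> shift -` G"
  shows "prob G = 0 \<or> prob G = 1"
proof -
  define A where "A k = (shift ^^ k) -` G" for k
  have A_sets: "A k \<in> sets borel" for k
    unfolding A_def using measurable_sets[OF borel_measurable_shift_funpow G(1), of k] by simp
  have "A k \<subseteq> A (Suc k)" for k using G(2) by (auto simp: A_def)
  then have inc: "incseq A" by (rule incseq_SucI)
  define B where "B = (\<Union>k. A k)"
  have B_sets: "B \<in> sets borel" unfolding B_def using A_sets by auto
  have "shift -` B = (\<Union>k. A (Suc k))" by (auto simp: B_def A_def funpow_swap1)
  also have "\<dots> = B"
  proof
    show "B \<subseteq> (\<Union>k. A (Suc k))" using \<open>\<And>k. A k \<subseteq> A (Suc k)\<close> by (auto simp: B_def)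
  qed (auto simp: B_def)
  finally have "measure \<mu> B = 0 \<or> measure \<mu> B = 1" using erg B_sets by (simp add: ergodic_def)
  moreover have "emeasure \<mu> B = emeasure \<mu> G"
  proof -
    have "emeasure \<mu> B = (SUP k. emeasure \<mu> (A k))"
      unfolding B_def by (rule SUP_emeasure_incseq[symmetric]) (use A_sets inc in \<open>auto simp: sets_eq\<close>)
    also have "\<dots> = emeasure \<mu> G" by (simp add: A_def emeasure_shift_funpow[OF G(1)])
    finally show ?thesis .
  qed
  ultimately show ?thesis by (simp add: measure_def)
qed

text \<open>
  The shortest bad initial words of length at least \<open>N\<close> form a prefix-free set, whose
  cylinders are therefore disjoint; bounding the length by a large \<open>M\<close> loses little
  measure and leaves finitely many.
\<close>
lemma long_disjoint_cover:
  fixes bad :: "'i list \<Rightarrow> bool"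
  assumes often: "prob {x. \<forall>N. \<exists>n\<ge>N. bad (init_word n x)} = 1" and \<delta>: "0 < \<delta>"
  obtains W M where "finite W" "\<And>u. u \<in> W \<Longrightarrow> bad u \<and> N \<le> length u \<and> length u \<le> M"
    "(\<Sum>u\<in>W. p u) \<le> 1" "1 - \<delta> < prob {x. \<exists>u\<in>W. x \<in> cylinder u}"
proof -
  define V where "V M = {x. \<exists>n. N \<le> n \<and> n \<le> M \<and> bad (init_word n x)}" for M
  have V_sets: "V M \<in> sets borel" for M
  proof -
    have "V M = (\<Union>n\<in>{N..M}. init_word n -` {w. bad w} \<inter> space borel)" by (auto simp: V_def)
    also have "\<dots> \<in> sets borel"
      by (intro sets.finite_UN finite_atLeastAtMost measurable_sets[OF measurable_init_word]) simp
    finally show ?thesis .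
  qed
  have inc: "incseq V" by (rule incseq_SucI) (auto simp: V_def)
  have "prob (\<Union>M. V M) = 1"
  proof -
    have "{x. \<forall>N. \<exists>n\<ge>N. bad (init_word n x)} \<subseteq> (\<Union>M. V M)" unfolding V_def by blast
    then have "1 \<le> prob (\<Union>M. V M)"
      unfolding often[symmetric] using V_sets by (intro finite_measure_mono) (auto simp: sets_eq)
    then show ?thesis by (simp add: antisym)
  qed
  moreover have "(\<lambda>M. prob (V M)) \<longlonglongrightarrow> prob (\<Union>M. V M)"
    by (rule finite_Lim_measure_incseq) (use V_sets inc in \<open>auto simp: sets_eq\<close>)
  ultimately have "\<forall>\<^sub>F M in sequentially. 1 - \<delta> < prob (V M)"
    using \<delta> by (intro order_tendstoD(1)[of _ 1]) auto
  then obtain M where M: "1 - \<delta> < prob (V M)" by (auto simp: eventually_sequentially)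
  define W where "W = {u. N \<le> length u \<and> length u \<le> M \<and> bad u \<and> (\<forall>k<length u. N \<le> k \<longrightarrow> \<not> bad (take k u))}"
  have "W \<subseteq> (\<Union>n\<in>{N..M}. words n)" by (auto simp: W_def words_def)
  then have fin: "finite W" by (rule finite_subset) auto
  have disj: "disjoint_family_on cylinder W"
    unfolding disjoint_family_on_def
  proof (intro ballI impI)
    have *: "length v \<le> length u" if "u \<in> W" "v \<in> W" "x \<in> cylinder u" "x \<in> cylinder v" for u v x
    proof (rule ccontr)
      assume "\<not> length v \<le> length u"
      then have "take (length u) v = u"
        using that(3,4) take_init_word[of "length u" "length v" x] by (simp add: cylinder_def)
      moreover have "\<not> bad (take (length u) v)" "bad u"
        using that(1,2) \<open>\<not> length v \<le> length u\<close> by (simp_all add: W_def)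
      ultimately show False by simp
    qed
    fix u v assume "u \<in> W" "v \<in> W" "u \<noteq> v"
    then show "cylinder u \<inter> cylinder v = {}"
      using *[of u v] *[of v u] by (fastforce simp: cylinder_def)
  qed
  show ?thesis
  proof (rule that[of W M])
    show "(\<Sum>u\<in>W. p u) \<le> 1"
    proof -
      have "cylinder ` W \<subseteq> events" by (auto simp: sets_eq)
      from finite_measure_finite_Union[OF fin this disj] show ?thesis
        by (metis prob_le_1)
    qed
    have "V M = {x. \<exists>u\<in>W. x \<in> cylinder u}"
    proof (intro set_eqI iffI)
      fix x assume "x \<in> V M"
      then obtain n where n: "N \<le> n" "n \<le> M" "bad (init_word n x)" by (auto simp: V_def)
      define m where "m = (LEAST m. N \<le> m \<and> bad (init_word m x))"
      have m: "N \<le> m" "bad (init_word m x)"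
        unfolding m_def using LeastI[of "\<lambda>m. N \<le> m \<and> bad (init_word m x)" n] n by auto
      have "m \<le> n" unfolding m_def using n by (intro Least_le) auto
      have "\<not> bad (init_word k x)" if "k < m" "N \<le> k" for k
        using not_less_Least[of k "\<lambda>m. N \<le> m \<and> bad (init_word m x)"] that by (auto simp: m_def)
      then have "init_word m x \<in> W" using m \<open>m \<le> n\<close> n by (auto simp: W_def take_init_word)
      then show "x \<in> {x. \<exists>u\<in>W. x \<in> cylinder u}" by (auto simp: cylinder_def intro!: bexI[of _ "init_word m x"])
    next
      fix x assume "x \<in> {x. \<exists>u\<in>W. x \<in> cylinder u}"
      then obtain u where "u \<in> W" "init_word (length u) x = u" by (auto simp: cylinder_def)
      then show "x \<in> V M" unfolding V_def W_def by (auto intro!: exI[of _ "length u"])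
    qed
    then show "1 - \<delta> < prob {x. \<exists>u\<in>W. x \<in> cylinder u}" using M by simp
  qed (use fin in \<open>auto simp: W_def\<close>)
qed

text \<open>
  By invariance the expected number of uncovered positions is at most \<open>n \<delta> +
  M\<close>; Markov's inequality at twice this value leaves half of the measure.
\<close>
lemma expected_uncovered_Markov:
  assumes W: "finite W" "\<And>u. u \<in> W \<Longrightarrow> length u \<le> M"
    and cover: "1 - \<delta> < prob {x. \<exists>u\<in>W. x \<in> cylinder u}" and pos: "0 < real n * \<delta> + real M"
  shows "1 / 2 \<le> (\<Sum>w\<in>{w\<in>words n. real (uncovered W w) \<le> 2 * (real n * \<delta> + real M)}. p w)"
proof -
  define U where "U = {x. \<exists>u\<in>W. x \<in> cylinder u}"
  have "U = (\<Union>u\<in>W. cylinder u)" by (auto simp: U_def)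
  then have U_sets: "U \<in> sets borel" using W(1) by auto
  have cU: "prob (- U) \<le> \<delta>"
    using prob_compl[of U] U_sets cover by (simp add: sets_eq U_def Compl_eq_Diff_UNIV)
  define c where "c x = real (uncovered W (init_word n x))" for x
  have c0: "0 \<le> c x" for x by (simp add: c_def)
  have c_meas: "c \<in> borel_measurable borel"
    unfolding c_def by (rule measurable_compose[OF measurable_init_word]) simp
  have c_le: "c x \<le> (\<Sum>k<n. indicator ((shift ^^ k) -` (- U)) x) + real M" for x
  proof -
    have "c x \<le> real ((\<Sum>k<n. of_bool ((shift ^^ k) x \<notin> U)) + min n M)"
      unfolding c_def of_nat_le_iff by (rule uncovered_init_word_le[OF W(2) U_def])
    also have "\<dots> \<le> (\<Sum>k<n. of_bool ((shift ^^ k) x \<notin> U)) + real M" by simp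
    also have "(\<Sum>k<n. of_bool ((shift ^^ k) x \<notin> U)) = (\<Sum>k<n. indicator ((shift ^^ k) -` (- U)) x :: real)"
      by (intro sum.cong) (auto simp: indicator_def)
    finally show ?thesis .
  qed
  have sh: "(shift ^^ k) -` (- U) \<in> sets borel" for k
    using measurable_sets[OF borel_measurable_shift_funpow borel_comp[OF U_sets], of k] by simp
  have c_int: "integrable \<mu> c"
  proof (rule integrable_const_bound[of _ n])
    show "AE x in \<mu>. norm (c x) \<le> real n"
      using uncovered_le_length[of W] by (auto simp: c_def intro!: AE_I2) (metis length_init_word)
  qed (use c_meas in simp)
  have "expectation c \<le> expectation (\<lambda>x. (\<Sum>k<n. indicator ((shift ^^ k) -` (- U)) x) + real M)"
    using c_int sh by (intro integral_mono c_le)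
      (auto intro!: Bochner_Integration.integrable_add Bochner_Integration.integrable_sum integrable_real_indicator simp: sets_eq less_top[symmetric])
  also have "\<dots> = (\<Sum>k<n. prob ((shift ^^ k) -` (- U))) + real M"
    using sh by (subst Bochner_Integration.integral_add)
      (auto intro!: Bochner_Integration.integrable_sum integrable_real_indicator
        simp: Bochner_Integration.integral_sum integrable_real_indicator sets_eq less_top[symmetric] prob_UNIV)
  also have "\<dots> \<le> real n * \<delta> + real M"
    using prob_shift_funpow[of "- U"] U_sets cU by (simp add: mult_left_mono)
  finally have E: "expectation c \<le> real n * \<delta> + real M" .
  define t where "t = 2 * (real n * \<delta> + real M)"
  have t: "0 < t" using pos by (simp add: t_def)
  have "prob {x \<in> space \<mu>. t \<le> c x} \<le> expectation c / t"
    by (rule integral_Markov_inequality_measure[of _ _ "{}"]) (use c_int t c0 in auto)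
  also have "\<dots> \<le> 1 / 2" using E t by (simp add: pos_divide_le_eq) (simp add: t_def)
  finally have half: "prob {x. t \<le> c x} \<le> 1 / 2" by simp
  have ct_sets: "{x. t \<le> c x} \<in> sets borel"
    using borel_measurable_le[OF borel_measurable_const c_meas, of t] by simp
  have "1 / 2 \<le> prob (- {x. t \<le> c x})"
    using prob_compl[of "{x. t \<le> c x}"] ct_sets half by (simp add: sets_eq Compl_eq_Diff_UNIV)
  also have "\<dots> \<le> prob {x. init_word n x \<in> {w\<in>words n. real (uncovered W w) \<le> t}}"
  proof (rule finite_measure_mono)
    show "{x. init_word n x \<in> {w\<in>words n. real (uncovered W w) \<le> t}} \<in> events"
      using measurable_sets[OF measurable_init_word, of "{w\<in>words n. real (uncovered W w) \<le> t}" n]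
      by (simp add: sets_eq vimage_def)
  qed (auto simp: c_def)
  also have "\<dots> = (\<Sum>w\<in>{w\<in>words n. real (uncovered W w) \<le> t}. p w)"
    by (rule prob_init_word_in) auto
  finally show ?thesis by (simp add: t_def)
qed

text \<open>
  Suppose the quotients \<open>r w\<close> of \<open>p w\<close> by \<open>e^(\<epsilon> |w|) g
  w\<close> are unbounded along \<open>x\<close>. Removing the first letter of \<open>x\<close>
  lowers them at most by a constant factor, so the set \<open>G\<close> of these \<open>x\<close>
  is contained in its preimage and has measure 0 or 1. If it had measure 1, parsing into long bad
  words would give a set \<open>S\<close> of words of length \<open>n\<close> with
  \<open>p\<close>-measure at least \<open>1/2\<close> on which \<open>g\<close> sums to at most
  \<open>c0 e^(-\<epsilon> n / 2)\<close>. Then Gibbs' inequality on \<open>S\<close> and on its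
  complement, where \<open>g\<close> sums to at most \<open>e^(\<epsilon> n / 16)\<close>, makes
  entropy plus energy at most \<open>- n \<epsilon> / 4 + n \<epsilon> / 16\<close> up to a
  constant, contradicting the lower bound \<open>- n \<epsilon> / 16\<close>.
\<close>
lemma equilibrium_local_upper_bound:
  fixes g :: "'i list \<Rightarrow> real" and Kn :: "nat \<Rightarrow> 'i list set"
  assumes erg: "ergodic \<mu>"
    and gpos: "\<And>w. 0 < g w" and gsub: "\<And>u v. g (u @ v) \<le> g u * g v"
    and glow: "0 < c" "\<And>i w. c * g w \<le> g (i # w)"
    and Kn: "\<And>n. finite (Kn n)" "\<And>w. p w \<noteq> 0 \<Longrightarrow> w \<in> Kn (length w)"
    and press: "\<And>\<delta>::real. 0 < \<delta> \<Longrightarrow> \<forall>\<^sub>F n in sequentially. (\<Sum>w\<in>Kn n. g w) \<le> exp (\<delta> * n)"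
    and equi: "\<And>\<delta>::real. 0 < \<delta> \<Longrightarrow> \<forall>\<^sub>F n in sequentially. - \<delta> * n \<le> (\<Sum>w\<in>words n. H (p w) + p w * ln (g w))"
    and \<epsilon>: "0 < \<epsilon>"
  shows "AE x in \<mu>. \<exists>C. \<forall>n. p (init_word n x) \<le> C * exp (\<epsilon> * n) * g (init_word n x)"
proof -
  define r where "r w = p w / (exp (\<epsilon> * length w) * g w)" for w
  have r0: "0 \<le> r w" for w using gpos[of w] by (simp add: r_def)
  define G where "G = {x. \<forall>C::nat. \<exists>n. real C < r (init_word n x)}"
  have "G = (\<Inter>C::nat. \<Union>n. init_word n -` {w. real C < r w} \<inter> space borel)" by (auto simp: G_def)
  also have "\<dots> \<in> sets borel"
    by (intro sets.countable_INT' sets.countable_UN' measurable_sets[OF measurable_init_word]) auto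
  finally have G_sets: "G \<in> sets borel" .
  have "G \<subseteq> shift -` G"
  proof
    fix x assume x: "x \<in> G"
    show "x \<in> shift -` G" unfolding G_def vimage_def mem_Collect_eq
    proof
      fix C :: nat
      \<comment> \<open>The summand \<open>r []\<close> excludes that \<open>n = 0\<close>
      below.\<close>
      obtain C' :: nat where C': "real C' > real C / (c * exp \<epsilon>) + r []"
        using reals_Archimedean2 by blast
      obtain n where n: "real C' < r (init_word n x)" using x by (auto simp: G_def)
      have "0 \<le> real C / (c * exp \<epsilon>)" using glow(1) by simp
      then have "n \<noteq> 0" using n C' by (intro notI) simp
      then obtain m where m: "n = Suc m" by (cases n) auto
      define w where "w = init_word m (shift x)"
      have w: "init_word n x = x 0 # w" "length w = m" by (simp_all add: m init_word_Suc w_def)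
      have "r (x 0 # w) \<le> p w / (exp \<epsilon> * exp (\<epsilon> * length w) * (c * g w))"
        unfolding r_def
        using p_append_le(2)[of "[x 0]" w] glow gpos
        by (intro frac_le) (auto simp: algebra_simps mult_left_mono simp flip: exp_add)
      also have "\<dots> = r w / (c * exp \<epsilon>)" by (simp add: r_def)
      finally have "real C / (c * exp \<epsilon>) < r w / (c * exp \<epsilon>)" using n C' w r0[of "[]"] by simp
      then have "real C < r w" using glow(1) by (simp add: divide_less_cancel)
      then show "\<exists>n. real C < r (init_word n (shift x))" by (auto simp: w_def)
    qed
  qed
  from ergodic_limsup_set[OF erg G_sets this] have "prob G = 0"
  proof
    assume full: "prob G = 1"
    define bad where "bad w \<longleftrightarrow> 1 < r w" for w
    have often: "prob {x. \<forall>N. \<exists>n\<ge>N. bad (init_word n x)} = 1"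
    proof -
      have "{x. \<forall>N. \<exists>n\<ge>N. bad (init_word n x)} = (\<Inter>N. \<Union>n\<in>{N..}. init_word n -` {w. bad w} \<inter> space borel)"
        by auto
      also have "\<dots> \<in> sets borel"
        by (intro sets.countable_INT' sets.countable_UN' measurable_sets[OF measurable_init_word]) auto
      finally have sets: "{x. \<forall>N. \<exists>n\<ge>N. bad (init_word n x)} \<in> sets borel" .
      have "G \<subseteq> {x. \<forall>N. \<exists>n\<ge>N. bad (init_word n x)}"
      proof (intro subsetI CollectI allI)
        fix x N assume x: "x \<in> G"
        \<comment> \<open>Exceeding all \<open>r (x|n)\<close> with \<open>n < N\<close> forces
        \<open>n \<ge> N\<close>.\<close>
        obtain C :: nat where C: "real C > 1 + (\<Sum>n<N. r (init_word n x))"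
          using reals_Archimedean2 by blast
        obtain n where n: "real C < r (init_word n x)" using x by (auto simp: G_def)
        have s0: "0 \<le> (\<Sum>n<N. r (init_word n x))" by (intro sum_nonneg r0)
        have "\<not> n < N"
          using member_le_sum[of n "{..<N}" "\<lambda>n. r (init_word n x)"] r0 n C by fastforce
        then show "\<exists>n\<ge>N. bad (init_word n x)" using n C s0 by (intro exI[of _ n]) (auto simp: bad_def)
      qed
      then have "prob G \<le> prob {x. \<forall>N. \<exists>n\<ge>N. bad (init_word n x)}"
        using sets by (intro finite_measure_mono) (auto simp: sets_eq)
      then show ?thesis using full by (simp add: antisym)
    qed
    \<comment> \<open>Of the gain \<open>\<epsilon>\<close> per letter, a quarter pays for the
    blocks and a quarter for the uncovered letters. The constant \<open>R\<close> depends on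
    neither \<open>N\<close> nor \<open>\<delta>\<close>, so that \<open>\<delta>\<close> can be
    chosen after \<open>R\<close> and \<open>N\<close>, \<open>W\<close>, \<open>M\<close> after
    \<open>\<delta>\<close>.\<close>
    define \<beta> where "\<beta> = \<epsilon> / 4"
    define D where "D = (\<Sum>i\<in>UNIV. g [i])"
    have D: "g [i] \<le> D" for i
      unfolding D_def using gpos by (intro member_le_sum) (auto intro: less_imp_le)
    define R where "R = max 1 (2 * real CARD('i) * D * exp \<epsilon>)"
    have R: "1 \<le> R" "2 * real CARD('i) * D * exp \<epsilon> \<le> R" by (auto simp: R_def)
    define \<delta> where "\<delta> = \<epsilon> / (8 * ln R + 8)"
    have lnR: "0 \<le> ln R" using R by simp
    have \<delta>: "0 < \<delta>" "2 * \<delta> * ln R \<le> \<epsilon> / 4"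
      using \<epsilon> lnR by (auto simp: \<delta>_def field_simps)
    obtain N :: nat where N: "1 \<le> N" "exp (- \<beta> * N) \<le> 1 / 2"
    proof -
      obtain N :: nat where N: "real N > ln 2 / \<beta>" using reals_Archimedean2 by blast
      then have "ln 2 < \<beta> * N" using \<epsilon> by (simp add: \<beta>_def field_simps)
      then have "exp (- \<beta> * N) \<le> exp (- ln 2)" by simp
      also have "\<dots> = 1 / 2" by (simp add: exp_minus)
      finally have "exp (- \<beta> * N) \<le> 1 / 2" .
      moreover have "N \<noteq> 0" using \<open>ln 2 < \<beta> * N\<close> by (intro notI) simp
      ultimately show ?thesis using that[of N] by simp
    qed
    obtain W M where W: "finite W" "\<And>u. u \<in> W \<Longrightarrow> bad u \<and> N \<le> length u \<and> length u \<le> M"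
      "(\<Sum>u\<in>W. p u) \<le> 1" "1 - \<delta> < prob {x. \<exists>u\<in>W. x \<in> cylinder u}"
      using long_disjoint_cover[OF often \<delta>(1), of N] by blast
    have Wsum: "(\<Sum>u\<in>W. g u * exp (\<epsilon> * length u)) \<le> 1"
    proof -
      have "g u * exp (\<epsilon> * length u) \<le> p u" if "u \<in> W" for u
        using W(2)[OF that] gpos[of u] by (simp add: bad_def r_def pos_less_divide_eq mult.commute)
      then have "(\<Sum>u\<in>W. g u * exp (\<epsilon> * length u)) \<le> (\<Sum>u\<in>W. p u)" by (intro sum_mono)
      then show ?thesis using W(3) by simp
    qed
    define c0 where "c0 = g [] * exp (2 * real M * ln R)"
    have main: "real n * \<epsilon> / 8 \<le> c0 + 1"
      if n: "0 < n" "(\<Sum>w\<in>Kn n. g w) \<le> exp (\<epsilon> / 16 * n)"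
        "- (\<epsilon> / 16) * n \<le> (\<Sum>w\<in>words n. H (p w) + p w * ln (g w))" for n :: nat
    proof -
      define q where "q = 2 * (real n * \<delta> + real M)"
      define S where "S = {w\<in>words n. real (uncovered W w) \<le> q}"
      have pS: "1 / 2 \<le> (\<Sum>w\<in>S. p w)"
        unfolding S_def q_def
        by (rule expected_uncovered_Markov) (use W \<delta> n in \<open>auto intro: add_pos_nonneg\<close>)
      have gS: "(\<Sum>w\<in>S. g w) * exp (\<epsilon> / 2 * n) \<le> c0"
      proof -
        have "(\<Sum>w\<in>S. g w * exp ((\<epsilon> - \<beta>) * n) / R powr q)
            \<le> (\<Sum>w\<in>S. g w * exp ((\<epsilon> - \<beta>) * n) / R ^ uncovered W w)"
        proof (intro sum_mono divide_left_mono)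
          fix w assume "w \<in> S"
          then show "R ^ uncovered W w \<le> R powr q"
            using R(1) by (simp add: S_def powr_realpow[symmetric] powr_mono)
        qed (use R gpos in \<open>auto intro!: mult_pos_pos mult_nonneg_nonneg less_imp_le[OF gpos]\<close>)
        also have "\<dots> \<le> (\<Sum>w\<in>words n. g w * exp ((\<epsilon> - \<beta>) * n) / R ^ uncovered W w)"
          using R gpos by (intro sum_mono2) (auto simp: S_def intro!: divide_nonneg_nonneg mult_nonneg_nonneg less_imp_le[OF gpos])
        also have "\<dots> \<le> g []"
          by (rule parsing_bound[OF gpos gsub D W(1) _ Wsum N _ _ R])
            (use W(2) \<epsilon> in \<open>auto simp: \<beta>_def\<close>)
        finally have "(\<Sum>w\<in>S. g w) * exp ((\<epsilon> - \<beta>) * n) \<le> g [] * R powr q"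
          using R(1) by (simp add: sum_distrib_right[symmetric] sum_divide_distrib[symmetric] pos_divide_le_eq)
        also have "R powr q = exp (2 * real M * ln R) * exp (2 * \<delta> * ln R * n)"
          using R(1) by (simp add: powr_def q_def algebra_simps flip: exp_add)
        also have "g [] * (exp (2 * real M * ln R) * exp (2 * \<delta> * ln R * n)) \<le> c0 * exp (\<epsilon> / 4 * n)"
        proof -
          have "exp (2 * \<delta> * ln R * n) \<le> exp (\<epsilon> / 4 * n)" using \<delta>(2) mult_right_mono[OF \<delta>(2), of n] by simp
          then show ?thesis using gpos[of "[]"] by (simp add: c0_def mult_left_mono)
        qed
        also have "exp ((\<epsilon> - \<beta>) * n) = exp (\<epsilon> / 2 * n) * exp (\<epsilon> / 4 * n)"
          by (simp add: \<beta>_def field_simps flip: exp_add)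
        finally show ?thesis by simp
      qed
      have 1: "(\<Sum>w\<in>S. H (p w) + p w * ln (g w)) \<le> c0 - n * \<epsilon> / 4"
      proof -
        have "(\<Sum>w\<in>S. H (p w) + p w * ln (g w)) \<le> (\<Sum>w\<in>S. g w * exp (\<epsilon> / 2 * n) - p w * (\<epsilon> / 2 * n))"
        proof (intro sum_mono)
          fix w show "H (p w) + p w * ln (g w) \<le> g w * exp (\<epsilon> / 2 * n) - p w * (\<epsilon> / 2 * n)"
            using gibbs_pointwise[of "p w" "g w" "\<epsilon> / 2 * n"] gpos[of w] by (smt (verit) measure_nonneg)
        qed
        also have "\<dots> = (\<Sum>w\<in>S. g w) * exp (\<epsilon> / 2 * n) - (\<Sum>w\<in>S. p w) * (\<epsilon> / 2 * n)"
          by (simp only: sum_subtractf sum_distrib_right)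
        also have "\<dots> \<le> c0 - (1 / 2) * (\<epsilon> / 2 * n)"
          using gS pS \<epsilon> by (intro diff_mono mult_right_mono) auto
        finally show ?thesis by (simp add: mult.commute)
      qed
      have 2: "(\<Sum>w\<in>words n - S. H (p w) + p w * ln (g w)) \<le> 1 + n * \<epsilon> / 16"
      proof -
        have "(\<Sum>w\<in>words n - S. H (p w) + p w * ln (g w))
            = (\<Sum>w\<in>{w\<in>words n - S. p w \<noteq> 0}. H (p w) + p w * ln (g w))"
          by (rule sum.mono_neutral_right) (auto simp: H_def)
        also have "\<dots> \<le> (\<Sum>w\<in>{w\<in>words n - S. p w \<noteq> 0}. g w * exp (- \<epsilon> / 16 * n) + p w * (\<epsilon> / 16 * n))"
        proof (intro sum_mono)
          fix w show "H (p w) + p w * ln (g w) \<le> g w * exp (- \<epsilon> / 16 * n) + p w * (\<epsilon> / 16 * n)"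
            using gibbs_pointwise[of "p w" "g w" "- \<epsilon> / 16 * n"] gpos[of w] by (smt (verit) measure_nonneg mult_minus_right divide_minus_left mult_minus_left)
        qed
        also have "\<dots> = (\<Sum>w\<in>{w\<in>words n - S. p w \<noteq> 0}. g w) * exp (- \<epsilon> / 16 * n)
            + (\<Sum>w\<in>{w\<in>words n - S. p w \<noteq> 0}. p w) * (\<epsilon> / 16 * n)"
          by (simp only: sum.distrib sum_distrib_right)
        also have "\<dots> \<le> exp (\<epsilon> / 16 * n) * exp (- \<epsilon> / 16 * n) + 1 * (\<epsilon> / 16 * n)"
        proof (intro add_mono mult_right_mono)
          have "(\<Sum>w\<in>{w\<in>words n - S. p w \<noteq> 0}. g w) \<le> (\<Sum>w\<in>Kn n. g w)"
            using Kn gpos by (intro sum_mono2) (auto simp: words_def intro: less_imp_le)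
          then show "(\<Sum>w\<in>{w\<in>words n - S. p w \<noteq> 0}. g w) \<le> exp (\<epsilon> / 16 * n)" using n(2) by simp
          have "(\<Sum>w\<in>{w\<in>words n - S. p w \<noteq> 0}. p w) \<le> (\<Sum>w\<in>words n. p w)"
            by (intro sum_mono2) auto
          then show "(\<Sum>w\<in>{w\<in>words n - S. p w \<noteq> 0}. p w) \<le> 1" by (simp add: sum_p_words)
        qed (use \<epsilon> in auto)
        also have "exp (\<epsilon> / 16 * n) * exp (- \<epsilon> / 16 * n) = 1" by (simp flip: exp_add)
        finally show ?thesis by (simp add: mult.commute)
      qed
      have "(\<Sum>w\<in>words n. H (p w) + p w * ln (g w))
          = (\<Sum>w\<in>words n - S. H (p w) + p w * ln (g w)) + (\<Sum>w\<in>S. H (p w) + p w * ln (g w))"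
        by (rule sum.subset_diff) (auto simp: S_def)
      then show ?thesis using n(3) 1 2 by (simp add: field_simps)
    qed
    have "\<forall>\<^sub>F n in sequentially. real n * \<epsilon> / 8 \<le> c0 + 1"
    proof -
      have e: "0 < \<epsilon> / 16" using \<epsilon> by simp
      show ?thesis
        using press[OF e] equi[OF e] eventually_gt_at_top[of 0]
        by eventually_elim (rule main)
    qed
    then obtain n0 where n0: "\<And>n. n \<ge> n0 \<Longrightarrow> real n * \<epsilon> / 8 \<le> c0 + 1"
      by (auto simp: eventually_sequentially)
    obtain n1 :: nat where "real n1 > (c0 + 1) * 8 / \<epsilon>" using reals_Archimedean2 by blast
    then have "real n1 * \<epsilon> / 8 > c0 + 1" using \<epsilon> by (simp add: field_simps)
    moreover have "real (max n0 n1) * \<epsilon> / 8 \<ge> real n1 * \<epsilon> / 8" using \<epsilon> by (simp add: divide_right_mono mult_right_mono)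
    ultimately show ?thesis using n0[of "max n0 n1"] by simp
  qed
  then have "AE x in \<mu>. x \<notin> G"
    using G_sets by (intro AE_not_in) (auto simp: null_sets_def sets_eq emeasure_eq_measure)
  then show ?thesis
  proof (rule AE_mp, intro AE_I2 impI)
    fix x assume "x \<notin> G"
    then obtain C :: nat where C: "\<And>n. r (init_word n x) \<le> real C" by (auto simp: G_def not_less)
    have "p (init_word n x) \<le> real C * exp (\<epsilon> * n) * g (init_word n x)" for n
      using C[of n] gpos[of "init_word n x"] by (simp add: r_def pos_divide_le_eq mult.assoc)
    then show "\<exists>C. \<forall>n. p (init_word n x) \<le> C * exp (\<epsilon> * n) * g (init_word n x)" by blast
  qed
qed

end

section \<open>Equilibrium measures\<close>

lemma exp_growth_of_limit:
  fixes a :: "nat \<Rightarrow> real"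
  assumes "(\<lambda>n. 1 / real n * a n) \<longlonglongrightarrow> 0" "0 < \<delta>"
  shows "\<forall>\<^sub>F n in sequentially. \<bar>a n\<bar> \<le> \<delta> * real n"
proof -
  have "\<forall>\<^sub>F n in sequentially. \<bar>1 / real n * a n\<bar> < \<delta>"
    using order_tendstoD(2)[OF tendsto_rabs_zero[OF assms(1)] assms(2)] .
  with eventually_gt_at_top[of 0] show ?thesis
    by eventually_elim (auto simp: abs_mult pos_divide_less_eq)
qed

lemma eventually_const_le_linear:
  fixes \<delta> c :: real
  assumes "0 < \<delta>"
  shows "\<forall>\<^sub>F n in sequentially. c \<le> \<delta> * real n"
proof -
  obtain N :: nat where N: "c / \<delta> < real N" using reals_Archimedean2 by blast
  have "c \<le> \<delta> * real n" if "n \<ge> N" for n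
  proof -
    have "c / \<delta> \<le> real n" using N that by linarith
    then show ?thesis using assms by (simp add: pos_divide_le_eq mult.commute)
  qed
  then show ?thesis by (auto simp: eventually_sequentially)
qed

text \<open>
  The properties of the singular value function along words that the thermodynamic part of the
  argument rests on. The lower bound makes the growth at most exponential in both directions, so
  that the limits are finite.
\<close>
locale quasi_submultiplicative =
  fixes \<phi> :: "'i::finite list \<Rightarrow> real" and C c :: real
  assumes pos: "\<And>w. 0 < \<phi> w" and C: "0 < C" and c: "0 < c"
    and upper: "\<And>u v. \<phi> (u @ v) \<le> C * \<phi> u * \<phi> v"
    and lower: "\<And>i w. c * \<phi> w \<le> \<phi> (i # w)"
begin

lemma power_lower: "c ^ length w * \<phi> [] \<le> \<phi> w"
proof (induction w)
  case (Cons i w)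
  have "c ^ length (i # w) * \<phi> [] = c * (c ^ length w * \<phi> [])" by simp
  also have "\<dots> \<le> c * \<phi> w" using Cons c by (intro mult_left_mono) auto
  also have "\<dots> \<le> \<phi> (i # w)" by (rule lower)
  finally show ?case .
qed simp

lemma ln_lower: "- (- ln c) * real (length w) - (- ln (\<phi> [])) \<le> ln (\<phi> w)"
proof -
  have "ln (c ^ length w * \<phi> []) \<le> ln (\<phi> w)"
    using power_lower[of w] c pos[of "[]"] pos[of w] by (subst ln_le_cancel_iff) auto
  then show ?thesis using c pos[of "[]"] by (simp add: ln_mult ln_realpow mult.commute)
qed

lemma ln_upper: "ln (\<phi> (u @ v)) \<le> ln (\<phi> u) + ln (\<phi> v) + ln C"
proof -
  have "ln (\<phi> (u @ v)) \<le> ln (C * \<phi> u * \<phi> v)"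
    using upper[of u v] pos C by (subst ln_le_cancel_iff) auto
  then show ?thesis using pos[of u] pos[of v] C by (simp add: ln_mult)
qed

text \<open>
  Initial words of length \<open>m + n\<close> of points of \<open>K\<close> split into initial
  words of lengths \<open>m\<close> and \<open>n\<close> of points of \<open>K\<close>, because
  \<open>K\<close> is mapped into itself by the shift.
\<close>
lemma pressure_convergent:
  fixes K :: "(nat \<Rightarrow> 'i) set"
  assumes K: "K \<noteq> {}" "shift ` K \<subseteq> K"
  shows "convergent (\<lambda>n. 1 / real n * ln (\<Sum>w\<in>init_word n ` K. \<phi> w))"
proof (rule fekete_convergent)
  define Z where "Z n = (\<Sum>w\<in>init_word n ` K. \<phi> w)" for n
  have fin: "finite (init_word n ` K)" for n
    by (rule finite_subset[OF _ finite_words[of n]]) auto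
  obtain x where x: "x \<in> K" using K by blast
  have Zge: "\<phi> (init_word n x) \<le> Z n" for n
    unfolding Z_def by (rule member_le_sum) (use x fin in \<open>auto intro: less_imp_le[OF pos]\<close>)
  have Zpos: "0 < Z n" for n using Zge[of n] pos[of "init_word n x"] by linarith
  fix m n
  have sh: "(shift ^^ m) x \<in> K" if "x \<in> K" for x
    using that K(2) by (induction m) auto
  have "Z (m + n) \<le> (\<Sum>w\<in>(\<lambda>z. fst z @ snd z) ` (init_word m ` K \<times> init_word n ` K). \<phi> w)"
    unfolding Z_def
  proof (rule sum_mono2)
    show "init_word (m + n) ` K \<subseteq> (\<lambda>z. fst z @ snd z) ` (init_word m ` K \<times> init_word n ` K)"
      using sh by (force simp: init_word_add image_iff)
  qed (auto intro!: finite_imageI finite_cartesian_product fin less_imp_le[OF pos])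
  also have "\<dots> \<le> (\<Sum>z\<in>init_word m ` K \<times> init_word n ` K. \<phi> (fst z @ snd z))"
    using sum_image_le[of "init_word m ` K \<times> init_word n ` K" \<phi> "\<lambda>z. fst z @ snd z"] fin
    by (auto simp: comp_def less_imp_le[OF pos])
  also have "\<dots> \<le> (\<Sum>z\<in>init_word m ` K \<times> init_word n ` K. C * \<phi> (fst z) * \<phi> (snd z))"
    by (intro sum_mono upper)
  also have "\<dots> = C * (Z m * Z n)"
  proof -
    have "Z m * Z n = (\<Sum>z\<in>init_word m ` K \<times> init_word n ` K. \<phi> (fst z) * \<phi> (snd z))"
      by (simp only: Z_def sum_product sum.cartesian_product case_prod_unfold)
    then show ?thesis by (simp add: sum_distrib_left mult.assoc)
  qed
  finally have "Z (m + n) \<le> C * (Z m * Z n)" .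
  then have "ln (Z (m + n)) \<le> ln (C * (Z m * Z n))"
    using Zpos C by (subst ln_le_cancel_iff) auto
  then show "ln (Z (m + n)) \<le> ln (Z m) + ln (Z n) + ln C"
    using Zpos[of m] Zpos[of n] C by (simp add: ln_mult)
  have "ln (\<phi> (init_word n x)) \<le> ln (Z n)"
    using Zge[of n] pos[of "init_word n x"] Zpos[of n] by (subst ln_le_cancel_iff) auto
  then show "- (- ln c) * real n - (- ln (\<phi> [])) \<le> ln (Z n)"
    using ln_lower[of "init_word n x"] by simp
qed

end

context shift_invariant begin

lemma entropy_convergent: "convergent (\<lambda>n. 1 / real n * (\<Sum>w\<in>words n. H (p w)))"
proof (rule fekete_convergent[where C = 0 and B = 0 and D = 0])
  fix m n
  show "(\<Sum>w\<in>words (m + n). H (p w)) \<le> (\<Sum>w\<in>words m. H (p w)) + (\<Sum>w\<in>words n. H (p w)) + 0"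
    using entropy_subadditive[of m n] by simp
  have "0 \<le> H (p w)" for w
    by (auto simp: H_def mult_nonneg_nonpos2 measure_nonneg zero_less_measure_iff ln_le_zero_iff mult_nonneg_nonpos)
  then show "- 0 * real n - 0 \<le> (\<Sum>w\<in>words n. H (p w))" by (simp add: sum_nonneg)
qed

lemma energy_convergent:
  assumes "quasi_submultiplicative \<phi> C c"
  shows "convergent (\<lambda>n. 1 / real n * (\<Sum>w\<in>words n. p w * ln (\<phi> w)))"
proof (rule fekete_convergent)
  interpret quasi_submultiplicative \<phi> C c by (rule assms)
  fix m n
  have "(\<Sum>w\<in>words (m + n). p w * ln (\<phi> w)) = (\<Sum>u\<in>words m. \<Sum>v\<in>words n. p (u @ v) * ln (\<phi> (u @ v)))"
    by (rule sum_words_add)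
  also have "\<dots> \<le> (\<Sum>u\<in>words m. \<Sum>v\<in>words n. p (u @ v) * (ln (\<phi> u) + ln (\<phi> v) + ln C))"
    by (intro sum_mono mult_left_mono ln_upper) auto
  also have "\<dots> = (\<Sum>w\<in>words m. p w * ln (\<phi> w)) + (\<Sum>w\<in>words n. p w * ln (\<phi> w)) + ln C"
  proof -
    have "(\<Sum>u\<in>words m. \<Sum>v\<in>words n. p (u @ v) * ln (\<phi> u)) = (\<Sum>u\<in>words m. p u * ln (\<phi> u))"
      by (simp add: sum_p_append_right flip: sum_distrib_right)
    moreover have "(\<Sum>u\<in>words m. \<Sum>v\<in>words n. p (u @ v) * ln (\<phi> v)) = (\<Sum>v\<in>words n. p v * ln (\<phi> v))"
      by (subst sum.swap) (simp add: sum_p_append_left flip: sum_distrib_right)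
    moreover have "(\<Sum>u\<in>words m. \<Sum>v\<in>words n. p (u @ v) * ln C) = ln C"
      by (simp add: sum_p_append_right sum_p_words flip: sum_distrib_right)
    ultimately show ?thesis by (simp add: distrib_left sum.distrib)
  qed
  finally show "(\<Sum>w\<in>words (m + n). p w * ln (\<phi> w))
    \<le> (\<Sum>w\<in>words m. p w * ln (\<phi> w)) + (\<Sum>w\<in>words n. p w * ln (\<phi> w)) + ln C" .
  have "(\<Sum>w\<in>words n. p w * (- (- ln c) * real n - (- ln (\<phi> [])))) \<le> (\<Sum>w\<in>words n. p w * ln (\<phi> w))"
  proof (intro sum_mono mult_left_mono)
    fix w :: "'i list" assume "w \<in> words n"
    then show "- (- ln c) * real n - (- ln (\<phi> [])) \<le> ln (\<phi> w)"
      using ln_lower[of w] by (simp add: words_def)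
  qed simp
  then show "- (- ln c) * real n - (- ln (\<phi> [])) \<le> (\<Sum>w\<in>words n. p w * ln (\<phi> w))"
    by (simp add: sum_p_words flip: sum_distrib_right)
qed

text \<open>
  Points outside of the support lie in null cylinders, of which there are countably many.
\<close>
lemma AE_in_support: "AE x in \<mu>. x \<in> measure_support \<mu>"
proof -
  define Nw where "Nw = {w. p w = 0}"
  have null: "(\<Union>w\<in>Nw. cylinder w) \<in> null_sets \<mu>"
  proof (rule null_sets_UN')
    show "countable Nw" by (rule countableI_type)
    show "cylinder w \<in> null_sets \<mu>" if "w \<in> Nw" for w
      using that by (simp add: Nw_def null_sets_def sets_eq emeasure_eq_measure)
  qed
  have "x \<in> measure_support \<mu>" if x: "x \<notin> (\<Union>w\<in>Nw. cylinder w)" for x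
  proof (rule ccontr)
    assume "x \<notin> measure_support \<mu>"
    then obtain U where U: "open U" "x \<in> U" "emeasure \<mu> U = 0" by (auto simp: measure_support_def)
    obtain n where n: "cylinder (init_word n x) \<subseteq> U" using cylinder_subset_open[OF U(1,2)] by blast
    have "p (init_word n x) \<le> prob U"
      using n U(1) by (intro finite_measure_mono) (auto simp: sets_eq)
    also have "\<dots> = 0" using U(3) by (simp add: measure_def)
    finally have "init_word n x \<in> Nw" by (simp add: Nw_def measure_le_0_iff)
    moreover have "x \<in> cylinder (init_word n x)" by (simp add: cylinder_def)
    ultimately show False using x by blast
  qed
  then show ?thesis using AE_not_in[OF null] by (auto elim!: eventually_mono)
qed

lemma positive_word_meets:
  assumes "measure_support \<mu> \<subseteq> K" "p w \<noteq> 0"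
  shows "w \<in> init_word (length w) ` K"
proof -
  have "\<exists>x. x \<in> cylinder w \<and> x \<in> K"
  proof (rule ccontr)
    assume no: "\<not> ?thesis"
    have "AE x in \<mu>. x \<notin> cylinder w"
      using AE_in_support by eventually_elim (use no assms(1) in blast)
    then have "emeasure \<mu> (cylinder w) = 0"
      by (subst (asm) AE_iff_measurable[of "cylinder w"]) (auto simp: sets_eq)
    then show False using assms(2) by (simp add: measure_def)
  qed
  then obtain x where "init_word (length w) x = w" "x \<in> K" by (auto simp: cylinder_def)
  then show ?thesis by (metis imageI)
qed

text \<open>
  The constant \<open>C\<close> is absorbed by passing from \<open>\<phi>\<close> to \<open>C
  \<phi>\<close>, which is submultiplicative and has the same exponential growth rates.
\<close>
lemma equilibrium_measure_local_bound:
  fixes K :: "(nat \<Rightarrow> 'i) set"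
  assumes qs: "quasi_submultiplicative \<phi> C c" and erg: "ergodic \<mu>"
    and K: "measure_support \<mu> \<subseteq> K"
    and press: "(\<lambda>n. 1 / real n * ln (\<Sum>w\<in>init_word n ` K. \<phi> w)) \<longlonglongrightarrow> 0"
    and ent: "(\<lambda>n. 1 / real n * (\<Sum>w\<in>words n. H (p w))) \<longlonglongrightarrow> h"
    and ener: "(\<lambda>n. 1 / real n * (\<Sum>w\<in>words n. p w * ln (\<phi> w))) \<longlonglongrightarrow> - h"
    and \<epsilon>: "0 < \<epsilon>"
  shows "AE x in \<mu>. \<exists>B. \<forall>n. p (init_word n x) \<le> B * exp (\<epsilon> * n) * \<phi> (init_word n x)"
proof -
  interpret quasi_submultiplicative \<phi> C c by (rule qs)
  have fin: "finite (init_word n ` K)" for n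
    by (rule finite_subset[OF _ finite_words[of n]]) auto
  have "AE x in \<mu>. \<exists>B. \<forall>n. p (init_word n x) \<le> B * exp (\<epsilon> * n) * (C * \<phi> (init_word n x))"
  proof (rule equilibrium_local_upper_bound[where g = "\<lambda>w. C * \<phi> w" and c = c and Kn = "\<lambda>n. init_word n ` K"])
    show "0 < C * \<phi> w" for w using pos C by simp
    show "C * \<phi> (u @ v) \<le> C * \<phi> u * (C * \<phi> v)" for u v
      using mult_left_mono[OF upper[of u v], of C] C by (simp add: mult_ac)
    show "c * (C * \<phi> w) \<le> C * \<phi> (i # w)" for i w
      using mult_left_mono[OF lower[of w i], of C] C by (simp add: mult_ac)
    show "w \<in> init_word (length w) ` K" if "p w \<noteq> 0" for w
      by (rule positive_word_meets[OF K that])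
    fix \<delta> :: real assume \<delta>: "0 < \<delta>"
    then have d2: "0 < \<delta> / 2" by simp
    show "\<forall>\<^sub>F n in sequentially. (\<Sum>w\<in>init_word n ` K. C * \<phi> w) \<le> exp (\<delta> * real n)"
      using exp_growth_of_limit[OF press d2] eventually_const_le_linear[OF d2, of "ln C"]
    proof eventually_elim
      case (elim n)
      define Z where "Z = (\<Sum>w\<in>init_word n ` K. \<phi> w)"
      have "ln Z \<le> \<delta> / 2 * real n" using elim(1) by (simp add: Z_def)
      moreover have "0 \<le> Z" unfolding Z_def by (intro sum_nonneg less_imp_le[OF pos])
      ultimately have "Z \<le> exp (\<delta> / 2 * real n)"
        by (metis exp_ge_zero exp_le_cancel_iff exp_ln order_le_less)
      moreover have "C \<le> exp (\<delta> / 2 * real n)"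
        using elim(2) C by (metis exp_le_cancel_iff exp_ln)
      ultimately have "C * Z \<le> exp (\<delta> / 2 * real n) * exp (\<delta> / 2 * real n)"
        using C \<open>0 \<le> Z\<close> by (intro mult_mono) auto
      then show ?case by (simp add: Z_def sum_distrib_left flip: exp_add)
    qed
    have "(\<lambda>n. 1 / real n * ((\<Sum>w\<in>words n. H (p w)) + (\<Sum>w\<in>words n. p w * ln (\<phi> w)))) \<longlonglongrightarrow> 0"
      using tendsto_add[OF ent ener] by (simp add: distrib_left)
    from exp_growth_of_limit[OF this d2] eventually_const_le_linear[OF d2, of "- ln C"]
    show "\<forall>\<^sub>F n in sequentially. - \<delta> * real n \<le> (\<Sum>w\<in>words n. H (p w) + p w * ln (C * \<phi> w))"
    proof eventually_elim
      case (elim n)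
      have "(\<Sum>w\<in>words n. H (p w) + p w * ln (C * \<phi> w))
          = (\<Sum>w\<in>words n. H (p w) + p w * ln (\<phi> w) + p w * ln C)"
        using C pos by (intro sum.cong refl) (simp add: ln_mult distrib_left less_imp_neq[symmetric])
      also have "\<dots> = (\<Sum>w\<in>words n. H (p w)) + (\<Sum>w\<in>words n. p w * ln (\<phi> w)) + ln C"
        by (simp add: sum.distrib sum_p_words flip: sum_distrib_right)
      finally show ?case using elim by linarith
    qed
  qed (use erg c fin \<epsilon> in auto)
  then show ?thesis
  proof eventually_elim
    case (elim x)
    then obtain B where "\<And>n. p (init_word n x) \<le> B * exp (\<epsilon> * n) * (C * \<phi> (init_word n x))" by blast
    then show ?case by (intro exI[of _ "B * C"]) (simp add: mult_ac)
  qed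
qed

end

text \<open>
  The lower bound for \<open>i # w\<close> is the upper bound for the product with the inverse of
  \<open>A i\<close>.
\<close>
lemma sv_fun_quasi_submultiplicative:
  fixes A :: "'i::finite \<Rightarrow> real^'d^'d"
  assumes inv: "\<And>i. invertible (A i)" and s: "0 \<le> s"
  obtains C c where "quasi_submultiplicative (\<lambda>w. sv_fun s (word_mat A w)) C c"
proof -
  obtain C where C: "0 < C" "\<And>A B :: real^'d^'d. invertible A \<Longrightarrow> invertible B \<Longrightarrow>
    sv_fun s (A ** B) \<le> C * sv_fun s A * sv_fun s B"
    using sv_fun_submultiplicative[OF s] by blast
  have "\<exists>B. B ** A i = mat 1 \<and> invertible B" for i
    using inv[of i] unfolding invertible_def by metis
  then obtain B where B: "\<And>i. B i ** A i = mat 1" "\<And>i. invertible (B i)" by metis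
  define D where "D = (\<Sum>i\<in>UNIV. sv_fun s (B i))"
  have D: "sv_fun s (B i) \<le> D" for i
    unfolding D_def using sv_fun_pos[OF B(2) s] by (intro member_le_sum) (auto intro: less_imp_le)
  have D0: "0 < D" using D[of undefined] sv_fun_pos[OF B(2) s, of undefined] by linarith
  have pos: "0 < sv_fun s (word_mat A w)" for w
    by (rule sv_fun_pos[OF invertible_word_mat[of A, OF inv] s])
  show ?thesis
  proof (rule that[of C "1 / (C * D)"], unfold_locales)
    fix i w
    have "word_mat A w = B i ** word_mat A (i # w)" by (simp add: B(1) matrix_mul_assoc)
    then have "sv_fun s (word_mat A w) = sv_fun s (B i ** word_mat A (i # w))" by simp
    also have "\<dots> \<le> C * sv_fun s (B i) * sv_fun s (word_mat A (i # w))"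
      by (rule C(2)[OF B(2) invertible_word_mat[of A, OF inv]])
    also have "\<dots> \<le> C * D * sv_fun s (word_mat A (i # w))"
      using D[of i] C(1) pos[of "i # w"] by (intro mult_right_mono mult_left_mono) auto
    finally show "1 / (C * D) * sv_fun s (word_mat A w) \<le> sv_fun s (word_mat A (i # w))"
      using C(1) D0 by (simp add: pos_divide_le_eq mult_ac)
  next
    fix u v
    show "sv_fun s (word_mat A (u @ v)) \<le> C * sv_fun s (word_mat A u) * sv_fun s (word_mat A v)"
      unfolding word_mat_append by (rule C(2)[OF invertible_word_mat[of A, OF inv] invertible_word_mat[of A, OF inv]])
  qed (use C D0 pos in auto)
qed

section \<open>The projection\<close>

lemma continuous_on_init_word:
  fixes f :: "'i::{finite, discrete_topology} list \<Rightarrow> 'b::topological_space"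
  shows "continuous_on UNIV (\<lambda>x. f (init_word n x))"
proof (rule continuous_on_open_vimage[THEN iffD2, rule_format])
  fix B :: "'b set"
  have "(\<lambda>x. f (init_word n x)) -` B \<inter> UNIV = (\<Union>w\<in>{w\<in>words n. f w \<in> B}. cylinder w)"
    by (auto simp: cylinder_def words_def)
  then show "open ((\<lambda>x. f (init_word n x)) -` B \<inter> UNIV)"
    by (simp add: open_UN open_cylinder)
qed simp

locale contracting_matrices =
  fixes A :: "'i::{finite, discrete_topology} \<Rightarrow> real^'d^'d" and \<eta> :: real
  assumes eta: "0 < \<eta>" "\<eta> < 1 / 2" and contr: "\<And>i v. norm (A i *v v) \<le> \<eta> * norm v"
begin

lemma norm_word_mat_le: "norm (word_mat A w *v v) \<le> \<eta> ^ length w * norm v"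
proof (induction w)
  case (Cons i w)
  have "norm (word_mat A (i # w) *v v) = norm (A i *v (word_mat A w *v v))"
    by (simp add: matrix_vector_mul_assoc)
  also have "\<dots> \<le> \<eta> * norm (word_mat A w *v v)" by (rule contr)
  also have "\<dots> \<le> \<eta> * (\<eta> ^ length w * norm v)" using Cons eta by (intro mult_left_mono) auto
  finally show ?case by simp
qed simp

abbreviation proj_term :: "(real^'d, 'i) vec \<Rightarrow> (nat \<Rightarrow> 'i) \<Rightarrow> nat \<Rightarrow> real^'d"
  where "proj_term a x n \<equiv> word_mat A (init_word n x) *v (a $ x n)"

lemma norm_proj_term_le: "norm (proj_term a x n) \<le> norm a * \<eta> ^ n"
proof -
  have "norm (proj_term a x n) \<le> \<eta> ^ n * norm (a $ x n)"
    using norm_word_mat_le[of "init_word n x"] by simp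
  also have "\<dots> \<le> \<eta> ^ n * norm a" using eta by (intro mult_left_mono Finite_Cartesian_Product.norm_nth_le) auto
  finally show ?thesis by (simp add: mult.commute)
qed

lemma summable_majorant: "summable (\<lambda>n. norm (a :: (real^'d, 'i) vec) * \<eta> ^ n)"
  using eta by (intro summable_mult summable_geometric) auto

lemma summable_proj: "summable (proj_term a x)"
  by (rule summable_comparison_test'[OF summable_majorant norm_proj_term_le])

lemma norm_proj_le: "norm (proj A a x) \<le> 2 * norm a"
proof -
  have "norm (proj A a x) \<le> (\<Sum>n. norm a * \<eta> ^ n)"
    unfolding proj_def
    by (rule norm_suminf_le[OF norm_proj_term_le summable_majorant])
  also have "\<dots> = norm a * (1 / (1 - \<eta>))"
    using eta by (subst suminf_mult) (auto simp: suminf_geometric summable_geometric)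
  also have "\<dots> \<le> norm a * 2" using eta by (intro mult_left_mono) (auto simp: field_simps)
  finally show ?thesis by simp
qed

lemma linear_proj: "linear (\<lambda>a. proj A a x)"
proof (rule linearI)
  fix a b c
  show "proj A (a + b) x = proj A a x + proj A b x"
    unfolding proj_def using suminf_add[OF summable_proj[where a = a and x = x] summable_proj[where a = b and x = x]]
    by (simp add: matrix_vector_right_distrib)
  show "proj A (c *\<^sub>R a) x = c *\<^sub>R proj A a x"
    unfolding proj_def using suminf_scaleR_right[OF summable_proj[where a = a and x = x], of c]
    by (simp add: matrix_vector_mult_scaleR)
qed

lemma continuous_proj_translation: "continuous_on S (\<lambda>a. proj A a x)"
  using linear_proj by (simp add: linear_continuous_on linear_conv_bounded_linear)

text \<open>
  Self-affinity: dropping the first \<open>n\<close> letters amounts to applying the affine map of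
  the initial word.
\<close>
lemma proj_split:
  "proj A a x = (\<Sum>k<n. proj_term a x k) + word_mat A (init_word n x) *v proj A a ((shift ^^ n) x)"
proof -
  have "proj A a x = (\<Sum>k. proj_term a x (k + n)) + (\<Sum>k<n. proj_term a x k)"
    unfolding proj_def by (rule suminf_split_initial_segment[OF summable_proj])
  also have "(\<Sum>k. proj_term a x (k + n))
      = (\<Sum>k. word_mat A (init_word n x) *v proj_term a ((shift ^^ n) x) k)"
    by (intro suminf_cong)
      (simp add: add.commute[of _ n] init_word_add word_mat_append matrix_vector_mul_assoc shift_funpow)
  also have "\<dots> = word_mat A (init_word n x) *v proj A a ((shift ^^ n) x)"
    unfolding proj_def
    by (rule bounded_linear.suminf[OF matrix_vector_mul_bounded_linear summable_proj, symmetric])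
  finally show ?thesis by simp
qed

lemma proj_diff:
  assumes "init_word n x = init_word n y"
  shows "proj A a x - proj A a y
    = word_mat A (init_word n x) *v (proj A a ((shift ^^ n) x) - proj A a ((shift ^^ n) y))"
proof -
  have "(\<Sum>k<n. proj_term a x k) = (\<Sum>k<n. proj_term a y k)"
  proof (intro sum.cong refl)
    fix k assume k: "k \<in> {..<n}"
    then have "init_word k x = init_word k y"
      using assms by (metis lessThan_iff less_imp_le take_init_word)
    moreover have "x k = y k" using assms k by (simp add: init_word_eq_iff)
    ultimately show "proj_term a x k = proj_term a y k" by simp
  qed
  then show ?thesis
    using proj_split[of a x n] proj_split[of a y n] assms by (simp add: matrix_vector_mult_diff_distrib)
qed

lemma continuous_proj: "continuous_on UNIV (proj A a)"
proof -
  have "uniform_limit UNIV (\<lambda>n x. \<Sum>k<n. proj_term a x k) (\<lambda>x. suminf (proj_term a x)) sequentially"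
    by (rule Weierstrass_m_test[OF _ summable_majorant]) (rule norm_proj_term_le)
  moreover have "continuous_on UNIV (\<lambda>x. \<Sum>k<n. proj_term a x k)" for n
  proof (intro continuous_on_sum)
    fix k
    have "continuous_on UNIV (\<lambda>x. (\<lambda>w. word_mat A (take k w) *v (a $ (w ! k))) (init_word (Suc k) x))"
      by (rule continuous_on_init_word)
    moreover have "(\<lambda>x. (\<lambda>w. word_mat A (take k w) *v (a $ (w ! k))) (init_word (Suc k) x)) = (\<lambda>x. proj_term a x k)"
      by (auto simp: take_init_word)
    ultimately show "continuous_on UNIV (\<lambda>x. proj_term a x k)" by (simp only:)
  qed
  ultimately show ?thesis
    unfolding proj_def by (intro uniform_limit_theorem[where F = sequentially] always_eventually) auto
qed

lemma measurable_proj [measurable]: "proj A a \<in> borel_measurable borel"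
  by (rule borel_measurable_continuous_onI[OF continuous_proj])

lemma measurable_proj_pair [measurable]:
  "(\<lambda>z. proj A (fst z) (snd z)) \<in> borel_measurable (borel \<Otimes>\<^sub>M borel)"
  unfolding proj_def
proof (rule borel_measurable_suminf)
  fix n
  have "(\<lambda>z. (\<lambda>w z. word_mat A (take n w) *v (fst z $ (w ! n))) (init_word (Suc n) (snd z)) z)
      \<in> borel_measurable ((borel :: (real^'d, 'i) vec measure) \<Otimes>\<^sub>M (borel :: (nat \<Rightarrow> 'i) measure))"
  proof (rule measurable_compose_countable[where f = "\<lambda>w z. word_mat A (take n w) *v (fst z $ (w ! n))"
        and g = "\<lambda>z. init_word (Suc n) (snd z)"])
    fix w :: "'i list"
    have "continuous_on UNIV (\<lambda>a :: (real^'d, 'i) vec. word_mat A (take n w) *v (a $ (w ! n)))"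
      by (intro continuous_intros continuous_on_compose2[OF linear_continuous_on[OF matrix_vector_mul_bounded_linear]]) auto
    then have "(\<lambda>a :: (real^'d, 'i) vec. word_mat A (take n w) *v (a $ (w ! n))) \<in> borel_measurable borel"
      by (rule borel_measurable_continuous_onI)
    then show "(\<lambda>z. word_mat A (take n w) *v (fst z $ (w ! n)))
        \<in> borel_measurable ((borel :: (real^'d, 'i) vec measure) \<Otimes>\<^sub>M (borel :: (nat \<Rightarrow> 'i) measure))"
      by (rule measurable_compose[OF measurable_fst])
  next
    have "snd \<in> (borel :: (real^'d, 'i) vec measure) \<Otimes>\<^sub>M (borel :: (nat \<Rightarrow> 'i) measure) \<rightarrow>\<^sub>M borel"
      by (rule measurable_snd)
    then show "(\<lambda>z. init_word (Suc n) (snd z)) \<in> (borel :: (real^'d, 'i) vec measure)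
        \<Otimes>\<^sub>M (borel :: (nat \<Rightarrow> 'i) measure) \<rightarrow>\<^sub>M count_space UNIV"
      by (rule measurable_compose[OF _ measurable_init_word])
  qed
  moreover have "(\<lambda>z. (\<lambda>w z. word_mat A (take n w) *v (fst z $ (w ! n))) (init_word (Suc n) (snd z)) z)
      = (\<lambda>z. proj_term (fst z) (snd z) n)"
    by (auto simp: take_init_word)
  ultimately show "(\<lambda>z. proj_term (fst z) (snd z) n) \<in> borel_measurable (borel \<Otimes>\<^sub>M borel)"
    by simp
qed

section \<open>Transversality\<close>

text \<open>
  Moving the vector of the letter \<open>x 0\<close> by \<open>v\<close> moves the projection of
  \<open>x\<close> by \<open>v\<close> through the first term of the series, and the first term
  for \<open>y\<close> not at all; all other effects come with a power of \<open>\<eta>\<close>.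
\<close>
lemma proj_axis_perturbation:
  assumes xy: "x 0 \<noteq> y 0"
  defines "c \<equiv> (\<Sum>n. \<eta> ^ Suc n * (of_bool (x (Suc n) = x 0) + of_bool (y (Suc n) = x 0)))"
  shows "norm (proj A (axis (x 0) v) x - proj A (axis (x 0) v) y - v) \<le> c * norm v"
proof -
  let ?a = "axis (x 0) v :: (real^'d, 'i) vec"
  let ?f = "\<lambda>n. \<eta> ^ Suc n * (of_bool (x (Suc n) = x 0) + of_bool (y (Suc n) = x 0)) * norm v"
  have sf: "summable ?f"
  proof (rule summable_comparison_test'[where g = "\<lambda>n. \<eta> ^ n * 2 * norm v" and N = 0])
    show "summable (\<lambda>n. \<eta> ^ n * 2 * norm v)"
      using eta by (intro summable_mult2 summable_geometric) auto
    fix n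
    have "?f n \<le> \<eta> ^ n * 2 * norm v"
      using eta by (intro mult_right_mono mult_mono power_decreasing) (auto simp: of_bool_def)
    moreover have "0 \<le> ?f n" using eta by simp
    ultimately show "norm (?f n) \<le> \<eta> ^ n * 2 * norm v" by simp
  qed
  have "proj A ?a x = (\<Sum>n. proj_term ?a x (Suc n)) + v"
    unfolding proj_def using suminf_split_head[OF summable_proj[where a = ?a and x = x]] by (simp add: axis_def)
  moreover have "proj A ?a y = (\<Sum>n. proj_term ?a y (Suc n))"
    unfolding proj_def using suminf_split_head[OF summable_proj[where a = ?a and x = y]] xy by (simp add: axis_def)
  moreover have "summable (\<lambda>n. proj_term ?a z (Suc n))" for z
    using summable_proj[where a = ?a and x = z] summable_Suc_iff[of "proj_term ?a z"] by simp
  ultimately have "proj A ?a x - proj A ?a y - v = (\<Sum>n. proj_term ?a x (Suc n) - proj_term ?a y (Suc n))"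
    using suminf_diff[of "\<lambda>n. proj_term ?a x (Suc n)" "\<lambda>n. proj_term ?a y (Suc n)"]
      by simp
  also have "norm \<dots> \<le> (\<Sum>n. ?f n)"
  proof (rule norm_suminf_le[OF _ sf])
    fix n
    have t: "norm (proj_term ?a z (Suc n)) \<le> \<eta> ^ Suc n * of_bool (z (Suc n) = x 0) * norm v" for z
    proof (cases "z (Suc n) = x 0")
      case True
      then show ?thesis using norm_word_mat_le[of "init_word (Suc n) z" v] by (simp add: axis_def)
    qed (simp add: axis_def)
    show "norm (proj_term ?a x (Suc n) - proj_term ?a y (Suc n)) \<le> ?f n"
      using norm_triangle_ineq4[of "proj_term ?a x (Suc n)" "proj_term ?a y (Suc n)"] t[of x] t[of y]
      unfolding distrib_left distrib_right by linarith
  qed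
  also have "(\<Sum>n. ?f n) = c * norm v"
  proof (cases "v = 0")
    case False
    then have "summable (\<lambda>n. \<eta> ^ Suc n * (of_bool (x (Suc n) = x 0) + of_bool (y (Suc n) = x 0)))"
      using sf summable_cmult_iff[of "norm v"] by (simp add: mult.commute)
    then show ?thesis unfolding c_def by (rule suminf_mult2[symmetric])
  qed simp
  finally show ?thesis .
qed

text \<open>
  The bound for the deviation from the identity in the better one of two blocks.
\<close>
definition pert :: real where "pert = \<eta> / (1 - \<eta>)"

lemma pert: "0 < pert" "pert < 1"
  using eta by (auto simp: pert_def field_simps)

text \<open>
  For a single block the error series may be as large as \<open>2 \<eta> / (1 - \<eta>)\<close>,
  which need not be less than 1. However, no letter equals both \<open>x 0\<close> and \<open>y
  0\<close>, so the error series for these two blocks add up to at most \<open>2 \<eta> / (1 -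
  \<eta>)\<close>, and one of them is at most \<open>\<eta> / (1 - \<eta>) < 1\<close>.
\<close>
lemma proj_axis_near_identity:
  assumes xy: "x 0 \<noteq> y 0"
  shows "(\<exists>q. \<forall>v. norm (proj A (axis q v) x - proj A (axis q v) y - v) \<le> pert * norm v) \<or>
         (\<exists>q. \<forall>v. norm (proj A (axis q v) y - proj A (axis q v) x - v) \<le> pert * norm v)"
proof -
  define f where "f q n = \<eta> ^ Suc n * (of_bool (x (Suc n) = q) + of_bool (y (Suc n) = q))" for q n
  have sg: "summable (\<lambda>n. 2 * \<eta> ^ Suc n)"
    using eta by (intro summable_mult) (simp add: summable_Suc_iff summable_geometric)
  have sf: "summable (f q)" for q
  proof (rule summable_comparison_test'[OF sg, of 0])
    fix n
    have "\<eta> ^ Suc n * (of_bool (x (Suc n) = q) + of_bool (y (Suc n) = q)) \<le> \<eta> ^ Suc n * 2"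
      using eta by (intro mult_left_mono) (auto simp: of_bool_def)
    moreover have "0 \<le> f q n" using eta by (simp add: f_def)
    ultimately show "norm (f q n) \<le> 2 * \<eta> ^ Suc n" by (simp add: f_def mult.commute)
  qed
  have "suminf (f (x 0)) + suminf (f (y 0)) = (\<Sum>n. f (x 0) n + f (y 0) n)"
    by (rule suminf_add[OF sf sf])
  also have "\<dots> \<le> (\<Sum>n. 2 * \<eta> ^ Suc n)"
  proof (rule suminf_le[OF _ summable_add[OF sf sf] sg])
    fix n show "f (x 0) n + f (y 0) n \<le> 2 * \<eta> ^ Suc n"
      using xy eta by (auto simp: f_def of_bool_def)
  qed
  also have "\<dots> = 2 * pert"
  proof -
    have "(\<Sum>n. \<eta> ^ Suc n) = \<eta> * (\<Sum>n. \<eta> ^ n)"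
      using eta suminf_mult[of "\<lambda>n. \<eta> ^ n" \<eta>] by (simp add: summable_geometric)
    also have "\<dots> = pert" using eta by (simp add: suminf_geometric pert_def)
    finally have "(\<Sum>n. \<eta> ^ Suc n) = pert" .
    moreover have "(\<Sum>n. 2 * \<eta> ^ Suc n) = 2 * (\<Sum>n. \<eta> ^ Suc n)"
      by (rule suminf_mult) (use eta in \<open>simp add: summable_Suc_iff summable_geometric\<close>)
    ultimately show ?thesis by simp
  qed
  finally have "suminf (f (x 0)) \<le> pert \<or> suminf (f (y 0)) \<le> pert" by linarith
  then show ?thesis
  proof
    assume *: "suminf (f (x 0)) \<le> pert"
    have "norm (proj A (axis (x 0) v) x - proj A (axis (x 0) v) y - v) \<le> pert * norm v" for v
      using proj_axis_perturbation[where x = x and y = y, OF xy, of v] mult_right_mono[OF *, of "norm v"]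
      by (simp add: f_def[abs_def])
    then show ?thesis by blast
  next
    assume *: "suminf (f (y 0)) \<le> pert"
    have "norm (proj A (axis (y 0) v) y - proj A (axis (y 0) v) x - v) \<le> pert * norm v" for v
      using proj_axis_perturbation[where x = y and y = x, OF xy[symmetric], of v] mult_right_mono[OF *, of "norm v"]
      by (simp add: f_def[abs_def] add.commute)
    then show ?thesis by blast
  qed
qed

end

lemma emeasure_lborel_translation:
  fixes S :: "'a::euclidean_space set"
  assumes "S \<in> sets borel"
  shows "(+) c ` S \<in> sets borel" "emeasure lborel ((+) c ` S) = emeasure lborel S"
proof -
  have eq: "(+) c ` S = (+) (- c) -` S \<inter> space borel"
  proof (intro set_eqI iffI)
    fix y assume "y \<in> (+) (- c) -` S \<inter> space borel"
    then have "- c + y \<in> S" by simp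
    then have "c + (- c + y) \<in> (+) c ` S" by (rule imageI)
    then show "y \<in> (+) c ` S" by simp
  qed auto
  show "(+) c ` S \<in> sets borel"
    unfolding eq by (rule measurable_sets[OF _ assms]) simp
  have "emeasure lborel S = emeasure (distr lborel borel ((+) (- c))) S"
    by (simp add: lborel_distr_plus)
  also have "\<dots> = emeasure lborel ((+) (- c) -` S \<inter> space lborel)"
    by (rule emeasure_distr) (use assms in auto)
  finally show "emeasure lborel ((+) c ` S) = emeasure lborel S" by (simp add: eq)
qed

lemma norm_axis_vec: "norm (axis q v :: ('b::real_normed_vector, 'n::finite) vec) = norm v"
  by (simp add: norm_vec_def L2_set_def axis_def if_distrib[of norm] if_distrib[of "\<lambda>x. x\<^sup>2"] cong: if_cong)

text \<open>
  In the block \<open>q\<close>, \<open>L\<close> is invertible with an inverse bounded by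
  \<open>1 / (1 - \<theta>)\<close>. So for each \<open>z\<close> in a maximal \<open>2
  r\<close>-separated set \<open>Y\<close> of points of the ellipsoid of \<open>T\<close> there is
  a vector \<open>v z\<close> of bounded length such that translating by \<open>v z\<close> in
  this block adds \<open>z\<close> to \<open>T (L a)\<close>. The translates of the set in
  question are disjoint and lie in a bounded ball, hence its measure is at most that of the ball
  divided by \<open>card Y\<close>, and \<open>card Y (2 r)^u\<close> is at least the content.
\<close>
lemma transversality_measure_bound:
  fixes L :: "real^'d^'i \<Rightarrow> real^'d" and T :: "real^'d^'d"
  assumes lin: "linear L" and near: "\<And>v. norm (L (axis q v) - v) \<le> \<theta> * norm v" and \<theta>: "0 \<le> \<theta>" "\<theta> < 1"
    and r: "0 < r"
  shows "ennreal (cover_content u T) * emeasure lborel {a \<in> cball 0 \<rho>. norm (T *v L a) \<le> r}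
    \<le> ennreal ((2 * r) powr u) * emeasure lborel (cball (0 :: real^'d^'i) (\<rho> + 1 / (1 - \<theta>)))"
proof -
  define S where "S = {a \<in> cball 0 \<rho>. norm (T *v L a) \<le> r}"
  have "linear (\<lambda>a. T *v L a)"
    using linear_compose[OF lin matrix_vector_mul_linear[of T]] by (simp add: comp_def)
  then have contL: "continuous_on UNIV (\<lambda>a. norm (T *v L a))"
    by (intro continuous_on_norm linear_continuous_on) (simp add: linear_conv_bounded_linear)
  have S_sets: "S \<in> sets borel"
  proof -
    have "closed (cball 0 \<rho> \<inter> {a. norm (T *v L a) \<le> r})"
      by (intro closed_Int closed_cball closed_Collect_le contL continuous_on_const)
    moreover have "S = cball 0 \<rho> \<inter> {a. norm (T *v L a) \<le> r}" by (auto simp: S_def)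
    ultimately show ?thesis by (simp add: borel_closed)
  qed
  obtain Y where Y: "Y \<subseteq> (*v) T ` cball 0 1" "ball_cover T (2 * r) Y"
    "\<And>y z. y \<in> Y \<Longrightarrow> z \<in> Y \<Longrightarrow> y \<noteq> z \<Longrightarrow> 2 * r < dist y z"
    using maximal_separated_cover[of "2 * r" T] r by auto
  have finY: "finite Y" using Y(2) by (simp add: ball_cover_def)
  have linN: "linear (\<lambda>v. L (axis q v))"
  proof -
    have "linear (\<lambda>v :: real^'d. axis q v :: real^'d^'i)"
      by (rule linearI) (auto simp: axis_def vec_eq_iff)
    then show ?thesis using linear_compose[OF _ lin] by (auto simp: comp_def)
  qed
  have expand: "(1 - \<theta>) * norm v \<le> norm (L (axis q v))" for v
    using near[of v] norm_triangle_ineq4[of "L (axis q v)" "L (axis q v) - v"] by (simp add: algebra_simps)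
  have "inj (\<lambda>v. L (axis q v))"
  proof (subst linear_injective_0[OF linN], intro allI impI)
    fix v assume "L (axis q v) = 0"
    then have "(1 - \<theta>) * norm v \<le> 0" using expand[of v] by simp
    then show "v = 0" using \<theta> by (simp add: mult_le_0_iff)
  qed
  then have surj: "surj (\<lambda>v. L (axis q v))" by (rule linear_inj_imp_surj[OF linN])
  have "\<exists>v. T *v L (axis q v) = z \<and> norm v \<le> 1 / (1 - \<theta>)" if zY: "z \<in> Y" for z
  proof -
    obtain x where x: "norm x \<le> 1" "z = T *v x" using Y(1) zY by auto
    obtain v where v: "x = L (axis q v)" using surj by (metis surjD)
    have "(1 - \<theta>) * norm v \<le> 1" using expand[of v] x v by simp
    then show ?thesis using x v \<theta> by (intro exI[of _ v]) (simp add: pos_le_divide_eq mult.commute)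
  qed
  then obtain v where v: "\<And>z. z \<in> Y \<Longrightarrow> T *v L (axis q (v z)) = z"
    "\<And>z. z \<in> Y \<Longrightarrow> norm (v z) \<le> 1 / (1 - \<theta>)" by metis
  define V where "V z = (+) (axis q (v z)) ` S" for z
  have V: "V z \<in> sets borel" "emeasure lborel (V z) = emeasure lborel S" for z
    unfolding V_def using emeasure_lborel_translation[OF S_sets] by auto
  have disj: "disjoint_family_on V Y"
    unfolding disjoint_family_on_def
  proof (intro ballI impI, rule ccontr)
    fix y z assume yz: "y \<in> Y" "z \<in> Y" "y \<noteq> z" "V y \<inter> V z \<noteq> {}"
    then obtain a b where ab: "a \<in> S" "b \<in> S" "axis q (v y) + a = axis q (v z) + b"
      unfolding V_def by blast
    then have "T *v L (axis q (v y) + a) = T *v L (axis q (v z) + b)" by simp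
    then have "y + T *v L a = z + T *v L b"
      using yz by (simp add: linear_add[OF lin] matrix_vector_right_distrib v)
    then have "y - z = T *v L b - T *v L a" by (simp add: algebra_simps)
    then have "dist y z \<le> norm (T *v L b) + norm (T *v L a)"
      by (simp add: dist_norm norm_triangle_ineq4)
    also have "\<dots> \<le> 2 * r" using ab by (simp add: S_def)
    finally show False using Y(3)[OF yz(1-3)] by simp
  qed
  have "of_nat (card Y) * emeasure lborel S = (\<Sum>z\<in>Y. emeasure lborel (V z))" by (simp add: V)
  also have "\<dots> = emeasure lborel (\<Union>z\<in>Y. V z)"
    by (rule sum_emeasure[OF _ disj finY]) (use V in auto)
  also have "\<dots> \<le> emeasure lborel (cball (0 :: real^'d^'i) (\<rho> + 1 / (1 - \<theta>)))"
  proof (rule emeasure_mono)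
    show "(\<Union>z\<in>Y. V z) \<subseteq> cball 0 (\<rho> + 1 / (1 - \<theta>))"
    proof
      fix b assume "b \<in> (\<Union>z\<in>Y. V z)"
      then obtain z a where z: "z \<in> Y" "a \<in> S" "b = axis q (v z) + a" by (auto simp: V_def)
      have "norm b \<le> norm (axis q (v z) :: real^'d^'i) + norm a" unfolding z(3) by (rule norm_triangle_ineq)
      also have "norm (axis q (v z) :: real^'d^'i) = norm (v z)" by (rule norm_axis_vec)
      finally show "b \<in> cball 0 (\<rho> + 1 / (1 - \<theta>))" using v(2)[OF z(1)] z(2) by (simp add: S_def)
    qed
  qed simp
  finally have main: "of_nat (card Y) * emeasure lborel S
      \<le> emeasure lborel (cball (0 :: real^'d^'i) (\<rho> + 1 / (1 - \<theta>)))" .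
  have "ennreal (cover_content u T) * emeasure lborel S
      \<le> ennreal (real (card Y) * (2 * r) powr u) * emeasure lborel S"
    using cover_content_le[OF Y(2)] by (intro mult_right_mono ennreal_leI) auto
  also have "\<dots> = ennreal ((2 * r) powr u) * (of_nat (card Y) * emeasure lborel S)"
    by (simp add: ennreal_mult mult_ac ennreal_of_nat_eq_real_of_nat)
  also have "\<dots> \<le> ennreal ((2 * r) powr u) * emeasure lborel (cball (0 :: real^'d^'i) (\<rho> + 1 / (1 - \<theta>)))"
    by (rule mult_left_mono[OF main]) simp
  finally show ?thesis by (simp add: S_def)
qed

text \<open>
  The common initial word contributes the matrix \<open>T\<close>, and the near-identity property
  holds for the two shifted sequences, in one order or the other.
\<close>
lemma (in contracting_matrices) transversality:
  assumes eq: "init_word n x = init_word n y" and ne: "x n \<noteq> y n" and r: "0 < r"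
  shows "ennreal (cover_content u (word_mat A (init_word n x)))
      * emeasure lborel {a \<in> cball 0 \<rho>. dist (proj A a x) (proj A a y) \<le> r}
    \<le> ennreal ((2 * r) powr u) * emeasure lborel (cball (0 :: (real^'d, 'i) vec) (\<rho> + 1 / (1 - pert)))"
proof -
  let ?x = "(shift ^^ n) x" and ?y = "(shift ^^ n) y" and ?T = "word_mat A (init_word n x)"
  have ne0: "?x 0 \<noteq> ?y 0" using ne by (simp add: shift_funpow)
  have d1: "dist (proj A a x) (proj A a y) = norm (?T *v (proj A a ?x - proj A a ?y))" for a
    by (simp add: dist_norm proj_diff[OF eq])
  have d2: "dist (proj A a x) (proj A a y) = norm (?T *v (proj A a ?y - proj A a ?x))" for a
    unfolding d1 by (metis matrix_vector_mult_diff_distrib norm_minus_commute)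
  from proj_axis_near_identity[where x = "?x" and y = "?y", OF ne0] show ?thesis
  proof (elim disjE exE)
    fix q assume "\<forall>v. norm (proj A (axis q v) ?x - proj A (axis q v) ?y - v) \<le> pert * norm v"
    then show ?thesis
      unfolding d1 using pert r
      by (intro transversality_measure_bound[where q = q] linear_compose_sub linear_proj) auto
  next
    fix q assume "\<forall>v. norm (proj A (axis q v) ?y - proj A (axis q v) ?x - v) \<le> pert * norm v"
    then show ?thesis
      unfolding d2 using pert r
      by (intro transversality_measure_bound[where q = q] linear_compose_sub linear_proj) auto
  qed
qed

section \<open>Bounds for Hausdorff dimension\<close>

lemma hausdorff_dim_ge:
  assumes "\<And>s. 0 \<le> s \<Longrightarrow> s \<le> t \<Longrightarrow> hausdorff_measure s E \<noteq> 0"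
  shows "ennreal t \<le> hausdorff_dim E"
  unfolding hausdorff_dim_def
proof (rule INF_greatest)
  fix s assume "s \<in> {s. 0 \<le> s \<and> hausdorff_measure s E = 0}"
  then show "ennreal t \<le> ennreal s" using assms[of s] by (intro ennreal_leI) force
qed

text \<open>
  A set that meets \<open>S\<close> is contained in a dyadic ball around a point of
  \<open>S\<close> whose radius is at most twice the diameter of the set. For \<open>s = 0\<close>
  the unit ball suffices. If the diameter is 0 and \<open>s > 0\<close>, the ball degenerates to a
  point, whose measure is the limit of those of the dyadic balls.
\<close>
lemma frostman_covering_set:
  fixes m :: "'a::metric_space measure"
  assumes fin: "finite_measure m" and sets: "sets m = sets borel"
    and s: "0 \<le> s" "s \<le> t" and C: "0 \<le> C"
    and frostman: "\<And>z k. z \<in> S \<Longrightarrow> measure m (cball z ((1 / 2) ^ k)) \<le> C * ((1 / 2) ^ k) powr t"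
    and U: "bounded U" "diameter U \<le> 1 / 2"
  shows "\<exists>V\<in>sets borel. U \<inter> S \<subseteq> V \<and> emeasure m V \<le> ennreal (C * 2 powr t) * diam_power s U"
proof (cases "U \<inter> S = {}")
  case True
  then show ?thesis by (intro bexI[of _ "{}"]) auto
next
  case False
  interpret finite_measure m by (rule fin)
  obtain z where z: "z \<in> U" "z \<in> S" using False by blast
  define D where "D = diameter U"
  have D: "0 \<le> D" "D \<le> 1 / 2" using U diameter_ge_0 by (auto simp: D_def)
  have UD: "U \<subseteq> cball z D"
    using diameter_bounded_bound[OF U(1) z(1)] by (auto simp: D_def)
  have cb: "cball z r \<in> sets borel" for r by (intro borel_closed closed_cball)
  consider "s = 0" | "0 < s" "D = 0" | "0 < s" "0 < D" using s D by linarith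
  then show ?thesis
  proof cases
    case 1
    have "emeasure m (cball z ((1 / 2) ^ 0)) \<le> ennreal (C * 2 powr t) * diam_power s U"
    proof -
      have "C * 1 \<le> C * 2 powr t" using C s by (intro mult_left_mono) (auto intro: ge_one_powr_ge_zero)
      then have "measure m (cball z ((1 / 2) ^ 0)) \<le> C * 2 powr t" using frostman[OF z(2), of 0] by simp
      then show ?thesis using 1 z(1) by (auto simp: diam_power_def emeasure_eq_measure intro: ennreal_leI)
    qed
    moreover have "U \<inter> S \<subseteq> cball z ((1 / 2) ^ 0)" using UD D by (auto simp: subset_iff)
    ultimately show ?thesis using cb by blast
  next
    case 2
    have "(\<lambda>k. C * ((1 / 2) ^ k) powr t) \<longlonglongrightarrow> 0"
    proof -
      have "(\<lambda>k. C * ((1 / 2) powr t) ^ k) \<longlonglongrightarrow> C * 0"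
        using 2 s by (intro tendsto_mult tendsto_const LIMSEQ_power_zero)
          (auto simp: powr_divide gr_one_powr)
      moreover have "((1 / 2 :: real) ^ k) powr t = ((1 / 2) powr t) ^ k" for k
        by (simp add: powr_realpow[symmetric] powr_powr mult.commute del: powr_realpow)
      ultimately show ?thesis by simp
    qed
    moreover have "measure m (cball z 0) \<le> C * ((1 / 2) ^ k) powr t" for k
      using frostman[OF z(2), of k] finite_measure_mono[of "cball z 0" "cball z ((1 / 2) ^ k)"] cb sets
      by (force intro: order_trans)
    ultimately have "measure m (cball z 0) \<le> 0" by (intro LIMSEQ_le_const) auto
    then have "emeasure m (cball z 0) = 0" by (simp add: emeasure_eq_measure measure_le_0_iff)
    then show ?thesis using UD 2 cb by (intro bexI[of _ "cball z 0"]) auto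
  next
    case 3
    define n where "n = (LEAST n. (1 / 2) ^ n < D)"
    have ex: "\<exists>n. (1 / 2) ^ n < D" using real_arch_pow_inv[of D "1 / 2"] 3 by simp
    have n: "(1 / 2) ^ n < D" unfolding n_def using LeastI_ex[OF ex] .
    have "n \<noteq> 0" using n D by (intro notI) simp
    then obtain k where k: "n = Suc k" by (cases n) auto
    have Dk: "D \<le> (1 / 2) ^ k" using not_less_Least[of k "\<lambda>n. (1 / 2) ^ n < D"] k by (simp add: n_def)
    have kD: "(1 / 2) ^ k \<le> 2 * D" using n k by simp
    have "measure m (cball z ((1 / 2) ^ k)) \<le> C * ((1 / 2) ^ k) powr t" by (rule frostman[OF z(2)])
    also have "\<dots> \<le> C * (2 * D) powr t"
      using C kD s by (intro mult_left_mono powr_mono2) auto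
    also have "\<dots> = C * 2 powr t * D powr t" using D by (simp add: powr_mult)
    also have "\<dots> \<le> C * 2 powr t * D powr s"
      using C D s 3 by (intro mult_left_mono powr_mono') auto
    finally have "emeasure m (cball z ((1 / 2) ^ k)) \<le> ennreal (C * 2 powr t * D powr s)"
      by (simp add: emeasure_eq_measure ennreal_leI)
    also have "\<dots> = ennreal (C * 2 powr t) * diam_power s U"
      using z 3 C by (auto simp: diam_power_def D_def ennreal_mult)
    finally have "emeasure m (cball z ((1 / 2) ^ k)) \<le> ennreal (C * 2 powr t) * diam_power s U" .
    moreover have "U \<inter> S \<subseteq> cball z ((1 / 2) ^ k)" using UD Dk by (auto simp: subset_iff)
    ultimately show ?thesis using cb by blast
  qed
qed

text \<open>
  Every cover of \<open>E\<close> has to carry the mass of \<open>S\<close>, and a set of diameter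
  \<open>\<delta> \<le> 1/2\<close> carries at most a constant times \<open>\<delta>^t \<le>
  \<delta>^s\<close> of it.
\<close>
lemma mass_distribution_principle:
  fixes m :: "'a::metric_space measure"
  assumes fin: "finite_measure m" and sets: "sets m = sets borel"
    and t: "0 \<le> t" and C: "0 \<le> C"
    and frostman: "\<And>z k. z \<in> S \<Longrightarrow> measure m (cball z ((1 / 2) ^ k)) \<le> C * ((1 / 2) ^ k) powr t"
    and S: "S \<in> sets borel" "S \<subseteq> E" "emeasure m S > 0"
  shows "ennreal t \<le> hausdorff_dim E"
proof (rule hausdorff_dim_ge)
  fix s assume s: "0 \<le> s" "s \<le> t"
  define c where "c = ennreal (C * 2 powr t)"
  have "emeasure m S \<le> c * (\<Sum>n. diam_power s (U n))"
    if U: "E \<subseteq> (\<Union>n. U n)" "\<And>n. bounded (U n) \<and> diameter (U n) \<le> 1 / 2" for U :: "nat \<Rightarrow> 'a set"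
  proof -
    have "\<forall>n. \<exists>V\<in>sets borel. U n \<inter> S \<subseteq> V \<and> emeasure m V \<le> c * diam_power s (U n)"
      unfolding c_def using U(2) by (intro allI frostman_covering_set[OF fin sets s C frostman]) auto
    then obtain V where V: "\<And>n. V n \<in> sets borel" "\<And>n. U n \<inter> S \<subseteq> V n"
      "\<And>n. emeasure m (V n) \<le> c * diam_power s (U n)" by metis
    have "S \<subseteq> (\<Union>n. V n)" using U(1) V(2) S(2) by blast
    then have "emeasure m S \<le> emeasure m (\<Union>n. V n)"
      using V(1) sets by (intro emeasure_mono) auto
    also have "\<dots> \<le> (\<Sum>n. emeasure m (V n))"
      using V(1) sets by (intro emeasure_subadditive_countably) auto
    also have "\<dots> \<le> (\<Sum>n. c * diam_power s (U n))" using V(3) by (intro suminf_le) auto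
    also have "\<dots> = c * (\<Sum>n. diam_power s (U n))" by simp
    finally show ?thesis .
  qed
  note * = this
  have ctop: "c < top" by (simp add: c_def)
  have "emeasure m S / c \<le> hausdorff_premeasure s (1 / 2) E"
    unfolding hausdorff_premeasure_def
  proof (rule INF_greatest)
    fix U :: "nat \<Rightarrow> 'a set"
    assume U: "U \<in> {U. E \<subseteq> (\<Union>n. U n) \<and> (\<forall>n. bounded (U n) \<and> diameter (U n) \<le> 1 / 2)}"
    have le: "emeasure m S \<le> c * (\<Sum>n. diam_power s (U n))" using *[of U] U by blast
    then have "c \<noteq> 0" using S(3) by (auto simp: not_less)
    have "emeasure m S / c \<le> (c * (\<Sum>n. diam_power s (U n))) / c" using le by (rule divide_right_mono_ennreal)
    also have "\<dots> = (\<Sum>n. diam_power s (U n))"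
      using \<open>c \<noteq> 0\<close> ctop by (subst mult.commute, intro ennreal_mult_divide_eq) auto
    finally show "emeasure m S / c \<le> (\<Sum>n. diam_power s (U n))" .
  qed
  also have "\<dots> \<le> hausdorff_measure s E"
    unfolding hausdorff_measure_def by (rule SUP_upper) simp
  finally have "emeasure m S / c \<le> hausdorff_measure s E" .
  moreover have "emeasure m S / c > 0" using S(3) ctop by (simp add: ennreal_zero_less_divide)
  ultimately show "hausdorff_measure s E \<noteq> 0" by auto
qed

text \<open>
  Finite covers by balls of different radii, encoded as sets of pairs of centre and radius, are
  padded with empty sets to the sequences that Hausdorff measure is built from.
\<close>
lemma hausdorff_measure_zeroI:
  fixes E :: "'a::metric_space set"
  assumes t: "0 < t"
    and cover: "\<And>\<delta> \<epsilon>. 0 < \<delta> \<Longrightarrow> 0 < \<epsilon> \<Longrightarrow> \<exists>F :: ('a \<times> real) set. finite F \<and>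
      E \<subseteq> (\<Union>z\<in>F. cball (fst z) (snd z)) \<and> (\<forall>z\<in>F. 0 \<le> snd z \<and> 2 * snd z \<le> \<delta>) \<and>
      (\<Sum>z\<in>F. (2 * snd z) powr t) \<le> \<epsilon>"
  shows "hausdorff_measure t E = 0"
proof -
  have "hausdorff_premeasure t \<delta> E = 0" if \<delta>: "0 < \<delta>" for \<delta>
  proof -
    have "hausdorff_premeasure t \<delta> E \<le> 0 + ennreal \<epsilon>" if \<epsilon>: "0 < \<epsilon>" for \<epsilon>
    proof -
      obtain F :: "('a \<times> real) set" where F: "finite F" "E \<subseteq> (\<Union>z\<in>F. cball (fst z) (snd z))"
        "\<And>z. z \<in> F \<Longrightarrow> 0 \<le> snd z \<and> 2 * snd z \<le> \<delta>" "(\<Sum>z\<in>F. (2 * snd z) powr t) \<le> \<epsilon>"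
        using cover[OF \<delta> \<epsilon>] by blast
      obtain h where h: "bij_betw h {..<card F} F"
        using ex_bij_betw_nat_finite[OF F(1)] by (auto simp: atLeast0LessThan)
      define U where "U n = (if n < card F then cball (fst (h n)) (snd (h n)) else {})" for n
      have hF: "h n \<in> F" if "n < card F" for n using h that by (auto simp: bij_betw_def)
      have diam: "diameter (cball c r) \<le> 2 * r" if "0 \<le> r" for c :: 'a and r
      proof -
        have "dist x y \<le> 2 * r" if "x \<in> cball c r" "y \<in> cball c r" for x y
          using that dist_triangle3[of x y c] by simp
        then show ?thesis using that unfolding diameter_def by (auto intro!: cSUP_least)
      qed
      have "E \<subseteq> (\<Union>n. U n)"
      proof
        fix x assume "x \<in> E"
        then obtain z where z: "z \<in> F" "x \<in> cball (fst z) (snd z)" using F(2) by auto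
        then obtain n where "n < card F" "h n = z"
          using h by (metis bij_betw_imp_surj_on imageE lessThan_iff)
        then show "x \<in> (\<Union>n. U n)" using z by (auto simp: U_def)
      qed
      moreover have "bounded (U n) \<and> diameter (U n) \<le> \<delta>" for n
      proof (cases "n < card F")
        case True
        have "0 \<le> snd (h n) \<and> 2 * snd (h n) \<le> \<delta>" using F(3)[of "h n"] hF[OF True] by simp
        then show ?thesis using True diam[of "snd (h n)" "fst (h n)"] by (auto simp: U_def)
      qed (use \<delta> in \<open>simp add: U_def\<close>)
      ultimately have "hausdorff_premeasure t \<delta> E \<le> (\<Sum>n. diam_power t (U n))"
        unfolding hausdorff_premeasure_def by (intro INF_lower) auto
      also have "\<dots> = (\<Sum>n<card F. diam_power t (U n))"
        by (rule suminf_finite) (auto simp: U_def diam_power_def)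
      also have "\<dots> \<le> (\<Sum>n<card F. ennreal ((2 * snd (h n)) powr t))"
      proof (intro sum_mono)
        fix n assume n: "n \<in> {..<card F}"
        have r: "0 \<le> snd (h n)" using F(3)[of "h n"] hF[of n] n by simp
        have "diameter (U n) powr t \<le> (2 * snd (h n)) powr t"
          using n r diam[OF r, of "fst (h n)"] t by (intro powr_mono2) (auto simp: U_def diameter_ge_0)
        then show "diam_power t (U n) \<le> ennreal ((2 * snd (h n)) powr t)"
          using t by (auto simp: diam_power_def intro: ennreal_leI)
      qed
      also have "\<dots> = ennreal (\<Sum>n<card F. (2 * snd (h n)) powr t)" by (rule sum_ennreal) simp
      also have "(\<Sum>n<card F. (2 * snd (h n)) powr t) = (\<Sum>z\<in>F. (2 * snd z) powr t)"
        by (rule sum.reindex_bij_betw[OF h])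
      also have "ennreal \<dots> \<le> ennreal \<epsilon>" using F(4) by (intro ennreal_leI)
      finally show ?thesis by simp
    qed
    then have "hausdorff_premeasure t \<delta> E \<le> 0" by (rule ennreal_le_epsilon)
    then show ?thesis by simp
  qed
  then have "hausdorff_measure t E \<le> 0"
    unfolding hausdorff_measure_def by (intro SUP_least) auto
  then show ?thesis by simp
qed

lemma hausdorff_dim_le:
  assumes m: "0 \<le> m" and "\<And>t. m < t \<Longrightarrow> hausdorff_measure t E = 0"
  shows "hausdorff_dim E \<le> ennreal m"
proof (rule ennreal_le_epsilon)
  fix e :: real assume "0 < e"
  then have "hausdorff_dim E \<le> ennreal (m + e)"
    unfolding hausdorff_dim_def using assms by (intro INF_lower) auto
  then show "hausdorff_dim E \<le> ennreal m + ennreal e" using m \<open>0 < e\<close> by simp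
qed

text \<open>
  A ball of \<open>d\<close>-space is covered by about \<open>r^(-d)\<close> balls of radius
  \<open>r\<close>. This takes care of the case \<open>s \<ge> d\<close> of the upper bound, with
  the empty word as the only word.
\<close>
lemma cover_content_mat_1:
  assumes t: "real CARD('d) < t"
  shows "cover_content t (mat 1 :: real^'d^'d) = 0"
proof -
  let ?d = "real CARD('d)"
  obtain e :: "nat \<Rightarrow> real^'d" where
    on: "\<And>i j. i < CARD('d) \<Longrightarrow> j < CARD('d) \<Longrightarrow> e i \<bullet> e j = (if i = j then 1 else 0)"
    by (rule singular_value_decomposition[of "mat 1 :: real^'d^'d"]) blast
  have le: "cover_content t (mat 1 :: real^'d^'d) \<le> 5 ^ CARD('d) * ?d powr t * r powr (t - ?d)"
    if r: "0 < r" "r \<le> 1" for r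
  proof -
    obtain F where F: "ball_cover (mat 1 :: real^'d^'d) (?d * r) F"
      "real (card F) \<le> (\<Prod>k<CARD('d). 5 * max 1 (1 / r))"
      using grid_ball_cover[OF on, where A = "mat 1 :: real^'d^'d" and \<alpha> = "\<lambda>_. 1" and r = r] r on
      by (auto simp: norm_eq_sqrt_inner)
    have "real (card F) \<le> 5 ^ CARD('d) * (1 / r) ^ CARD('d)"
      using F(2) r by (simp add: max_def power_mult_distrib[symmetric] field_simps split: if_splits)
    then have "cover_content t (mat 1 :: real^'d^'d) \<le> (5 ^ CARD('d) * (1 / r) ^ CARD('d)) * (?d * r) powr t"
      using cover_content_le[OF F(1), of t] by (meson mult_right_mono order_trans powr_ge_zero)
    also have "\<dots> = 5 ^ CARD('d) * ?d powr t * r powr (t - ?d)"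
      using r by (simp add: powr_mult powr_diff powr_realpow power_one_over field_simps)
    finally show ?thesis .
  qed
  have "cover_content t (mat 1 :: real^'d^'d) \<le> 0"
  proof (rule tendsto_lowerbound[of "\<lambda>r. 5 ^ CARD('d) * ?d powr t * r powr (t - ?d)" _ "at_right 0"])
    have "((\<lambda>r. r powr (t - ?d)) \<longlongrightarrow> 0) (at_right (0::real))"
    proof (rule tendsto_zero_powrI)
      show "((\<lambda>r::real. r) \<longlongrightarrow> 0) (at_right 0)" by (rule tendsto_ident_at)
      show "\<forall>\<^sub>F r::real in at_right 0. 0 \<le> r" by (auto simp: eventually_at_right_field intro!: exI[of _ 1])
    qed (use t in auto)
    from tendsto_mult[OF tendsto_const this, of "5 ^ CARD('d) * ?d powr t"]
    show "((\<lambda>r. 5 ^ CARD('d) * ?d powr t * r powr (t - ?d)) \<longlongrightarrow> 0) (at_right 0)" by simp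
    show "\<forall>\<^sub>F r in at_right 0. cover_content t (mat 1 :: real^'d^'d) \<le> 5 ^ CARD('d) * ?d powr t * r powr (t - ?d)"
      using le by (auto simp: eventually_at_right_field intro!: exI[of _ 1])
  qed simp
  then show ?thesis using cover_content_nonneg[of t "mat 1 :: real^'d^'d"] by simp
qed

text \<open>
  The piece of \<open>\<pi>(K)\<close> that belongs to a word \<open>w\<close> is a translate of a
  subset of \<open>R A\<^sub>w(B(0,1))\<close>, hence it is covered by the scaled balls of a
  near-optimal cover for \<open>A\<^sub>w\<close>. If the sum of the contents is small, so is
  every single radius.
\<close>
lemma (in contracting_matrices) hausdorff_measure_proj_zero:
  assumes t: "0 < t" and small: "\<And>\<epsilon>. 0 < \<epsilon> \<Longrightarrow> \<exists>n. (\<Sum>w\<in>init_word n ` K. cover_content t (word_mat A w)) < \<epsilon>"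
  shows "hausdorff_measure t (proj A a ` K) = 0"
proof (rule hausdorff_measure_zeroI[OF t])
  fix \<delta> \<epsilon> :: real assume \<delta>: "0 < \<delta>" and \<epsilon>: "0 < \<epsilon>"
  define R where "R = 2 * norm a + 1"
  have R: "1 \<le> R" by (simp add: R_def)
  \<comment> \<open>Small enough both for the total \<open>\<epsilon>\<close> and, since each
  cover has at least one ball, for the bound \<open>\<delta>\<close> on the diameters.\<close>
  define \<epsilon>' where "\<epsilon>' = min \<epsilon> (\<delta> powr t) / (2 * R) powr t"
  have \<epsilon>': "0 < \<epsilon>'" using \<epsilon> \<delta> R by (simp add: \<epsilon>'_def)
  obtain n where n: "(\<Sum>w\<in>init_word n ` K. cover_content t (word_mat A w)) < \<epsilon>'"
    using small[OF \<epsilon>'] by blast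
  define W where "W = init_word n ` K"
  have finW: "finite W" unfolding W_def by (rule finite_subset[OF _ finite_words[of n]]) auto
  \<comment> \<open>The slack that each single cover may use up.\<close>
  define \<gamma> where "\<gamma> = (\<epsilon>' - (\<Sum>w\<in>W. cover_content t (word_mat A w))) / (real (card W) + 1)"
  have \<gamma>: "0 < \<gamma>" using n by (simp add: \<gamma>_def W_def)
  have "\<exists>F r. ball_cover (word_mat A w) r F \<and> real (card F) * r powr t < cover_content t (word_mat A w) + \<gamma>" for w
    using cover_content_less[of t "word_mat A w" "cover_content t (word_mat A w) + \<gamma>"] \<gamma> by (metis less_add_same_cancel1)
  then obtain F r where Fr: "\<And>w. ball_cover (word_mat A w) (r w) (F w)"
    "\<And>w. real (card (F w)) * r w powr t < cover_content t (word_mat A w) + \<gamma>" by metis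
  have r: "0 < r w" "finite (F w)" for w using Fr(1)[of w] by (auto simp: ball_cover_def)
  define c where "c w = (\<Sum>k<n. word_mat A (take k w) *v (a $ (w ! k)))" for w
  define G where "G = (\<lambda>(w, z). (c w + R *\<^sub>R z, R * r w)) ` (SIGMA w:W. F w)"
  have sum_le: "(\<Sum>w\<in>W. real (card (F w)) * r w powr t) \<le> \<epsilon>'"
  proof -
    have "(\<Sum>w\<in>W. real (card (F w)) * r w powr t) \<le> (\<Sum>w\<in>W. cover_content t (word_mat A w) + \<gamma>)"
      by (intro sum_mono less_imp_le Fr(2))
    also have "\<dots> = (\<Sum>w\<in>W. cover_content t (word_mat A w)) + real (card W) * \<gamma>" by (simp add: sum.distrib)
    also have "\<dots> \<le> (\<Sum>w\<in>W. cover_content t (word_mat A w)) + (real (card W) + 1) * \<gamma>" using \<gamma> by simp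
    also have "\<dots> = \<epsilon>'" by (simp add: \<gamma>_def)
    finally show ?thesis .
  qed
  have finG: "finite G" unfolding G_def using finW r by (intro finite_imageI finite_SigmaI) auto
  show "\<exists>F :: ((real^'d) \<times> real) set. finite F \<and>
      proj A a ` K \<subseteq> (\<Union>z\<in>F. cball (fst z) (snd z)) \<and> (\<forall>z\<in>F. 0 \<le> snd z \<and> 2 * snd z \<le> \<delta>) \<and>
      (\<Sum>z\<in>F. (2 * snd z) powr t) \<le> \<epsilon>"
  proof (intro exI[of _ G] conjI finG)
    show "proj A a ` K \<subseteq> (\<Union>z\<in>G. cball (fst z) (snd z))"
    proof
      fix y assume "y \<in> proj A a ` K"
      then obtain x where x: "x \<in> K" "y = proj A a x" by blast
      define w where "w = init_word n x"
      have w: "w \<in> W" using x by (simp add: w_def W_def)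
      define v where "v = proj A a ((shift ^^ n) x) /\<^sub>R R"
      have "norm v \<le> 1" using norm_proj_le[of a "(shift ^^ n) x"] R by (simp add: v_def field_simps) (simp add: R_def)
      then obtain z where z: "z \<in> F w" "dist z (word_mat A w *v v) \<le> r w"
        using Fr(1)[of w] unfolding ball_cover_def by (force simp: image_subset_iff)
      have "(\<Sum>k<n. proj_term a x k) = c w"
        unfolding c_def by (intro sum.cong) (auto simp: w_def take_init_word)
      then have "y = c w + R *\<^sub>R (word_mat A w *v v)"
        using proj_split[of a x n] R x
        by (simp add: w_def v_def matrix_vector_mult_scaleR)
      then have "dist (c w + R *\<^sub>R z) y = R * dist z (word_mat A w *v v)"
        using R by (simp add: dist_norm flip: scaleR_diff_right)
      also have "\<dots> \<le> R * r w" using z R by (intro mult_left_mono) auto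
      finally have "y \<in> cball (c w + R *\<^sub>R z) (R * r w)" by simp
      moreover have "(c w + R *\<^sub>R z, R * r w) \<in> G" unfolding G_def using w z by force
      ultimately show "y \<in> (\<Union>z\<in>G. cball (fst z) (snd z))" by force
    qed
    have rad: "2 * (R * r w) \<le> \<delta>" if w: "w \<in> W" for w
    proof -
      have "1 * r w powr t \<le> real (card (F w)) * r w powr t"
        using ball_cover_card_ge_1[OF Fr(1)[of w]] by (intro mult_right_mono) auto
      also have "\<dots> \<le> (\<Sum>w\<in>W. real (card (F w)) * r w powr t)"
        by (rule member_le_sum[OF w _ finW]) auto
      also have "\<dots> \<le> \<epsilon>'" by (rule sum_le)
      also have "\<epsilon>' \<le> \<delta> powr t / (2 * R) powr t" unfolding \<epsilon>'_def by (intro divide_right_mono) auto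
      finally have "(2 * R * r w) powr t \<le> \<delta> powr t"
        using R r[of w] by (simp add: powr_mult pos_le_divide_eq mult_ac)
      then have "2 * R * r w \<le> \<delta>"
        using powr_less_mono2[of t \<delta> "2 * R * r w"] t \<delta> by fastforce
      then show ?thesis by (simp add: mult.assoc)
    qed
    then show "\<forall>z\<in>G. 0 \<le> snd z \<and> 2 * snd z \<le> \<delta>"
      unfolding G_def using R r(1) by (auto intro!: mult_nonneg_nonneg less_imp_le[OF r(1)])
    have "(\<Sum>z\<in>G. (2 * snd z) powr t) \<le> (\<Sum>(w, z)\<in>(SIGMA w:W. F w). (2 * (R * r w)) powr t)"
    proof -
      have "finite (SIGMA w:W. F w)" using finW r by (intro finite_SigmaI) auto
      from sum_image_le[OF this, of "\<lambda>z. (2 * snd z) powr t" "\<lambda>(w, z). (c w + R *\<^sub>R z, R * r w)"]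
      show ?thesis by (simp add: G_def comp_def case_prod_beta')
    qed
    also have "\<dots> = (\<Sum>w\<in>W. real (card (F w)) * (2 * (R * r w)) powr t)"
      using finW r by (subst sum.Sigma[symmetric]) auto
    also have "\<dots> = (2 * R) powr t * (\<Sum>w\<in>W. real (card (F w)) * r w powr t)"
      using R r(1) by (simp add: sum_distrib_left powr_mult less_imp_le mult_ac)
    also have "\<dots> \<le> (2 * R) powr t * \<epsilon>'" by (intro mult_left_mono sum_le) simp
    also have "\<dots> \<le> \<epsilon>" using R by (simp add: \<epsilon>'_def)
    finally show "(\<Sum>z\<in>G. (2 * snd z) powr t) \<le> \<epsilon>" .
  qed
qed

section \<open>Mass of balls for typical translations\<close>

lemma cover_content_pos:
  fixes A :: "real^'d^'d"
  assumes "invertible A" "0 \<le> u" "u < real CARD('d)"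
  shows "0 < cover_content u A"
proof -
  have "0 < (3 * real CARD('d)) powr u * cover_content u A"
    using cover_content_ge_sv_fun[OF assms] sv_fun_pos[OF assms(1,2)] by linarith
  then show ?thesis by (simp add: zero_less_mult_iff)
qed

locale projected_measure = contracting_matrices A \<eta> + shift_invariant \<mu>
  for A :: "'i::{finite, discrete_topology} \<Rightarrow> real^'d^'d" and \<eta> :: real and \<mu> :: "(nat \<Rightarrow> 'i) measure"
begin

lemma cover_content_word_mat_le_1: "cover_content u (word_mat A w) \<le> 1"
proof -
  have "norm (word_mat A w *v x) \<le> 1" if "norm x \<le> 1" for x
  proof -
    have "norm (word_mat A w *v x) \<le> \<eta> ^ length w * norm x" by (rule norm_word_mat_le)
    also have "\<dots> \<le> 1 * 1" using eta that by (intro mult_mono power_le_one) auto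
    finally show ?thesis by simp
  qed
  then have "ball_cover (word_mat A w) 1 {0}" by (auto simp: ball_cover_def)
  from cover_content_le[OF this, of u] show ?thesis by simp
qed

text \<open>
  The mass of the ball of radius \<open>r\<close> around the projection of \<open>x\<close>, as a
  function of the pair \<open>(a, x)\<close>: it has to be measurable in both variables together.
\<close>
definition mass :: "real \<Rightarrow> (real^'d, 'i) vec \<times> (nat \<Rightarrow> 'i) \<Rightarrow> ennreal"
  where "mass r z = emeasure \<mu> {y. dist (proj A (fst z) (snd z)) (proj A (fst z) y) \<le> r}"

lemma measurable_mass [measurable]: "mass r \<in> borel_measurable (borel \<Otimes>\<^sub>M borel)"
proof -
  let ?N = "(borel :: (real^'d, 'i) vec measure) \<Otimes>\<^sub>M (borel :: (nat \<Rightarrow> 'i) measure)"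
  define Q where "Q = {z :: ((real^'d, 'i) vec \<times> (nat \<Rightarrow> 'i)) \<times> (nat \<Rightarrow> 'i).
      dist (proj A (fst (fst z)) (snd (fst z))) (proj A (fst (fst z)) (snd z)) \<le> r}"
  have 1: "(\<lambda>z. proj A (fst (fst z)) (snd (fst z))) \<in> borel_measurable (?N \<Otimes>\<^sub>M (borel :: (nat \<Rightarrow> 'i) measure))"
    by (rule measurable_compose[OF measurable_fst measurable_proj_pair])
  have "(\<lambda>z. (fst (fst z), snd z)) \<in> ?N \<Otimes>\<^sub>M (borel :: (nat \<Rightarrow> 'i) measure) \<rightarrow>\<^sub>M ?N"
    by measurable
  from measurable_compose[OF this measurable_proj_pair]
  have 2: "(\<lambda>z. proj A (fst (fst z)) (snd z)) \<in> borel_measurable (?N \<Otimes>\<^sub>M (borel :: (nat \<Rightarrow> 'i) measure))"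
    by simp
  have "{z \<in> space (?N \<Otimes>\<^sub>M borel). dist (proj A (fst (fst z)) (snd (fst z))) (proj A (fst (fst z)) (snd z)) \<le> r}
      \<in> sets (?N \<Otimes>\<^sub>M (borel :: (nat \<Rightarrow> 'i) measure))"
    by (intro borel_measurable_le borel_measurable_dist 1 2 borel_measurable_const)
  then have "Q \<in> sets (?N \<Otimes>\<^sub>M \<mu>)"
    by (simp add: Q_def space_pair_measure sets_eq cong: sets_pair_measure_cong)
  from measurable_emeasure_Pair[OF this] show ?thesis
    by (simp add: mass_def[abs_def] Q_def vimage_def)
qed

text \<open>
  Fubini's theorem turns the average mass of a ball around the projection of \<open>x\<close> into
  the integral over \<open>y\<close> of the measure of the parameters for which \<open>x\<close>
  and \<open>y\<close> have close projections. The \<open>y\<close> that first differ from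
  \<open>x\<close> at position \<open>n\<close> lie in the cylinder of \<open>x|n\<close>, so
  transversality and the local bound at \<open>x\<close> leave a geometric series.
\<close>
lemma integral_mass_bound:
  assumes u: "0 < u" "u < real CARD('d)" and inv: "\<And>i. invertible (A i)"
    and \<theta>: "0 < \<theta>" "\<theta> < 1" and B: "0 \<le> B"
    and loc: "\<And>n. p (init_word n x) \<le> B * \<theta> ^ n * cover_content u (word_mat A (init_word n x))"
  obtains M where "M < top"
    "\<And>r. 0 < r \<Longrightarrow> (\<integral>\<^sup>+a. indicator (cball 0 \<rho>) a * mass r (a, x) \<partial>lborel) \<le> M * ennreal (r powr u)"
proof -
  interpret pair_sigma_finite "lborel :: (real^'d, 'i) vec measure" \<mu> ..
  define g where "g n = cover_content u (word_mat A (init_word n x))" for n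
  have g: "0 < g n" "g n \<le> 1" for n
    using cover_content_pos[OF invertible_word_mat[of A, OF inv]] u cover_content_word_mat_le_1
    by (auto simp: g_def)
  define V where "V = emeasure lborel (cball (0 :: (real^'d, 'i) vec) (\<rho> + 1 / (1 - pert)))"
  have V: "V < top" unfolding V_def using emeasure_bounded_finite[OF bounded_cball] by simp
  \<comment> \<open>The diagonal \<open>y = x\<close>, where there is no first difference, carries
  no mass.\<close>
  have point: "emeasure \<mu> {x} = 0"
  proof -
    have "(\<lambda>n. B * \<theta> ^ n) \<longlonglongrightarrow> B * 0" using \<theta> by (intro tendsto_mult tendsto_const LIMSEQ_power_zero) auto
    moreover have "prob {x} \<le> B * \<theta> ^ n" for n
    proof -
      have "prob {x} \<le> p (init_word n x)"
        by (intro finite_measure_mono) (auto simp: cylinder_def sets_eq)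
      also have "\<dots> \<le> B * \<theta> ^ n * g n" using loc by (simp add: g_def)
      also have "\<dots> \<le> B * \<theta> ^ n * 1" using B \<theta> g by (intro mult_left_mono) auto
      finally show ?thesis by simp
    qed
    ultimately have "prob {x} \<le> 0" by (intro LIMSEQ_le_const) auto
    then show ?thesis by (simp add: emeasure_eq_measure measure_le_0_iff)
  qed
  have singleton: "{x} \<in> sets borel"
  proof -
    have "{x} = (\<Inter>n. cylinder (init_word n x))"
    proof (intro set_eqI iffI)
      fix y assume "y \<in> (\<Inter>n. cylinder (init_word n x))"
      then have "init_word (Suc k) y = init_word (Suc k) x" for k by (simp add: cylinder_def)
      then have "y k = x k" for k by (metis init_word_eq_iff lessI)
      then show "y \<in> {x}" by auto
    qed (auto simp: cylinder_def)
    then show ?thesis by (simp add: sets.countable_INT'')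
  qed
  define S where "S r y = {a \<in> cball 0 \<rho>. dist (proj A a x) (proj A a y) \<le> r}" for r y
  have "(\<integral>\<^sup>+a. indicator (cball 0 \<rho>) a * mass r (a, x) \<partial>lborel)
      \<le> (ennreal (2 powr u) * V * ennreal (B / (1 - \<theta>))) * ennreal (r powr u)" if r: "0 < r" for r
  proof -
    have m1: "(\<lambda>z. proj A (fst z) x) \<in> borel_measurable (lborel \<Otimes>\<^sub>M \<mu>)"
    proof -
      have "(\<lambda>a. proj A a x) \<in> borel_measurable borel"
        by (rule borel_measurable_continuous_onI[OF continuous_proj_translation])
      then show ?thesis by (intro measurable_compose[OF measurable_fst]) simp
    qed
    have m2: "(\<lambda>z. proj A (fst z) (snd z)) \<in> borel_measurable (lborel \<Otimes>\<^sub>M \<mu>)"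
      using measurable_proj_pair by (simp cong: measurable_cong_sets sets_pair_measure_cong add: sets_eq)
    define f where "f a y = (indicator (cball 0 \<rho>) a * indicator {z. dist (proj A (fst z) x) (proj A (fst z) (snd z)) \<le> r} (a, y) :: ennreal)" for a y
    have fm: "(\<lambda>z. f (fst z) (snd z)) \<in> borel_measurable (lborel \<Otimes>\<^sub>M \<mu>)"
    proof -
      have "{z \<in> space (lborel \<Otimes>\<^sub>M \<mu>). dist (proj A (fst z) x) (proj A (fst z) (snd z)) \<le> r} \<in> sets (lborel \<Otimes>\<^sub>M \<mu>)"
        by (intro borel_measurable_le borel_measurable_dist m1 m2 borel_measurable_const)
      then have "indicator {z. dist (proj A (fst z) x) (proj A (fst z) (snd z)) \<le> r} \<in> borel_measurable (lborel \<Otimes>\<^sub>M \<mu>)"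
        by (intro borel_measurable_indicator) (simp add: space_pair_measure)
      moreover have "(\<lambda>z. indicator (cball 0 \<rho>) (fst z) :: ennreal) \<in> borel_measurable (lborel \<Otimes>\<^sub>M \<mu>)"
        by (intro measurable_compose[OF measurable_fst] borel_measurable_indicator) simp
      ultimately show ?thesis unfolding f_def by (intro borel_measurable_times_ennreal) simp_all
    qed
    have meas_y: "(\<lambda>y. proj A a y) \<in> borel_measurable borel" for a by (rule measurable_proj)
    have "(\<integral>\<^sup>+a. indicator (cball 0 \<rho>) a * mass r (a, x) \<partial>lborel) = (\<integral>\<^sup>+a. \<integral>\<^sup>+y. f a y \<partial>\<mu> \<partial>lborel)"
    proof (rule nn_integral_cong)
      fix a
      have "{y. dist (proj A a x) (proj A a y) \<le> r} \<in> sets borel"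
        using borel_measurable_le[OF borel_measurable_dist[OF borel_measurable_const meas_y] borel_measurable_const, of "proj A a x" a r]
        by simp
      then have "(\<integral>\<^sup>+y. f a y \<partial>\<mu>) = indicator (cball 0 \<rho>) a * (\<integral>\<^sup>+y. indicator {y. dist (proj A a x) (proj A a y) \<le> r} y \<partial>\<mu>)"
        unfolding f_def by (subst nn_integral_cmult[symmetric]) (auto simp: sets_eq indicator_def intro!: nn_integral_cong)
      also have "(\<integral>\<^sup>+y. indicator {y. dist (proj A a x) (proj A a y) \<le> r} y \<partial>\<mu>) = mass r (a, x)"
        using \<open>{y. dist (proj A a x) (proj A a y) \<le> r} \<in> sets borel\<close>
        by (subst nn_integral_indicator) (auto simp: sets_eq mass_def)
      finally show "indicator (cball 0 \<rho>) a * mass r (a, x) = (\<integral>\<^sup>+y. f a y \<partial>\<mu>)" by simp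
    qed
    also have "\<dots> = (\<integral>\<^sup>+y. \<integral>\<^sup>+a. f a y \<partial>lborel \<partial>\<mu>)"
      by (rule Fubini'[symmetric]) (use fm in \<open>simp add: case_prod_beta'\<close>)
    also have "\<dots> = (\<integral>\<^sup>+y. emeasure lborel (S r y) \<partial>\<mu>)"
    proof (rule nn_integral_cong)
      fix y
      have "closed (cball 0 \<rho> \<inter> {a. dist (proj A a x) (proj A a y) \<le> r})"
        by (intro closed_Int closed_cball closed_Collect_le continuous_on_dist continuous_proj_translation continuous_on_const)
      moreover have "S r y = cball 0 \<rho> \<inter> {a. dist (proj A a x) (proj A a y) \<le> r}" by (auto simp: S_def)
      ultimately have "S r y \<in> sets lborel" by (simp add: borel_closed)
      then have "emeasure lborel (S r y) = (\<integral>\<^sup>+a. indicator (S r y) a \<partial>lborel)" by simp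
      also have "\<dots> = (\<integral>\<^sup>+a. f a y \<partial>lborel)"
        by (intro nn_integral_cong) (auto simp: f_def S_def indicator_def)
      finally show "(\<integral>\<^sup>+a. f a y \<partial>lborel) = emeasure lborel (S r y)" by simp
    qed
    also have "\<dots> \<le> (\<integral>\<^sup>+y. (\<Sum>n. ennreal ((2 * r) powr u / g n) * V * indicator (cylinder (init_word n x)) y) \<partial>\<mu>)"
    proof (rule nn_integral_mono_AE)
      have "AE y in \<mu>. y \<notin> {x}"
        using point by (intro AE_not_in) (auto simp: null_sets_def sets_eq singleton)
      then show "AE y in \<mu>. emeasure lborel (S r y)
          \<le> (\<Sum>n. ennreal ((2 * r) powr u / g n) * V * indicator (cylinder (init_word n x)) y)"
      proof eventually_elim
        case (elim y)
        then have "\<exists>n. x n \<noteq> y n" by auto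
        define n where "n = (LEAST n. x n \<noteq> y n)"
        have n: "x n \<noteq> y n" unfolding n_def by (rule LeastI_ex) fact
        have eq: "init_word n x = init_word n y"
          unfolding init_word_eq_iff n_def by (meson not_less_Least)
        have "ennreal (g n) * emeasure lborel (S r y) \<le> ennreal ((2 * r) powr u) * V"
          unfolding g_def S_def V_def by (rule transversality[OF eq n r])
        then have "ennreal (1 / g n) * (ennreal (g n) * emeasure lborel (S r y))
            \<le> ennreal (1 / g n) * (ennreal ((2 * r) powr u) * V)" by (rule mult_left_mono) simp
        moreover have "ennreal (1 / g n) * (ennreal (g n) * emeasure lborel (S r y)) = emeasure lborel (S r y)"
          using g[of n] by (simp flip: mult.assoc ennreal_mult')
        moreover have "ennreal (1 / g n) * (ennreal ((2 * r) powr u) * V) = ennreal ((2 * r) powr u / g n) * V"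
          using g(1)[of n] by (simp add: mult.assoc[symmetric] ennreal_mult[symmetric])
        ultimately have "emeasure lborel (S r y) \<le> ennreal ((2 * r) powr u / g n) * V" by simp
        also have "\<dots> = ennreal ((2 * r) powr u / g n) * V * indicator (cylinder (init_word n x)) y"
          using eq by (simp add: cylinder_def)
        also have "\<dots> \<le> (\<Sum>n. ennreal ((2 * r) powr u / g n) * V * indicator (cylinder (init_word n x)) y)"
        proof -
          define h where "h k = ennreal ((2 * r) powr u / g k) * V * indicator (cylinder (init_word k x)) y" for k
          have "h n \<le> suminf h" using sum_le_suminf[of h "{n}"] by simp
          then show ?thesis by (simp only: h_def[abs_def])
        qed
        finally show ?case .
      qed
    qed
    also have "\<dots> = (\<Sum>n. ennreal ((2 * r) powr u / g n) * V * emeasure \<mu> (cylinder (init_word n x)))"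
      by (subst nn_integral_suminf) (auto simp: sets_eq nn_integral_cmult)
    also have "\<dots> \<le> (\<Sum>n. ennreal ((2 * r) powr u) * V * ennreal (B * \<theta> ^ n))"
    proof (intro suminf_le allI)
      fix n
      have "ennreal ((2 * r) powr u / g n) * V * emeasure \<mu> (cylinder (init_word n x))
          = V * ennreal ((2 * r) powr u / g n * p (init_word n x))"
      proof -
        have "ennreal ((2 * r) powr u / g n) * ennreal (p (init_word n x)) = ennreal ((2 * r) powr u / g n * p (init_word n x))"
          using g(1)[of n] by (intro ennreal_mult[symmetric]) auto
        then show ?thesis unfolding emeasure_eq_measure by (metis mult.assoc mult.commute)
      qed
      also have "\<dots> \<le> V * ennreal ((2 * r) powr u * (B * \<theta> ^ n))"
      proof (intro mult_left_mono ennreal_leI)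
        have "(2 * r) powr u / g n * p (init_word n x) \<le> (2 * r) powr u / g n * (B * \<theta> ^ n * g n)"
          using loc[of n] g(1)[of n] by (intro mult_left_mono) (auto simp: g_def)
        then show "(2 * r) powr u / g n * p (init_word n x) \<le> (2 * r) powr u * (B * \<theta> ^ n)"
          using g(1)[of n] by simp
      qed simp
      also have "\<dots> = ennreal ((2 * r) powr u) * V * ennreal (B * \<theta> ^ n)"
        using B \<theta> by (simp add: ennreal_mult mult_ac)
      finally show "ennreal ((2 * r) powr u / g n) * V * emeasure \<mu> (cylinder (init_word n x))
          \<le> ennreal ((2 * r) powr u) * V * ennreal (B * \<theta> ^ n)" .
    qed auto
    also have "\<dots> = ennreal ((2 * r) powr u) * V * (\<Sum>n. ennreal (B * \<theta> ^ n))" by simp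
    also have "(\<Sum>n. ennreal (B * \<theta> ^ n)) = ennreal (B / (1 - \<theta>))"
    proof -
      have "(\<lambda>n. B * \<theta> ^ n) sums (B * (1 / (1 - \<theta>)))" using \<theta> by (intro sums_mult geometric_sums) simp
      then show ?thesis using B \<theta> by (subst suminf_ennreal_eq) auto
    qed
    also have "ennreal ((2 * r) powr u) = ennreal (2 powr u) * ennreal (r powr u)"
      using r by (simp add: powr_mult ennreal_mult)
    finally show ?thesis by (simp add: mult_ac)
  qed
  moreover have "ennreal (2 powr u) * V * ennreal (B / (1 - \<theta>)) < top"
    using V by (simp add: ennreal_mult_less_top)
  ultimately show ?thesis using that by blast
qed

end

section \<open>Dimension of the projections\<close>

context projected_measure begin

text \<open>
  Summing the averages over dyadic radii with the weights \<open>2^(k t)\<close> still gives a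
  finite value, since \<open>t < u\<close>. So the weighted sum \<open>W\<close> is finite for
  almost every parameter, and Fubini's theorem exchanges the quantifiers over parameters and
  points.
\<close>
lemma AE_finite_energy:
  assumes t: "0 \<le> t" "t < u" "u < real CARD('d)" and inv: "\<And>i. invertible (A i)"
    and \<theta>: "0 < \<theta>" "\<theta> < 1"
    and loc: "AE x in \<mu>. \<exists>B. 0 \<le> B \<and> (\<forall>n. p (init_word n x) \<le> B * \<theta> ^ n * cover_content u (word_mat A (init_word n x)))"
  shows "AE a in lborel. AE x in \<mu>. \<exists>C::nat. \<forall>k. mass ((1 / 2) ^ k) (a, x) \<le> ennreal (real C * ((1 / 2) ^ k) powr t)"
proof -
  interpret pair_sigma_finite "lborel :: (real^'d, 'i) vec measure" \<mu> ..
  define c where "c k = ennreal (1 / ((1 / 2) ^ k) powr t)" for k :: nat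
  define W where "W z = (\<Sum>k. c k * mass ((1 / 2) ^ k) z)" for z
  have W_meas: "W \<in> borel_measurable (borel \<Otimes>\<^sub>M borel)"
    unfolding W_def[abs_def] by measurable
  have sect: "(\<lambda>a. f (a, x)) \<in> borel_measurable borel"
    if "f \<in> borel_measurable (borel \<Otimes>\<^sub>M borel)" for f :: "(real^'d, 'i) vec \<times> (nat \<Rightarrow> 'i) \<Rightarrow> ennreal" and x
    by (rule measurable_compose[OF _ that]) simp
  have "AE x in \<mu>. AE a in lborel. W (a, x) \<noteq> \<infinity>"
    using loc
  proof eventually_elim
    case (elim x)
    then obtain B where B: "0 \<le> B" "\<And>n. p (init_word n x) \<le> B * \<theta> ^ n * cover_content u (word_mat A (init_word n x))"
      by blast
    have "AE a in lborel. indicator (cball 0 (real N)) a * W (a, x) \<noteq> \<infinity>" for N :: nat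
    proof (rule nn_integral_PInf_AE)
      show "(\<lambda>a. indicator (cball 0 (real N)) a * W (a, x)) \<in> borel_measurable lborel"
        using sect[OF W_meas] by (intro borel_measurable_times_ennreal borel_measurable_indicator) simp_all
      obtain M where M: "M < top" "\<And>r. 0 < r \<Longrightarrow>
          (\<integral>\<^sup>+a. indicator (cball 0 (real N)) a * mass r (a, x) \<partial>lborel) \<le> M * ennreal (r powr u)"
        using integral_mass_bound[of u \<theta> B x "real N"] t inv \<theta> B by auto
      define q where "q = (1 / 2 :: real) powr (u - t)"
      have q: "0 < q" "q < 1" using t by (auto simp: q_def powr_divide gr_one_powr)
      have "(\<integral>\<^sup>+a. indicator (cball 0 (real N)) a * W (a, x) \<partial>lborel)
          = (\<integral>\<^sup>+a. (\<Sum>k. c k * (indicator (cball 0 (real N)) a * mass ((1 / 2) ^ k) (a, x))) \<partial>lborel)"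
        by (intro nn_integral_cong) (simp add: W_def mult.left_commute flip: ennreal_suminf_cmult)
      also have "\<dots> = (\<Sum>k. c k * (\<integral>\<^sup>+a. indicator (cball 0 (real N)) a * mass ((1 / 2) ^ k) (a, x) \<partial>lborel))"
      proof -
        have m: "(\<lambda>a. indicator (cball 0 (real N)) a * mass ((1 / 2) ^ k) (a, x)) \<in> borel_measurable lborel" for k
          using sect[OF measurable_mass] by (intro borel_measurable_times_ennreal borel_measurable_indicator) simp_all
        show ?thesis using m
          by (subst nn_integral_suminf) (auto simp: nn_integral_cmult)
      qed
      also have "\<dots> \<le> (\<Sum>k. M * ennreal (q ^ k))"
      proof (intro suminf_le allI)
        fix k :: nat
        have "c k * (\<integral>\<^sup>+a. indicator (cball 0 (real N)) a * mass ((1 / 2) ^ k) (a, x) \<partial>lborel)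
            \<le> c k * (M * ennreal (((1 / 2) ^ k) powr u))"
          by (intro mult_left_mono M(2)) auto
        also have "\<dots> = M * (ennreal (1 / ((1 / 2) ^ k) powr t) * ennreal (((1 / 2) ^ k) powr u))"
          by (simp add: c_def mult.left_commute)
        also have "ennreal (1 / ((1 / 2) ^ k) powr t) * ennreal (((1 / 2) ^ k) powr u) = ennreal (q ^ k)"
        proof -
          have "1 / ((1 / 2 :: real) ^ k) powr t * ((1 / 2) ^ k) powr u = ((1 / 2) ^ k) powr (u - t)"
            by (simp add: powr_diff)
          also have "\<dots> = q ^ k"
            unfolding q_def by (simp add: powr_realpow[symmetric] powr_powr mult.commute del: powr_realpow)
          finally have e: "1 / ((1 / 2 :: real) ^ k) powr t * ((1 / 2) ^ k) powr u = q ^ k" .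
          have "ennreal (1 / ((1 / 2) ^ k) powr t) * ennreal (((1 / 2) ^ k) powr u)
              = ennreal (1 / ((1 / 2 :: real) ^ k) powr t * ((1 / 2) ^ k) powr u)"
            by (rule ennreal_mult[symmetric]) auto
          then show ?thesis by (simp only: e)
        qed
        finally show "c k * (\<integral>\<^sup>+a. indicator (cball 0 (real N)) a * mass ((1 / 2) ^ k) (a, x) \<partial>lborel)
            \<le> M * ennreal (q ^ k)" .
      qed auto
      also have "\<dots> = M * (\<Sum>k. ennreal (q ^ k))" by simp
      also have "(\<Sum>k. ennreal (q ^ k)) = ennreal (1 / (1 - q))"
        using q geometric_sums[of q] by (subst suminf_ennreal_eq) auto
      also have "M * ennreal (1 / (1 - q)) < top" using M(1) by (simp add: ennreal_mult_less_top)
      finally show "(\<integral>\<^sup>+a. indicator (cball 0 (real N)) a * W (a, x) \<partial>lborel) \<noteq> \<infinity>" by simp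
    qed
    then have "AE a in lborel. \<forall>N::nat. indicator (cball 0 (real N)) a * W (a, x) \<noteq> \<infinity>"
      by (simp add: AE_all_countable)
    then show ?case
    proof eventually_elim
      case (elim a)
      obtain N :: nat where "norm a \<le> real N" using real_arch_simple by blast
      then show ?case using elim[rule_format, of N] by simp
    qed
  qed
  moreover have "{z \<in> space (lborel \<Otimes>\<^sub>M \<mu>). W (fst z, snd z) \<noteq> \<infinity>} \<in> sets (lborel \<Otimes>\<^sub>M \<mu>)"
  proof -
    have eq: "sets ((lborel :: (real^'d, 'i) vec measure) \<Otimes>\<^sub>M \<mu>) = sets (borel \<Otimes>\<^sub>M borel)"
      by (intro sets_pair_measure_cong) (simp_all add: sets_eq)
    have "{z \<in> space (borel \<Otimes>\<^sub>M borel). W z \<noteq> \<infinity>} \<in> sets (borel \<Otimes>\<^sub>M borel)"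
      using W_meas by measurable
    then show ?thesis unfolding eq by (simp add: space_pair_measure)
  qed
  ultimately have "AE a in lborel. AE x in \<mu>. W (a, x) \<noteq> \<infinity>"
    using AE_commute[of "\<lambda>a x. W (a, x) \<noteq> \<infinity>"] by blast
  then show ?thesis
  proof eventually_elim
    case (elim a)
    then show ?case
    proof eventually_elim
      case (elim x)
      then obtain w where w: "0 \<le> w" "W (a, x) = ennreal w" by (cases "W (a, x)") auto
      obtain C :: nat where C: "w \<le> real C" using real_arch_simple by blast
      have "mass ((1 / 2) ^ k) (a, x) \<le> ennreal (real C * ((1 / 2) ^ k) powr t)" for k
      proof -
        define b where "b = ((1 / 2 :: real) ^ k) powr t"
        have b: "0 < b" by (simp add: b_def)
        have "c k * mass ((1 / 2) ^ k) (a, x) \<le> W (a, x)"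
          unfolding W_def using sum_le_suminf[of "\<lambda>k. c k * mass ((1 / 2) ^ k) (a, x)" "{k}"] by simp
        also have "\<dots> \<le> ennreal (real C)" unfolding w using C by (rule ennreal_leI)
        finally have "ennreal b * (ennreal (1 / b) * mass ((1 / 2) ^ k) (a, x)) \<le> ennreal b * ennreal (real C)"
          unfolding c_def b_def[symmetric] by (rule mult_left_mono) simp
        moreover have "ennreal b * (ennreal (1 / b) * mass ((1 / 2) ^ k) (a, x)) = mass ((1 / 2) ^ k) (a, x)"
          using b by (simp flip: mult.assoc ennreal_mult')
        ultimately show ?thesis using b by (simp add: b_def mult.commute flip: ennreal_mult)
      qed
      then show ?case by blast
    qed
  qed
qed

lemma emeasure_distr_cball:
  "emeasure (distr \<mu> borel (proj A a)) (cball (proj A a x) r) = mass r (a, x)"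
  by (subst emeasure_distr) (auto simp: mass_def vimage_def intro!: borel_closed)

text \<open>
  A set \<open>B\<close> of positive measure contains a subset of positive measure on which the
  constant \<open>C\<close> of the local bound is fixed, and the mass distribution principle
  applies to this subset.
\<close>
lemma hausdorff_dim_distr_ge:
  assumes t: "0 \<le> t"
    and loc: "AE x in \<mu>. \<exists>C::nat. \<forall>k. mass ((1 / 2) ^ k) (a, x) \<le> ennreal (real C * ((1 / 2) ^ k) powr t)"
  shows "ennreal t \<le> hausdorff_dim_measure (distr \<mu> borel (proj A a))"
  unfolding hausdorff_dim_measure_def
proof (rule INF_greatest)
  define m where "m = distr \<mu> borel (proj A a)"
  fix B assume "B \<in> {B \<in> sets borel. 0 < emeasure (distr \<mu> borel (proj A a)) B}"
  then have B: "B \<in> sets borel" "0 < emeasure m B" by (auto simp: m_def)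
  interpret m: prob_space m unfolding m_def by (rule prob_space_distr) simp
  have sets_m: "sets m = sets borel" by (simp add: m_def)
  define good where "good C = {z. \<forall>k. emeasure m (cball z ((1 / 2) ^ k)) \<le> ennreal (real C * ((1 / 2) ^ k) powr t)}" for C :: nat
  have cball_meas: "(\<lambda>z. emeasure m (cball z r)) \<in> borel_measurable borel" for r
  proof -
    have "{z \<in> space (borel \<Otimes>\<^sub>M borel). dist (fst z) (snd z :: real^'d) \<le> r} \<in> sets (borel \<Otimes>\<^sub>M borel)"
      by measurable
    moreover have "{z \<in> space (borel \<Otimes>\<^sub>M borel). dist (fst z) (snd z :: real^'d) \<le> r}
        = {z. dist (fst z) (snd z) \<le> r}"
      by (simp add: space_pair_measure)
    moreover have "sets ((borel :: (real^'d) measure) \<Otimes>\<^sub>M (borel :: (real^'d) measure)) = sets (borel \<Otimes>\<^sub>M m)"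
      by (intro sets_pair_measure_cong) (simp_all add: sets_m)
    ultimately have "{z. dist (fst z) (snd z :: real^'d) \<le> r} \<in> sets (borel \<Otimes>\<^sub>M m)"
      by (simp only:)
    from m.measurable_emeasure_Pair[OF this] show ?thesis by (simp add: vimage_def cball_def)
  qed
  have good_sets: "good C \<in> sets borel" for C
  proof -
    have eq: "good C = (\<Inter>k. {z \<in> space borel. emeasure m (cball z ((1 / 2) ^ k)) \<le> ennreal (real C * ((1 / 2) ^ k) powr t)})"
      by (auto simp: good_def)
    have b: "{z \<in> space borel. emeasure m (cball z ((1 / 2) ^ k)) \<le> ennreal (real C * ((1 / 2) ^ k) powr t)} \<in> sets borel" for k
      by (intro borel_measurable_le cball_meas borel_measurable_const)
    show ?thesis unfolding eq by (rule sets.countable_INT''[OF _ _ b]) auto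
  qed
  have AE_good: "AE z in m. \<exists>C. z \<in> good C"
  proof -
    have "AE x in \<mu>. \<exists>C. proj A a x \<in> good C"
      using loc by eventually_elim (simp add: good_def m_def emeasure_distr_cball)
    moreover have "{z. \<exists>C. z \<in> good C} \<in> sets borel"
    proof -
      have "{z. \<exists>C. z \<in> good C} = (\<Union>C. good C)" by auto
      then show ?thesis using good_sets by auto
    qed
    ultimately show ?thesis unfolding m_def by (subst AE_distr_iff) auto
  qed
  have "\<exists>C. 0 < emeasure m (B \<inter> good C)"
  proof (rule ccontr)
    assume "\<not> ?thesis"
    then have "emeasure m (B \<inter> good C) = 0" for C by (auto simp: not_less)
    then have "AE z in m. z \<notin> B \<inter> good C" for C
      using B good_sets by (intro AE_not_in) (auto simp: null_sets_def sets_m)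
    then have "AE z in m. \<forall>C. z \<notin> B \<inter> good C" unfolding AE_all_countable by (rule allI)
    with AE_good have "AE z in m. z \<notin> B" by eventually_elim auto
    then have "emeasure m B = 0"
      using B by (subst (asm) AE_iff_measurable[of B]) (auto simp: sets_m m_def)
    then show False using B by simp
  qed
  then obtain C where C: "0 < emeasure m (B \<inter> good C)" by blast
  show "ennreal t \<le> hausdorff_dim B"
  proof (rule mass_distribution_principle[where m = m and S = "B \<inter> good C" and C = "real C"])
    show "finite_measure m" by (rule m.finite_measure_axioms)
    fix z k assume "z \<in> B \<inter> good C"
    then have "emeasure m (cball z ((1 / 2) ^ k)) \<le> ennreal (real C * ((1 / 2) ^ k) powr t)"
      by (simp add: good_def)
    then show "measure m (cball z ((1 / 2) ^ k)) \<le> real C * ((1 / 2) ^ k) powr t"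
      by (simp add: m.emeasure_eq_measure)
  qed (use t C B good_sets sets_m in auto)
qed

end

lemma contracting_matrices_exists:
  fixes A :: "'i::{finite, discrete_topology} \<Rightarrow> real^'d^'d"
  assumes "\<And>i. onorm ((*v) (A i)) < 1 / 2"
  obtains \<eta> where "contracting_matrices A \<eta>"
proof -
  define \<eta> where "\<eta> = max (1 / 4) (Max (range (\<lambda>i. onorm ((*v) (A i)))))"
  have le: "onorm ((*v) (A i)) \<le> \<eta>" for i
    unfolding \<eta>_def by (intro max.coboundedI2 Max_ge) auto
  have "Max (range (\<lambda>i. onorm ((*v) (A i)))) < 1 / 2"
    by (subst Max_less_iff) (use assms in auto)
  then have "\<eta> < 1 / 2" unfolding \<eta>_def by linarith
  moreover have "norm (A i *v v) \<le> \<eta> * norm v" for i v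
    using onorm[OF matrix_vector_mul_bounded_linear, of "A i" v] mult_right_mono[OF le[of i], of "norm v"]
    by simp
  ultimately have "contracting_matrices A \<eta>" by unfold_locales (auto simp: \<eta>_def)
  then show ?thesis by (rule that)
qed

text \<open>
  For \<open>s < d\<close> the sum of the contents over \<open>K\<^sub>n\<close> is at most
  \<open>C e^(-\<delta> n)\<close>, where the vanishing pressure accounts for a factor
  \<open>e^(\<delta> n)\<close> and the larger exponent \<open>t > s\<close> for \<open>e^(-2
  \<delta> n)\<close>.
\<close>
lemma hausdorff_dim_proj_le:
  fixes A :: "'i::{finite, discrete_topology} \<Rightarrow> real^'d^'d"
  assumes "contracting_matrices A \<eta>" and inv: "\<And>i. invertible (A i)" and s: "0 \<le> s"
    and press: "(\<lambda>n. 1 / real n * ln (\<Sum>w\<in>init_word n ` K. sv_fun s (word_mat A w))) \<longlonglongrightarrow> 0"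
    and K: "K \<noteq> {}"
  shows "hausdorff_dim (proj A a ` K) \<le> ennreal (min s (real CARD('d)))"
proof (rule hausdorff_dim_le)
  interpret contracting_matrices A \<eta> by fact
  fix t assume t: "min s (real CARD('d)) < t"
  then have t0: "0 < t" using s by linarith
  have "\<exists>n. (\<Sum>w\<in>init_word n ` K. cover_content t (word_mat A w)) < \<epsilon>" if \<epsilon>: "0 < \<epsilon>" for \<epsilon>
  proof (cases "s < real CARD('d)")
    case False
    then have "cover_content t (mat 1 :: real^'d^'d) = 0" using t by (intro cover_content_mat_1) auto
    moreover have "init_word 0 ` K = {[]}" using K by auto
    ultimately show ?thesis using \<epsilon> by (intro exI[of _ 0]) simp
  next
    case True
    then have st: "s < t" using t by simp
    obtain C where C: "0 < C" "\<And>(A::real^'d^'d) \<rho>. invertible A \<Longrightarrow> 0 < \<rho> \<Longrightarrow>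
      (\<And>x. norm (A *v x) \<le> \<rho> * norm x) \<Longrightarrow> cover_content t A \<le> C * \<rho> powr (t - s) * sv_fun s A"
      using cover_content_le_sv_fun_powr[OF s True less_imp_le[OF st]] by blast
    define \<delta> where "\<delta> = - (t - s) * ln \<eta> / 2"
    have \<delta>: "0 < \<delta>" using st eta by (simp add: \<delta>_def mult_neg_neg mult_less_0_iff zero_less_mult_iff)
    define c where "c = - ln (\<epsilon> / (2 * C))"
    have "\<forall>\<^sub>F n in sequentially. \<bar>ln (\<Sum>w\<in>init_word n ` K. sv_fun s (word_mat A w))\<bar> \<le> \<delta> * real n"
      by (rule exp_growth_of_limit[OF press \<delta>])
    with eventually_const_le_linear[OF \<delta>, of c]
    have "\<forall>\<^sub>F n in sequentially. (\<Sum>w\<in>init_word n ` K. cover_content t (word_mat A w)) < \<epsilon>"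
    proof eventually_elim
      case (elim n)
      define Z where "Z = (\<Sum>w\<in>init_word n ` K. sv_fun s (word_mat A w))"
      have sv0: "0 < sv_fun s (word_mat A w)" for w
        by (rule sv_fun_pos[OF invertible_word_mat[of A, OF inv] s])
      have Z0: "0 \<le> Z" unfolding Z_def by (intro sum_nonneg less_imp_le[OF sv0])
      have Z: "Z \<le> exp (\<delta> * real n)"
        using elim(2) Z0 unfolding Z_def[symmetric] by (metis abs_le_D1 exp_ge_zero exp_le_cancel_iff exp_ln order_le_less)
      have "(\<Sum>w\<in>init_word n ` K. cover_content t (word_mat A w))
          \<le> (\<Sum>w\<in>init_word n ` K. C * (\<eta> ^ n) powr (t - s) * sv_fun s (word_mat A w))"
      proof (intro sum_mono C(2) invertible_word_mat inv)
        fix w x assume "w \<in> init_word n ` K"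
        then show "norm (word_mat A w *v x) \<le> \<eta> ^ n * norm x" using norm_word_mat_le[of w x] by auto
      qed (use eta in auto)
      also have "\<dots> = C * (\<eta> ^ n) powr (t - s) * Z" by (simp add: Z_def sum_distrib_left)
      also have "\<dots> \<le> C * (\<eta> ^ n) powr (t - s) * exp (\<delta> * real n)"
        using C(1) Z by (intro mult_left_mono) auto
      also have "(\<eta> ^ n) powr (t - s) = exp (- 2 * \<delta> * real n)"
        using eta by (simp add: powr_def ln_realpow \<delta>_def algebra_simps)
      also have "C * exp (- 2 * \<delta> * real n) * exp (\<delta> * real n) = C * exp (- \<delta> * real n)"
        by (simp add: mult.assoc flip: exp_add)
      also have "\<dots> \<le> C * exp (- c)" using C(1) elim(1) by simp
      also have "\<dots> = \<epsilon> / 2" using C(1) \<epsilon> by (simp add: c_def)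
      also have "\<dots> < \<epsilon>" using \<epsilon> by simp
      finally show ?case .
    qed
    then show ?thesis by (auto simp: eventually_sequentially)
  qed
  then show "hausdorff_measure t (proj A a ` K) = 0" by (rule hausdorff_measure_proj_zero[OF t0])
qed (use s in auto)

theorem theorem5p2:
  fixes A :: "'i::{finite, discrete_topology} \<Rightarrow> real^'d^'d"
    and K :: "(nat \<Rightarrow> 'i) set"
    and s :: real
    and \<mu> :: "(nat \<Rightarrow> 'i) measure"
  assumes "CARD('i) \<ge> 2"
    and "\<And>i. invertible (A i)"
    and "\<And>i. onorm ((*v) (A i)) < 1 / 2"
    and "K \<noteq> {}"
    and "compact K"
    and "shift ` K \<subseteq> K"
    and "s \<ge> 0"
    and "pressure A K s = 0"
    and "equilibrium_measure A K s \<mu>"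
    and "ergodic \<mu>"
  shows "AE a :: real^'d^('i::{finite, discrete_topology}) in lebesgue.
           hausdorff_dim (proj A a ` K) = ennreal (min s (real CARD('d))) \<and>
           hausdorff_dim_measure (distr \<mu> borel (proj A a)) = ennreal (min s (real CARD('d)))"
proof -
  obtain \<eta> where \<eta>: "contracting_matrices A \<eta>" using contracting_matrices_exists assms(3) by blast
  have inv: "\<And>i. invertible (A i)" by fact
  have "\<mu> \<in> invariant_measures K" using assms(9) by (simp add: equilibrium_measure_def)
  then have \<mu>: "prob_space \<mu>" "sets \<mu> = sets borel" "distr \<mu> borel shift = \<mu>" "measure_support \<mu> \<subseteq> K"
    unfolding invariant_measures_def mem_Collect_eq by blast+
  interpret contracting_matrices A \<eta> by fact
  interpret shift_invariant \<mu>
    by (rule shift_invariant.intro[OF \<mu>(1) shift_invariant_axioms.intro[OF \<mu>(2,3)]])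
  interpret projected_measure A \<eta> \<mu> by (rule projected_measure.intro) unfold_locales
  define \<phi> where "\<phi> = (\<lambda>w. sv_fun s (word_mat A w))"
  obtain C c where qs: "quasi_submultiplicative \<phi> C c"
    unfolding \<phi>_def by (rule sv_fun_quasi_submultiplicative[OF inv \<open>s \<ge> 0\<close>])
  have press: "(\<lambda>n. 1 / real n * ln (\<Sum>w\<in>init_word n ` K. \<phi> w)) \<longlonglongrightarrow> 0"
    using quasi_submultiplicative.pressure_convergent[OF qs \<open>K \<noteq> {}\<close> \<open>shift ` K \<subseteq> K\<close>] \<open>pressure A K s = 0\<close>
    by (simp add: convergent_LIMSEQ_iff pressure_def \<phi>_def)
  have ent: "(\<lambda>n. 1 / real n * (\<Sum>w\<in>words n. H (p w))) \<longlonglongrightarrow> entropy \<mu>"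
    using entropy_convergent by (simp add: convergent_LIMSEQ_iff entropy_def)
  have ener: "(\<lambda>n. 1 / real n * (\<Sum>w\<in>words n. p w * ln (\<phi> w))) \<longlonglongrightarrow> - entropy \<mu>"
  proof -
    have "energy A s \<mu> = - entropy \<mu>"
      using assms(8,9) by (simp add: equilibrium_measure_def)
    then show ?thesis
      using energy_convergent[OF qs] by (simp add: convergent_LIMSEQ_iff energy_def \<phi>_def)
  qed
  define D where "D = min s (real CARD('d))"
  have lower: "AE a in lborel. ennreal t \<le> hausdorff_dim_measure (distr \<mu> borel (proj A a))"
    if t: "0 \<le> t" "t < D" for t
  proof -
    \<comment> \<open>An intermediate exponent: \<open>u < s\<close> yields decay along words, and
    \<open>t < u\<close> convergence over dyadic radii.\<close>
    define u where "u = (t + D) / 2"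
    have u: "t < u" "u < D" "0 < u" "u < real CARD('d)" "u < s" using t by (auto simp: u_def D_def)
    obtain C1 where C1: "0 < C1" "\<And>(A::real^'d^'d) \<rho>. invertible A \<Longrightarrow> 0 < \<rho> \<Longrightarrow>
      (\<And>x. norm (A *v x) \<le> \<rho> * norm x) \<Longrightarrow> sv_fun s A \<le> C1 * \<rho> powr (s - u) * cover_content u A"
      using sv_fun_le_cover_content[OF less_imp_le[OF u(3)] u(4) less_imp_le[OF u(5)]] by blast
    \<comment> \<open>Half of the gain \<open>\<eta>^(n (s - u)) = e^(- 2 \<epsilon> n)\<close> is
    spent on the error \<open>e^(\<epsilon> n)\<close> of the local bound.\<close>
    define \<epsilon> where "\<epsilon> = - (s - u) * ln \<eta> / 2"
    have \<epsilon>: "0 < \<epsilon>" using u eta by (simp add: \<epsilon>_def mult_less_0_iff zero_less_mult_iff)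
    have "AE x in \<mu>. \<exists>B. 0 \<le> B \<and> (\<forall>n. p (init_word n x) \<le> B * exp (- \<epsilon>) ^ n * cover_content u (word_mat A (init_word n x)))"
      using equilibrium_measure_local_bound[OF qs \<open>ergodic \<mu>\<close> \<mu>(4) press ent ener \<epsilon>]
    proof eventually_elim
      case (elim x)
      then obtain B where B: "\<And>n. p (init_word n x) \<le> B * exp (\<epsilon> * n) * \<phi> (init_word n x)" by blast
      have "p (init_word n x) \<le> \<bar>B\<bar> * C1 * exp (- \<epsilon>) ^ n * cover_content u (word_mat A (init_word n x))" for n
      proof -
        have \<phi>0: "0 \<le> \<phi> (init_word n x)"
          unfolding \<phi>_def
          by (rule less_imp_le[OF sv_fun_pos[OF invertible_word_mat[of A, OF inv] \<open>s \<ge> 0\<close>]])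
        have "p (init_word n x) \<le> \<bar>B\<bar> * exp (\<epsilon> * n) * \<phi> (init_word n x)"
          by (rule order_trans[OF B]) (intro mult_right_mono \<phi>0; simp)
        also have "\<phi> (init_word n x) \<le> C1 * (\<eta> ^ n) powr (s - u) * cover_content u (word_mat A (init_word n x))"
          unfolding \<phi>_def using norm_word_mat_le[of "init_word n x"] eta
          by (intro C1(2) invertible_word_mat inv) auto
        also have "(\<eta> ^ n) powr (s - u) = exp (- 2 * \<epsilon> * n)"
          using eta by (simp add: powr_def ln_realpow \<epsilon>_def algebra_simps)
        also have "\<bar>B\<bar> * exp (\<epsilon> * n) * (C1 * exp (- 2 * \<epsilon> * n) * cover_content u (word_mat A (init_word n x)))
            = \<bar>B\<bar> * C1 * (exp (\<epsilon> * n) * exp (- 2 * \<epsilon> * n)) * cover_content u (word_mat A (init_word n x))"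
          by (simp only: mult_ac)
        also have "exp (\<epsilon> * n) * exp (- 2 * \<epsilon> * n) = exp (- \<epsilon>) ^ n"
          by (simp add: mult.commute flip: exp_add exp_of_nat_mult)
        finally show ?thesis by (simp add: mult_left_mono)
      qed
      then show ?case using C1(1) by (intro exI[of _ "\<bar>B\<bar> * C1"]) auto
    qed
    then have "AE a in lborel. AE x in \<mu>. \<exists>C::nat. \<forall>k. mass ((1 / 2) ^ k) (a, x) \<le> ennreal (real C * ((1 / 2) ^ k) powr t)"
      using t u \<epsilon> inv by (intro AE_finite_energy[of t u "exp (- \<epsilon>)"]) auto
    then show ?thesis by eventually_elim (rule hausdorff_dim_distr_ge[OF t(1)])
  qed
  have D0: "0 \<le> D" using \<open>s \<ge> 0\<close> by (simp add: D_def)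
  have lower': "AE a in lborel. ennreal D \<le> hausdorff_dim_measure (distr \<mu> borel (proj A a))"
  proof (cases "D = 0")
    case False
    define t where "t k = D - D / real (Suc k)" for k
    have t: "0 \<le> t k" "t k < D" for k using D0 False by (auto simp: t_def field_simps)
    have "AE a in lborel. \<forall>k. ennreal (t k) \<le> hausdorff_dim_measure (distr \<mu> borel (proj A a))"
      unfolding AE_all_countable using lower t by blast
    then show ?thesis
    proof eventually_elim
      case (elim a)
      have "(\<lambda>k. D - D * inverse (real (Suc k))) \<longlonglongrightarrow> D - D * 0"
        by (intro tendsto_intros LIMSEQ_inverse_real_of_nat)
      then have "t \<longlonglongrightarrow> D" by (simp add: t_def[abs_def] divide_inverse)
      then have "(\<lambda>k. ennreal (t k)) \<longlonglongrightarrow> ennreal D" by (rule tendsto_ennrealI)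
      then show ?case by (rule LIMSEQ_le_const2) (use elim in auto)
    qed
  qed simp
  have upper: "hausdorff_dim (proj A a ` K) \<le> ennreal D" for a
    unfolding D_def using hausdorff_dim_proj_le[OF \<eta> inv \<open>s \<ge> 0\<close> press[unfolded \<phi>_def] \<open>K \<noteq> {}\<close>] .
  have mid: "hausdorff_dim_measure (distr \<mu> borel (proj A a)) \<le> hausdorff_dim (proj A a ` K)" for a
  proof -
    have "compact (proj A a ` K)"
      using continuous_proj continuous_on_subset \<open>compact K\<close> by (intro compact_continuous_image) blast+
    then have E: "proj A a ` K \<in> sets borel" by (simp add: borel_compact)
    have "AE x in \<mu>. x \<in> proj A a -` (proj A a ` K)"
      using AE_in_support by eventually_elim (use \<mu>(4) in blast)
    moreover have V: "proj A a -` (proj A a ` K) \<in> sets \<mu>"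
      using measurable_sets[OF measurable_proj E] by (simp add: sets_eq)
    ultimately have "emeasure \<mu> (proj A a -` (proj A a ` K)) = 1"
      by (subst emeasure_eq_1_AE) auto
    then have "0 < emeasure (distr \<mu> borel (proj A a)) (proj A a ` K)"
      using E by (subst emeasure_distr) auto
    then show ?thesis unfolding hausdorff_dim_measure_def using E by (intro INF_lower) auto
  qed
  have "AE a in lborel. hausdorff_dim (proj A a ` K) = ennreal D \<and>
           hausdorff_dim_measure (distr \<mu> borel (proj A a)) = ennreal D"
    using lower'
  proof eventually_elim
    case (elim a)
    have "ennreal D \<le> hausdorff_dim (proj A a ` K)"
      "hausdorff_dim_measure (distr \<mu> borel (proj A a)) \<le> ennreal D"
      using order_trans[OF elim mid] order_trans[OF mid upper] by blast+
    with elim upper[of a] show ?case by (intro conjI antisym)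
  qed
  then show ?thesis unfolding D_def by (rule AE_completion)
qed

end
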